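(* Let $\mathcal S:=\Theta\times\Xi\subset\mathbb R^n_+\times\mathbb S^n_{++}$ be nonempty and compact, and let $\mu_1,\mu_2$ be Borel probability measures on $\mathbb R^n$ that admit mixing laws over $\mathcal S$, i.e. there are Borel probability measures $\eta_1,\eta_2$ on $\mathcal S$ with $\mu_i(C)=\int_{\mathcal S}\mathcal N(s)(C)\,d\eta_i(s)$ for all Borel $C\subseteq\mathbb R^n$, $i=1,2$. Define $$\Gamma_{\mathcal S}:=\Bigl\{\pi\in\mathcal P(\mathcal S\times\mathcal S):\int_{\mathcal S}\mathcal N(s)(A)\,d\pi_1(s)=\mu_1(A),\ \int_{\mathcal S}\mathcal N(s)(B)\,d\pi_2(s)=\mu_2(B)\ \ \forall A,B\in\mathcal B(\mathbb R^n)\Bigr\},$$ $$W_{2,\mathcal S}^{\mathrm{prm}}(\mu_1,\mu_2):=\inf_{\pi\in\Gamma_{\mathcal S}}\int_{\mathcal S\times\mathcal S}d_{\mathrm{BW}}^2(\mathcal N(s_1),\mathcal N(s_2))\,d\pi(s_1,s_2),$$ $$W_{2,\mathcal S}^{\mathrm{mix}}(\mu_1,\mu_2):=\inf_{\nu\in\Pi(\mu_1,\mu_2)\cap\mathbb{GM}_{2n}^{\mathcal S}}\int_{\mathbb R^n\times\mathbb R^n}\|y_1-y_2\|_2^2\,d\nu(y_1,y_2).$$ Then $\Pi(\mu_1,\mu_2)\cap\mathbb{GM}_{2n}^{\mathcal S}$ is nonempty and the infimum defining $W_{2,\mathcal S}^{\mathrm{mix}}(\mu_1,\mu_2)$ is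 attained. Additionally, every $\pi\in\Gamma_{\mathcal S}$ has finite second moment, and $$W_{2,\mathcal S}^{\mathrm{mix}}(\mu_1,\mu_2)=W_{2,\mathcal S}^{\mathrm{prm}}(\mu_1,\mu_2).$$
   Context: $\mathbb S^n_{++}$ and $\mathbb S^n_+$ are the symmetric positive definite and positive semidefinite $n\times n$ matrices; $\mathcal P(\cdot)$ denotes Borel probability measures, $\mathcal B(\cdot)$ Borel sets; $\pi_1,\pi_2$ are the marginals of $\pi$. For $s=(m,Q)$, $\mathcal N(s)$ is the Gaussian law on $\mathbb R^n$ with mean $m$, covariance $Q$. For $s_i=(m_i,Q_i)$, $d_{\mathrm{BW}}^2(\mathcal N(s_1),\mathcal N(s_2))=\|m_1-m_2\|^2+\operatorname{tr}(Q_1+Q_2-2(Q_1^{1/2}Q_2Q_1^{1/2})^{1/2})$. $\Pi(\mu_1,\mu_2)$ is the set of couplings of $\mu_1,\mu_2$. "Finite second moment" of $\pi$ means $\int(\|m_1\|^2+\|Q_1\|_F^2+\|m_2\|^2+\|Q_2\|_F^2)\,d\pi<\infty$. Writing $Q\in\mathbb S^{2n}_+$ in $n\times n$ blocks $Q=\begin{pmatrix}Q_{11}&Q_{12}\\Q_{21}&Q_{22}\end{pmatrix}$, let $$\mathcal Z_{\mathcal S}:=\{z=((m_1,m_2),Q)\in\mathbb R^n\times\mathbb R^n\times\mathbb S^{2n}_+:(m_1,Q_{11})\in\mathcal S,\ (m_2,Q_{22})\in\mathcal S\},$$ and let $\mathcal N(z)$ be the (possibly degenerate) Gaussian law on $\mathbb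 R^{2n}$ with mean $(m_1,m_2)$ and covariance $Q$. $\mathbb{GM}_{2n}^{\mathcal S}$ is the set of $\nu\in\mathcal P(\mathbb R^{2n})$ for which there is $\lambda\in\mathcal P(\mathcal Z_{\mathcal S})$ with $\nu(A)=\int_{\mathcal Z_{\mathcal S}}\mathcal N(z)(A)\,d\lambda(z)$ for all Borel $A\subseteq\mathbb R^{2n}$. *)

theory Defs
  imports "HOL-Probability.Probability"
begin

definition nonneg_orthant :: "(real ^ 'n) set" where
  "nonneg_orthant = {m. \<forall>i. 0 \<le> m $ i}"

definition psd_matrices :: "(real ^ 'n ^ 'n) set" where
  "psd_matrices = {Q. transpose Q = Q \<and> (\<forall>x. 0 \<le> x \<bullet> (Q *v x))}"

definition pd_matrices :: "(real ^ 'n ^ 'n) set" where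
  "pd_matrices = {Q. transpose Q = Q \<and> (\<forall>x. x \<noteq> 0 \<longrightarrow> 0 < x \<bullet> (Q *v x))}"

text \<open>The principal square root; only meaningful on \<^const>\<open>psd_matrices\<close>, where it exists and
  is unique.\<close>

definition psd_sqrt :: "real ^ 'n ^ 'n \<Rightarrow> real ^ 'n ^ 'n" where
  "psd_sqrt Q = (THE R. R \<in> psd_matrices \<and> R ** R = Q)"

definition borel_probs :: "'a :: topological_space set \<Rightarrow> 'a measure set" where
  "borel_probs X = {\<mu>. prob_space \<mu> \<and> sets \<mu> = sets (restrict_space borel X)}"

text \<open>The law of \<open>m + Q\<^sup>1\<^sup>/\<^sup>2 Z\<close> with \<open>Z\<close> a vector of independent standard normal variables. This
  covers every \<open>Q\<close> in \<^const>\<open>psd_matrices\<close>, singular ones included.\<close>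

definition std_gaussian :: "(real ^ 'n) measure" where
  "std_gaussian =
     distr (\<Pi>\<^sub>M i\<in>(UNIV :: 'n set). density lborel (\<lambda>x. ennreal (std_normal_density x)))
       borel (\<lambda>f. \<chi> i. f i)"

definition gaussian :: "(real ^ 'n) \<times> (real ^ 'n ^ 'n) \<Rightarrow> (real ^ 'n) measure" where
  "gaussian s = distr std_gaussian borel (\<lambda>x. fst s + psd_sqrt (snd s) *v x)"

text \<open>The squared Bures--Wasserstein distance between \<open>gaussian s\<close> and \<open>gaussian t\<close>.\<close>

definition bw_sq :: "(real ^ 'n) \<times> (real ^ 'n ^ 'n) \<Rightarrow> (real ^ 'n) \<times> (real ^ 'n ^ 'n) \<Rightarrow> real" where
  "bw_sq s t =
     (norm (fst s - fst t))\<^sup>2 +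
     trace (snd s + snd t - 2 *\<^sub>R psd_sqrt (psd_sqrt (snd s) ** snd t ** psd_sqrt (snd s)))"

definition mixing_law ::
  "((real ^ 'n) \<times> (real ^ 'n ^ 'n)) set \<Rightarrow> (real ^ 'n) measure \<Rightarrow>
   ((real ^ 'n) \<times> (real ^ 'n ^ 'n)) measure \<Rightarrow> bool" where
  "mixing_law S \<mu> \<eta> \<longleftrightarrow>
     \<eta> \<in> borel_probs S \<and>
     (\<forall>C\<in>sets borel. emeasure \<mu> C = (\<integral>\<^sup>+ s. emeasure (gaussian s) C \<partial>\<eta>))"

definition Gamma_S ::
  "((real ^ 'n) \<times> (real ^ 'n ^ 'n)) set \<Rightarrow> (real ^ 'n) measure \<Rightarrow> (real ^ 'n) measure \<Rightarrow>
   (((real ^ 'n) \<times> (real ^ 'n ^ 'n)) \<times> ((real ^ 'n) \<times> (real ^ 'n ^ 'n))) measure set" where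
  "Gamma_S S \<mu>\<^sub>1 \<mu>\<^sub>2 =
     {\<pi> \<in> borel_probs (S \<times> S).
        (\<forall>A\<in>sets borel.
           (\<integral>\<^sup>+ s. emeasure (gaussian s) A \<partial>distr \<pi> (restrict_space borel S) fst) = emeasure \<mu>\<^sub>1 A) \<and>
        (\<forall>B\<in>sets borel.
           (\<integral>\<^sup>+ s. emeasure (gaussian s) B \<partial>distr \<pi> (restrict_space borel S) snd) = emeasure \<mu>\<^sub>2 B)}"

text \<open>The library norm on \<open>real ^ 'n ^ 'n\<close> is the Frobenius norm.\<close>

definition finite_second_moment ::
  "(((real ^ 'n) \<times> (real ^ 'n ^ 'n)) \<times> ((real ^ 'n) \<times> (real ^ 'n ^ 'n))) measure \<Rightarrow> bool" where
  "finite_second_moment \<pi> \<longleftrightarrow>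
     (\<integral>\<^sup>+ ((m\<^sub>1, Q\<^sub>1), (m\<^sub>2, Q\<^sub>2)).
        ennreal ((norm m\<^sub>1)\<^sup>2 + (norm Q\<^sub>1)\<^sup>2 + (norm m\<^sub>2)\<^sup>2 + (norm Q\<^sub>2)\<^sup>2) \<partial>\<pi>) < \<infinity>"

text \<open>The costs are nonnegative, so all transport values are taken in \<^typ>\<open>ennreal\<close>; this avoids
  the conventions for non-integrable functions and for unbounded infima in \<^typ>\<open>real\<close>.\<close>

definition W_prm ::
  "((real ^ 'n) \<times> (real ^ 'n ^ 'n)) set \<Rightarrow> (real ^ 'n) measure \<Rightarrow> (real ^ 'n) measure \<Rightarrow> ennreal" where
  "W_prm S \<mu>\<^sub>1 \<mu>\<^sub>2 =
     (INF \<pi>\<in>Gamma_S S \<mu>\<^sub>1 \<mu>\<^sub>2. \<integral>\<^sup>+ (s\<^sub>1, s\<^sub>2). ennreal (bw_sq s\<^sub>1 s\<^sub>2) \<partial>\<pi>)"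

text \<open>Points of \<open>2n\<close>-dimensional space are pairs of vectors; \<open>2n \<times> 2n\<close> matrices are indexed by
  \<open>'n + 'n\<close>, so that \<open>block Inl Inr Q\<close> is the upper right \<open>n \<times> n\<close> block of \<open>Q\<close>, etc.\<close>

definition block ::
  "('n \<Rightarrow> 'k) \<Rightarrow> ('n \<Rightarrow> 'k) \<Rightarrow> real ^ 'k ^ 'k \<Rightarrow> real ^ 'n ^ 'n" where
  "block f g Q = (\<chi> i j. Q $ f i $ g j)"

definition join_vec :: "(real ^ 'n) \<times> (real ^ 'n) \<Rightarrow> real ^ ('n + 'n)" where
  "join_vec m = (\<chi> k. case k of Inl i \<Rightarrow> fst m $ i | Inr i \<Rightarrow> snd m $ i)"

definition split_vec :: "real ^ ('n + 'n) \<Rightarrow> (real ^ 'n) \<times> (real ^ 'n)" where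
  "split_vec y = ((\<chi> i. y $ Inl i), (\<chi> i. y $ Inr i))"

definition gaussian2 ::
  "((real ^ 'n) \<times> (real ^ 'n)) \<times> (real ^ ('n + 'n) ^ ('n + 'n)) \<Rightarrow> ((real ^ 'n) \<times> (real ^ 'n)) measure" where
  "gaussian2 z = distr (gaussian (join_vec (fst z), snd z)) borel split_vec"

definition Z_S ::
  "((real ^ 'n) \<times> (real ^ 'n ^ 'n)) set \<Rightarrow>
   (((real ^ 'n) \<times> (real ^ 'n)) \<times> (real ^ ('n + 'n) ^ ('n + 'n))) set" where
  "Z_S S = {((m\<^sub>1, m\<^sub>2), Q) | m\<^sub>1 m\<^sub>2 Q.
     Q \<in> psd_matrices \<and> (m\<^sub>1, block Inl Inl Q) \<in> S \<and> (m\<^sub>2, block Inr Inr Q) \<in> S}"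

definition GM_2n ::
  "((real ^ 'n) \<times> (real ^ 'n ^ 'n)) set \<Rightarrow> ((real ^ 'n) \<times> (real ^ 'n)) measure set" where
  "GM_2n S = {\<nu> \<in> borel_probs UNIV.
     \<exists>\<Lambda>\<in>borel_probs (Z_S S).
       \<forall>A\<in>sets borel. emeasure \<nu> A = (\<integral>\<^sup>+ z. emeasure (gaussian2 z) A \<partial>\<Lambda>)}"

definition couplings ::
  "(real ^ 'n) measure \<Rightarrow> (real ^ 'n) measure \<Rightarrow> ((real ^ 'n) \<times> (real ^ 'n)) measure set" where
  "couplings \<mu>\<^sub>1 \<mu>\<^sub>2 =
     {\<nu> \<in> borel_probs UNIV. distr \<nu> borel fst = \<mu>\<^sub>1 \<and> distr \<nu> borel snd = \<mu>\<^sub>2}"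

definition transport_cost :: "((real ^ 'n) \<times> (real ^ 'n)) measure \<Rightarrow> ennreal" where
  "transport_cost \<nu> = (\<integral>\<^sup>+ (y\<^sub>1, y\<^sub>2). ennreal ((norm (y\<^sub>1 - y\<^sub>2))\<^sup>2) \<partial>\<nu>)"

definition W_mix ::
  "((real ^ 'n) \<times> (real ^ 'n ^ 'n)) set \<Rightarrow> (real ^ 'n) measure \<Rightarrow> (real ^ 'n) measure \<Rightarrow> ennreal" where
  "W_mix S \<mu>\<^sub>1 \<mu>\<^sub>2 = (INF \<nu>\<in>couplings \<mu>\<^sub>1 \<mu>\<^sub>2 \<inter> GM_2n S. transport_cost \<nu>)"

end

theory Submission
  imports Defs
begin

text \<open>
  Both values minimise the same cost, once over mixtures of Gaussian laws on pairs and once over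
  couplings of Gaussian parameters, and one can pass between the two kinds of competitors without
  raising the cost.

  A joint Gaussian with mean \<open>(m\<^sub>1, m\<^sub>2)\<close> and covariance \<open>Q\<close> has Gaussian marginals with parameters
  \<open>(m\<^sub>1, Q\<^sub>1\<^sub>1)\<close> and \<open>(m\<^sub>2, Q\<^sub>2\<^sub>2)\<close>, and its transport cost is
  \<open>(norm (m\<^sub>1 - m\<^sub>2))\<^sup>2 + trace Q\<^sub>1\<^sub>1 + trace Q\<^sub>2\<^sub>2 - 2 * trace Q\<^sub>1\<^sub>2\<close>. For given marginals the trace of \<open>Q\<^sub>1\<^sub>2\<close>
  is at most the trace of the square root in the Bures--Wasserstein formula (\<open>bures_upper_bound\<close>), with
  equality for an explicit block \<open>Q\<^sub>1\<^sub>2\<close> that depends continuously on the positive definite marginal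
  covariances (\<open>optimal_joint_cov\<close>). Sending every component of a mixture to its marginal parameters thus
  turns a mixture coupling into a parameter coupling of no larger cost, and joining every pair of
  parameters by its optimal joint covariance turns a parameter coupling into a mixture coupling of
  equal cost (\<open>mixture_coupling_to_parameter_coupling\<close>, \<open>parameter_coupling_to_mixture_coupling\<close>).

  It remains to find an optimal parameter coupling. Probability measures on the compact set \<open>S \<times> S\<close> are
  weakly sequentially compact (\<open>borel_probs_compact_subseq\<close>), the cost is continuous on \<open>S \<times> S\<close>, and the
  constraints survive weak limits (\<open>mixture_weak_limit\<close>). Weak compactness is reduced to Helly's theorem
  on the real line by a space-filling curve that has a measurable right inverse.

  That the marginals of a Gaussian law are the expected ones rests on the rotational symmetry of the
  standard Gaussian: a matrix with orthonormal rows extends to an orthogonal matrix, hence maps a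
  standard Gaussian to a standard Gaussian (\<open>std_gaussian_coisometry\<close>). The symmetry of Lebesgue measure
  behind this comes from the uniqueness of translation invariant measures.
\<close>

section \<open>Spectral theorem and principal square roots\<close>

text \<open>A maximiser \<open>v\<close> of \<open>x \<bullet> f x\<close> on the unit sphere of \<open>V\<close> is an eigenvector: if \<open>l\<close> is the
  maximum, the quadratic form \<open>q x = l * (x \<bullet> x) - x \<bullet> f x\<close> is nonnegative on \<open>V\<close> and vanishes at \<open>v\<close>,
  so \<open>v\<close> is a critical point of \<open>q\<close>, which says \<open>l *\<^sub>R v = f v\<close>.\<close>

lemma selfadjoint_eigenvector:
  fixes f :: "'a::euclidean_space \<Rightarrow> 'a"
  assumes lin: "linear f" and sa: "\<And>x y. f x \<bullet> y = x \<bullet> f y"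
    and sub: "subspace V" and inv: "\<And>x. x \<in> V \<Longrightarrow> f x \<in> V" and nt: "V \<noteq> {0}"
  obtains v l where "v \<in> V" "norm v = 1" "f v = l *\<^sub>R v"
proof -
  have cont: "continuous_on X f" for X
    using lin by (simp add: linear_continuous_on linear_conv_bounded_linear)
  have "0 \<in> V" using sub by (rule subspace_0)
  then obtain w0 where w0: "w0 \<in> V" "w0 \<noteq> 0" using nt by blast
  let ?K = "sphere 0 1 \<inter> V"
  have cK: "compact ?K" by (intro compact_Int_closed closed_subspace sub) auto
  have "w0 /\<^sub>R norm w0 \<in> ?K" using w0 by (auto intro: subspace_scale[OF sub])
  then have "?K \<noteq> {}" by blast
  then obtain v where v: "v \<in> ?K" and vmax: "\<And>x. x \<in> ?K \<Longrightarrow> x \<bullet> f x \<le> v \<bullet> f v"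
    using continuous_attains_sup[OF cK, of "\<lambda>x. x \<bullet> f x"]
      continuous_on_inner[OF continuous_on_id cont] by blast
  define l where "l = v \<bullet> f v"
  define q where "q x = l * (x \<bullet> x) - x \<bullet> f x" for x
  have q_nonneg: "0 \<le> q x" if "x \<in> V" for x
  proof (cases "x = 0")
    case True then show ?thesis by (simp add: q_def)
  next
    case False
    have "x /\<^sub>R norm x \<in> ?K" using that False by (auto intro: subspace_scale[OF sub])
    from vmax[OF this] have "(x \<bullet> f x) / (norm x)\<^sup>2 \<le> l"
      using lin by (simp add: l_def linear_scale power2_eq_square field_simps)
    then show ?thesis using False by (simp add: q_def dot_square_norm field_simps)
  qed
  define u where "u = l *\<^sub>R v - f v"
  have uV: "u \<in> V" using v by (auto simp: u_def intro: subspace_diff[OF sub] subspace_scale[OF sub] inv)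
  have qv: "q v = 0" using v by (simp add: q_def l_def dot_square_norm)
  have expand: "q (v - t *\<^sub>R u) = t\<^sup>2 * q u - 2 * t * (u \<bullet> u)" for t
  proof -
    have "q (v - t *\<^sub>R u) = q v - t * (2 * l * (v \<bullet> u) - (v \<bullet> f u + u \<bullet> f v)) + t\<^sup>2 * q u"
      using lin by (simp add: q_def linear_diff linear_scale algebra_simps power2_eq_square inner_commute)
    moreover have "v \<bullet> f u = u \<bullet> f v" by (metis inner_commute sa)
    moreover have "u \<bullet> u = l * (v \<bullet> u) - u \<bullet> f v" using inner_diff_right[of u "l *\<^sub>R v" "f v"]
      by (simp add: u_def[symmetric] inner_commute)
    ultimately have "q (v - t *\<^sub>R u) = 0 - t * (2 * (u \<bullet> u + u \<bullet> f v) - (u \<bullet> f v + u \<bullet> f v)) + t\<^sup>2 * q u"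
      using qv by simp
    then show ?thesis by (simp add: algebra_simps)
  qed
  have "u \<bullet> u = 0"
  proof (rule ccontr)
    assume "u \<bullet> u \<noteq> 0"
    then have c: "0 < u \<bullet> u" by (metis inner_ge_zero less_eq_real_def)
    \<comment> \<open>For small \<open>t > 0\<close> the linear term of \<open>q (v - t *\<^sub>R u)\<close> wins and makes it negative; this \<open>t\<close> is small enough.\<close>
    define t where "t = (u \<bullet> u) / (q u + 1)"
    have qu: "0 \<le> q u" by (rule q_nonneg[OF uV])
    have t: "0 < t" using c qu by (simp add: t_def)
    have "v - t *\<^sub>R u \<in> V" using v uV by (auto intro: subspace_diff[OF sub] subspace_scale[OF sub])
    from q_nonneg[OF this] have "0 \<le> t * (t * q u - 2 * (u \<bullet> u))"
      by (simp add: expand power2_eq_square algebra_simps)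
    then have "2 * (u \<bullet> u) \<le> t * q u" using t by (simp add: zero_le_mult_iff)
    also have "t * q u \<le> u \<bullet> u" using c qu by (simp add: t_def field_simps)
    finally show False using c by simp
  qed
  then have "f v = l *\<^sub>R v" by (simp add: u_def)
  then show thesis using v that by auto
qed

lemma symmetric_matrix_inner:
  fixes Q :: "real ^ 'n ^ 'n"
  assumes "transpose Q = Q"
  shows "(Q *v x) \<bullet> y = x \<bullet> (Q *v y)"
  by (metis assms dot_lmul_matrix transpose_matrix_vector)

text \<open>An orthonormal family of eigenvectors with the largest number of members must span the space:
  otherwise its orthogonal complement is invariant under \<open>Q\<close> and contains one more eigenvector.\<close>

lemma symmetric_matrix_eigenbasis:
  fixes Q :: "real ^ 'n ^ 'n"
  assumes sym: "transpose Q = Q"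
  obtains B l where "finite B" "pairwise orthogonal B" "\<And>b. b \<in> B \<Longrightarrow> norm b = 1"
    "span B = UNIV" "\<And>b. b \<in> B \<Longrightarrow> Q *v b = l b *\<^sub>R b"
proof -
  define good where "good B \<longleftrightarrow> pairwise orthogonal B \<and> (\<forall>b\<in>B. norm b = 1 \<and> (\<exists>l. Q *v b = l *\<^sub>R b))"
    for B :: "(real ^ 'n) set"
  have indep: "independent B" if "good B" for B
    using that by (intro pairwise_orthogonal_independent) (auto simp: good_def)
  have bound: "card B \<le> DIM(real ^ 'n)" "finite B" if "good B" for B
    using independent_bound[OF indep[OF that]] by auto
  have "good {}" by (simp add: good_def)
  then obtain B where B: "good B" and Bmax: "\<And>C. good C \<Longrightarrow> card C \<le> card B"
    using ex_has_greatest_nat[of good "{}" card "Suc (DIM(real ^ 'n))"] bound(1)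
    by (metis le_imp_less_Suc)
  have "span B = UNIV"
  proof (rule ccontr)
    assume ns: "span B \<noteq> UNIV"
    define V where "V = {x. \<forall>b\<in>B. orthogonal b x}"
    have sub: "subspace V" unfolding V_def by (rule subspace_orthogonal_to_vectors)
    have inv: "Q *v x \<in> V" if "x \<in> V" for x
      unfolding V_def
    proof safe
      fix b assume b: "b \<in> B"
      then obtain l where "Q *v b = l *\<^sub>R b" using B by (auto simp: good_def)
      then have "b \<bullet> (Q *v x) = l * (b \<bullet> x)" by (metis inner_scaleR_left sym symmetric_matrix_inner)
      then show "orthogonal b (Q *v x)" using that b by (simp add: V_def orthogonal_def)
    qed
    have "\<exists>x. x \<noteq> 0 \<and> (\<forall>y\<in>span B. orthogonal x y)"
      using orthogonal_to_subspace_exists_gen[of B UNIV] ns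
      by (metis UNIV_I psubsetI span_UNIV subset_UNIV)
    then have "V \<noteq> {0}" by (auto simp: V_def orthogonal_commute span_base)
    then obtain v l where v: "v \<in> V" "norm v = 1" "Q *v v = l *\<^sub>R v"
      using selfadjoint_eigenvector[OF matrix_vector_mul_linear symmetric_matrix_inner[OF sym] sub inv] by metis
    have "v \<notin> B" using v by (auto simp: V_def orthogonal_def dot_square_norm)
    moreover have "good (insert v B)"
      using B v by (auto simp: good_def pairwise_insert V_def orthogonal_commute)
    ultimately show False using Bmax[of "insert v B"] bound(2)[OF B] by simp
  qed
  moreover obtain l where "\<And>b. b \<in> B \<Longrightarrow> Q *v b = l b *\<^sub>R b" using B unfolding good_def by metis
  ultimately show thesis using that[of B l] B bound(2)[OF B] by (auto simp: good_def)
qed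

text \<open>The defect \<open>d = R b - sqrt l b\<close> satisfies \<open>R d = - sqrt l d\<close>, and positivity leaves only \<open>d = 0\<close>. A
  positive semidefinite root is therefore determined on an eigenbasis of its square, which is why
  the principal square root is unique.\<close>

lemma psd_square_eigenvector:
  fixes R :: "real ^ 'n ^ 'n"
  assumes R: "R \<in> psd_matrices" and ev: "(R ** R) *v b = l *\<^sub>R b" and l: "0 \<le> l"
  shows "R *v b = sqrt l *\<^sub>R b"
proof -
  have sym: "transpose R = R" and pos: "\<And>x. 0 \<le> x \<bullet> (R *v x)" using R by (auto simp: psd_matrices_def)
  define d where "d = R *v b - sqrt l *\<^sub>R b"
  have RRb: "R *v (R *v b) = l *\<^sub>R b" using ev by (simp add: matrix_vector_mul_assoc)
  show ?thesis
  proof (cases "l = 0")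
    case True
    then have "(R *v b) \<bullet> (R *v b) = 0" using RRb symmetric_matrix_inner[OF sym] by simp
    then show ?thesis using True by simp
  next
    case False
    have "R *v d = - (sqrt l *\<^sub>R d)"
      using l by (simp add: d_def matrix_vector_mult_diff_distrib matrix_vector_mult_scaleR RRb algebra_simps)
    then have "0 \<le> - (sqrt l * (d \<bullet> d))" using pos[of d] by simp
    then have "d \<bullet> d \<le> 0" using False l by (simp add: mult_le_0_iff)
    then have "d = 0" by (metis inner_gt_zero_iff not_less)
    then show ?thesis by (simp add: d_def)
  qed
qed

lemma matrix_eq_on_spanning_set:
  fixes A C :: "real ^ 'n ^ 'm"
  assumes "span B = UNIV" "\<And>b. b \<in> B \<Longrightarrow> A *v b = C *v b"
  shows "A = C"
proof -
  have "A *v x = C *v x" for x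
    by (rule linear_eq_on_span[of "(*v) A" "(*v) C" B]) (use assms in auto)
  then show ?thesis by (simp add: matrix_eq)
qed

lemma psd_sqrt_unique:
  fixes R :: "real ^ 'n ^ 'n"
  assumes "R \<in> psd_matrices" "R' \<in> psd_matrices" "R ** R = R' ** R'"
  shows "R = R'"
proof -
  have sym: "transpose (R ** R) = R ** R"
    using assms(1) by (simp add: matrix_transpose_mul psd_matrices_def)
  obtain B l where B: "finite B" "pairwise orthogonal B" "\<And>b. b \<in> B \<Longrightarrow> norm b = 1"
    "span B = UNIV" "\<And>b. b \<in> B \<Longrightarrow> (R ** R) *v b = l b *\<^sub>R b"
    using symmetric_matrix_eigenbasis[OF sym] by metis
  have nn: "0 \<le> l b" if "b \<in> B" for b
  proof -
    have "transpose R = R" using assms(1) by (simp add: psd_matrices_def)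
    then have "0 \<le> b \<bullet> ((R ** R) *v b)"
      by (metis inner_ge_zero matrix_vector_mul_assoc symmetric_matrix_inner)
    then show ?thesis using B(3,5)[OF that] by (simp add: dot_square_norm)
  qed
  show ?thesis
  proof (rule matrix_eq_on_spanning_set[OF B(4)])
    fix b assume b: "b \<in> B"
    show "R *v b = R' *v b"
      using psd_square_eigenvector[OF assms(1) B(5)[OF b] nn[OF b]]
        psd_square_eigenvector[OF assms(2), of b "l b"] B(5)[OF b] nn[OF b] assms(3) by simp
  qed
qed

lemma psd_sqrt_exists:
  fixes Q :: "real ^ 'n ^ 'n"
  assumes "Q \<in> psd_matrices"
  shows "\<exists>R. R \<in> psd_matrices \<and> R ** R = Q"
proof -
  have sym: "transpose Q = Q" and pos: "\<And>x. 0 \<le> x \<bullet> (Q *v x)" using assms by (auto simp: psd_matrices_def)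
  obtain B l where B: "finite B" "pairwise orthogonal B" "\<And>b. b \<in> B \<Longrightarrow> norm b = 1"
    "span B = UNIV" "\<And>b. b \<in> B \<Longrightarrow> Q *v b = l b *\<^sub>R b"
    using symmetric_matrix_eigenbasis[OF sym] by metis
  have nn: "0 \<le> l b" if "b \<in> B" for b
    using pos[of b] B(3,5)[OF that] by (simp add: dot_square_norm)
  define f where "f x = (\<Sum>b\<in>B. (sqrt (l b) * (b \<bullet> x)) *\<^sub>R b)" for x
  have lin: "linear f" unfolding f_def
    by (intro linearI) (simp_all add: algebra_simps sum.distrib scaleR_sum_right)
  define R where "R = matrix f"
  have R: "R *v x = f x" for x by (simp add: R_def lin)
  have inner_f: "f x \<bullet> y = (\<Sum>b\<in>B. sqrt (l b) * (b \<bullet> x) * (b \<bullet> y))" for x y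
    by (simp add: f_def inner_sum_left)
  have fb: "f b = sqrt (l b) *\<^sub>R b" if "b \<in> B" for b
  proof -
    have "f b = (\<Sum>c\<in>B. if c = b then sqrt (l b) *\<^sub>R b else 0)" unfolding f_def
      using B(2,3) that by (intro sum.cong) (auto simp: pairwise_def orthogonal_def dot_square_norm)
    then show ?thesis using B(1) that by simp
  qed
  have "f x \<bullet> y = x \<bullet> f y" for x y
    by (subst (2) inner_commute) (simp add: inner_f mult_ac)
  then have "(transpose R) *v x = R *v x" for x
    by (metis R dot_lmul_matrix transpose_matrix_vector vector_eq_rdot)
  then have "transpose R = R" by (simp add: matrix_eq)
  moreover have "0 \<le> x \<bullet> (R *v x)" for x
    by (subst inner_commute) (auto simp: R inner_f mult.assoc intro!: sum_nonneg mult_nonneg_nonneg[OF real_sqrt_ge_zero[OF nn] zero_le_square])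
  moreover have "R ** R = Q"
  proof (rule matrix_eq_on_spanning_set[OF B(4)])
    fix b assume b: "b \<in> B"
    show "(R ** R) *v b = Q *v b"
      using nn[OF b] by (simp add: matrix_vector_mul_assoc[symmetric] R fb[OF b] linear_scale[OF lin] B(5)[OF b])
  qed
  ultimately show ?thesis by (auto simp: psd_matrices_def)
qed

lemma psd_sqrt:
  assumes "Q \<in> psd_matrices"
  shows psd_sqrt_psd: "psd_sqrt Q \<in> psd_matrices" and psd_sqrt_mult: "psd_sqrt Q ** psd_sqrt Q = Q"
    and psd_sqrt_sym: "transpose (psd_sqrt Q) = psd_sqrt Q"
proof -
  have "\<exists>!R. R \<in> psd_matrices \<and> R ** R = Q"
    using psd_sqrt_exists[OF assms] by (auto intro: psd_sqrt_unique)
  from theI'[OF this] show "psd_sqrt Q \<in> psd_matrices" "psd_sqrt Q ** psd_sqrt Q = Q"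
    by (auto simp: psd_sqrt_def)
  then show "transpose (psd_sqrt Q) = psd_sqrt Q" by (simp add: psd_matrices_def)
qed

lemma psd_sqrt_eqI:
  assumes "R \<in> psd_matrices" "R ** R = Q"
  shows "psd_sqrt Q = R"
  unfolding psd_sqrt_def using assms by (auto intro: the_equality psd_sqrt_unique)

lemma pd_psd: "Q \<in> pd_matrices \<Longrightarrow> Q \<in> psd_matrices"
  unfolding pd_matrices_def psd_matrices_def
  by (clarsimp, metis inner_zero_left less_eq_real_def)

lemma pd_invertible:
  assumes "Q \<in> pd_matrices" shows "invertible Q"
proof -
  have "x = 0" if "Q *v x = 0" for x
    using assms that by (force simp: pd_matrices_def)
  then show ?thesis by (simp add: matrix_left_invertible_ker invertible_left_inverse)
qed

lemma invertible_factor: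
  fixes A B :: "real ^ 'n ^ 'n"
  assumes "invertible (A ** B)" shows "invertible A" "invertible B"
  using assms by (auto simp: invertible_det_nz det_mul)

lemma pd_sqrt_invertible: "Q \<in> pd_matrices \<Longrightarrow> invertible (psd_sqrt Q)"
  by (metis invertible_factor(1) pd_invertible pd_psd psd_sqrt_mult)

subsection \<open>Continuity of the square root\<close>

lemma inner_eq_trace:
  fixes A B :: "real ^ 'k ^ 'n"
  shows "A \<bullet> B = trace (A ** transpose B)"
  by (simp add: trace_def matrix_matrix_mult_def transpose_def inner_vec_def)

lemma inner_matrix_mult_left:
  fixes A :: "real ^ 'k ^ 'n" and B :: "real ^ 'k ^ 'm"
  shows "(M ** A) \<bullet> B = A \<bullet> (transpose M ** B)"
proof -
  have "(M ** A) \<bullet> B = (\<Sum>i\<in>UNIV. \<Sum>j\<in>UNIV. \<Sum>k\<in>UNIV. M $ i $ k * A $ k $ j * B $ i $ j)"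
    by (simp add: matrix_matrix_mult_def inner_vec_def sum_distrib_right)
  also have "\<dots> = (\<Sum>i\<in>UNIV. \<Sum>k\<in>UNIV. \<Sum>j\<in>UNIV. M $ i $ k * A $ k $ j * B $ i $ j)"
    by (intro sum.cong refl sum.swap)
  also have "\<dots> = (\<Sum>k\<in>UNIV. \<Sum>i\<in>UNIV. \<Sum>j\<in>UNIV. M $ i $ k * A $ k $ j * B $ i $ j)"
    by (rule sum.swap)
  also have "\<dots> = (\<Sum>k\<in>UNIV. \<Sum>j\<in>UNIV. \<Sum>i\<in>UNIV. M $ i $ k * A $ k $ j * B $ i $ j)"
    by (intro sum.cong refl sum.swap)
  also have "\<dots> = A \<bullet> (transpose M ** B)"
    by (simp add: matrix_matrix_mult_def inner_vec_def transpose_def sum_distrib_left mult_ac)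
  finally show ?thesis .
qed

lemma continuous_on_matrix_mult [continuous_intros]:
  fixes f :: "'a::topological_space \<Rightarrow> real ^ 'k ^ 'n" and g :: "'a \<Rightarrow> real ^ 'm ^ 'k"
  assumes "continuous_on X f" "continuous_on X g"
  shows "continuous_on X (\<lambda>x. f x ** g x)"
  unfolding matrix_matrix_mult_def
  by (intro continuous_on_vec_lambda continuous_intros assms)

lemma continuous_on_matrix_vector_mult:
  fixes f :: "'a::topological_space \<Rightarrow> real ^ 'k ^ 'n" and g :: "'a \<Rightarrow> real ^ 'k"
  assumes "continuous_on X f" "continuous_on X g"
  shows "continuous_on X (\<lambda>x. f x *v g x)"
  unfolding matrix_vector_mult_def
  by (intro continuous_on_vec_lambda continuous_intros assms)

lemma continuous_on_transpose:
  fixes f :: "'a::topological_space \<Rightarrow> real ^ 'k ^ 'n"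
  assumes "continuous_on X f"
  shows "continuous_on X (\<lambda>x. transpose (f x))"
  unfolding transpose_def by (intro continuous_on_vec_lambda continuous_intros assms)

lemma continuous_on_trace:
  fixes f :: "'a::topological_space \<Rightarrow> real ^ 'n ^ 'n"
  assumes "continuous_on X f"
  shows "continuous_on X (\<lambda>x. trace (f x))"
  unfolding trace_def by (intro continuous_intros assms)

lemma closed_psd_matrices: "closed (psd_matrices :: (real ^ 'n ^ 'n) set)"
proof -
  have "psd_matrices = {Q::real ^ 'n ^ 'n. transpose Q = Q} \<inter> (\<Inter>x. {Q. 0 \<le> x \<bullet> (Q *v x)})"
    by (auto simp: psd_matrices_def)
  moreover have "closed {Q::real ^ 'n ^ 'n. transpose Q = Q}"
    by (intro closed_Collect_eq continuous_on_transpose continuous_on_id)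
  moreover have "closed {Q::real ^ 'n ^ 'n. 0 \<le> x \<bullet> (Q *v x)}" for x
    by (intro closed_Collect_le continuous_intros continuous_on_matrix_vector_mult)
  ultimately show ?thesis by (metis (no_types, lifting) closed_INT closed_Int)
qed

text \<open>Squaring is injective and continuous on the compact set of positive semidefinite matrices of norm
  at most \<open>r\<close>, so it has a continuous inverse on the image of this set. Since the squared Frobenius
  norm of a root of \<open>Q\<close> is the trace of \<open>Q\<close>, that image contains all \<open>Q\<close> of trace below \<open>r\<^sup>2\<close>.\<close>

lemma continuous_on_psd_sqrt:
  "continuous_on psd_matrices (psd_sqrt :: real ^ 'n ^ 'n \<Rightarrow> real ^ 'n ^ 'n)"
proof -
  have loc: "continuous_on (psd_matrices \<inter> {Q. trace Q < r\<^sup>2}) (psd_sqrt :: real ^ 'n ^ 'n \<Rightarrow> _)"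
    if r: "0 < r" for r
  proof -
    let ?K = "cball 0 r \<inter> psd_matrices :: (real ^ 'n ^ 'n) set"
    have "continuous_on ((\<lambda>R. R ** R) ` ?K) psd_sqrt"
    proof (rule continuous_on_inv)
      show "continuous_on ?K (\<lambda>R. R ** R)" by (intro continuous_intros)
      show "compact ?K" by (intro compact_Int_closed compact_cball closed_psd_matrices)
      show "\<forall>x\<in>?K. psd_sqrt (x ** x) = x" by (simp add: psd_sqrt_eqI)
    qed
    moreover have "Q \<in> (\<lambda>R. R ** R) ` ?K" if "Q \<in> psd_matrices" "trace Q < r\<^sup>2" for Q
    proof -
      have "(norm (psd_sqrt Q))\<^sup>2 = trace Q"
        by (simp add: power2_norm_eq_inner inner_eq_trace psd_sqrt_sym psd_sqrt_mult that)
      then have "norm (psd_sqrt Q) \<le> r" using that r by (metis less_imp_le power2_le_imp_le)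
      then show ?thesis using that
        by (intro image_eqI[of _ _ "psd_sqrt Q"]) (auto simp: psd_sqrt_mult psd_sqrt_psd)
    qed
    ultimately show ?thesis by (auto intro: continuous_on_subset)
  qed
  show ?thesis
    unfolding continuous_on_eq_continuous_within
  proof
    fix Q :: "real ^ 'n ^ 'n" assume Q: "Q \<in> psd_matrices"
    define r where "r = sqrt (\<bar>trace Q\<bar> + 1)"
    have r: "0 < r" "r\<^sup>2 = \<bar>trace Q\<bar> + 1" by (auto simp: r_def)
    have "open {Q::real ^ 'n ^ 'n. trace Q < r\<^sup>2}"
      by (intro open_Collect_less continuous_on_trace continuous_intros)
    moreover have "continuous (at Q within psd_matrices \<inter> {Q. trace Q < r\<^sup>2}) psd_sqrt"
      using loc[OF r(1)] Q r by (auto simp: continuous_on_eq_continuous_within)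
    moreover have "at Q within psd_matrices \<inter> {Q. trace Q < r\<^sup>2} = at Q within psd_matrices"
      using calculation(1) r(2) by (intro at_within_nhd[of _ "{Q. trace Q < r\<^sup>2}"]) auto
    ultimately show "continuous (at Q within psd_matrices) psd_sqrt"
      by (simp add: continuous_within)
  qed
qed

lemma matrix_inv_inverse:
  fixes A :: "real ^ 'n ^ 'n"
  assumes "invertible A"
  shows matrix_inv_right: "A ** matrix_inv A = mat 1" and matrix_inv_left: "matrix_inv A ** A = mat 1"
  using someI_ex[OF assms[unfolded invertible_def]] by (auto simp: matrix_inv_def)

text \<open>Cramer's rule for the columns of the inverse, in a form that shows its continuity.\<close>

lemma matrix_inv_cramer:
  fixes A :: "real ^ 'n ^ 'n"
  assumes "invertible A"
  shows "matrix_inv A = (\<chi> k j. det (\<chi> i l. if l = k then axis j 1 $ i else A $ i $ l) / det A)"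
proof -
  have "A *v (matrix_inv A *v axis j 1) = axis j 1" for j
    using assms by (simp add: matrix_vector_mul_assoc matrix_inv_right)
  then have "matrix_inv A *v axis j 1 = (\<chi> k. det (\<chi> i l. if l = k then axis j 1 $ i else A $ i $ l) / det A)" for j
    using assms by (subst (asm) cramer) (simp_all add: invertible_det_nz)
  then have "(matrix_inv A *v axis j 1) $ k = det (\<chi> i l. if l = k then axis j 1 $ i else A $ i $ l) / det A" for j k
    by simp
  moreover have "(matrix_inv A *v axis j 1) $ k = matrix_inv A $ k $ j" for j k
    by (simp add: matrix_vector_mult_basis column_def)
  ultimately show ?thesis by (simp add: vec_eq_iff)
qed

lemma continuous_on_matrix_inv:
  fixes f :: "'a::topological_space \<Rightarrow> real ^ 'n ^ 'n"
  assumes f: "continuous_on X f" and inv: "\<And>x. x \<in> X \<Longrightarrow> invertible (f x)"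
  shows "continuous_on X (\<lambda>x. matrix_inv (f x))"
proof -
  have det: "continuous_on X (\<lambda>x. det (g x))" if "\<And>i j. continuous_on X (\<lambda>x. g x $ i $ j)" for g :: "'a \<Rightarrow> real ^ 'n ^ 'n"
    unfolding det_def by (intro continuous_intros that)
  have "continuous_on X (\<lambda>x. \<chi> k j. det (\<chi> i l. if l = k then axis j 1 $ i else f x $ i $ l) / det (f x))"
  proof (intro continuous_on_vec_lambda continuous_on_divide det ballI)
    fix i j k l
    show "continuous_on X (\<lambda>x. (\<chi> i l. if l = k then axis j 1 $ i else f x $ i $ l) $ i $ l)" for i l k j
      by (cases "l = k") (auto intro!: continuous_intros f)
    show "continuous_on X (\<lambda>x. f x $ i $ j)" for i j by (intro continuous_intros f)
    show "det (f x) \<noteq> 0" if "x \<in> X" for x using inv[OF that] by (simp add: invertible_det_nz)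
  qed
  then show ?thesis
    by (rule continuous_on_eq) (simp add: matrix_inv_cramer inv)
qed

section \<open>The Bures optimisation problem\<close>

lemma psd_congruence:
  fixes Q :: "real ^ 'n ^ 'n" and G :: "real ^ 'n ^ 'm"
  assumes "Q \<in> psd_matrices"
  shows "G ** Q ** transpose G \<in> psd_matrices"
proof -
  have "x \<bullet> ((G ** Q ** transpose G) *v x) = (transpose G *v x) \<bullet> (Q *v (transpose G *v x))" for x
    by (simp add: matrix_vector_mul_assoc[symmetric] dot_lmul_matrix[symmetric] transpose_matrix_vector)
  then show ?thesis using assms
    by (simp add: psd_matrices_def matrix_transpose_mul matrix_mul_assoc)
qed

text \<open>Its trace is the largest value that the trace of the off-diagonal block of a positive semidefinite
  matrix with diagonal blocks \<open>P\<close> and \<open>Q\<close> can take.\<close>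

definition bures_root :: "real ^ 'n ^ 'n \<Rightarrow> real ^ 'n ^ 'n \<Rightarrow> real ^ 'n ^ 'n" where
  "bures_root P Q = psd_sqrt (psd_sqrt P ** Q ** psd_sqrt P)"

text \<open>For positive definite \<open>P\<close> and \<open>Q\<close>, the linear map with this matrix is the optimal transport map from the centred Gaussian with
  covariance \<open>P\<close> to the one with covariance \<open>Q\<close>.\<close>

definition monge_matrix :: "real ^ 'n ^ 'n \<Rightarrow> real ^ 'n ^ 'n \<Rightarrow> real ^ 'n ^ 'n" where
  "monge_matrix P Q = matrix_inv (psd_sqrt P) ** bures_root P Q ** matrix_inv (psd_sqrt P)"

lemma bures_root_arg_psd:
  assumes "P \<in> psd_matrices" "Q \<in> psd_matrices"
  shows "psd_sqrt P ** Q ** psd_sqrt P \<in> psd_matrices"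
  using psd_congruence[OF assms(2), of "psd_sqrt P"] by (simp add: psd_sqrt_sym assms)

lemma transpose_matrix_inv:
  fixes A :: "real ^ 'n ^ 'n"
  assumes "invertible A" "transpose A = A"
  shows "transpose (matrix_inv A) = matrix_inv A"
proof -
  have "transpose (matrix_inv A) ** A = transpose (A ** matrix_inv A)"
    by (simp add: matrix_transpose_mul assms)
  also have "\<dots> = mat 1" by (simp add: matrix_inv_right assms)
  finally have "transpose (matrix_inv A) ** (A ** matrix_inv A) = matrix_inv A"
    by (simp add: matrix_mul_assoc)
  then show ?thesis by (simp add: matrix_inv_right assms)
qed

lemma monge_matrix:
  assumes P: "P \<in> pd_matrices" and Q: "Q \<in> pd_matrices"
  defines "T \<equiv> monge_matrix P Q"
  shows monge_matrix_psd: "T \<in> psd_matrices"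
    and monge_matrix_transports: "T ** P ** T = Q"
    and monge_matrix_trace: "trace (P ** T) = trace (bures_root P Q)"
    and monge_matrix_invertible: "invertible T"
proof -
  let ?H = "psd_sqrt P" and ?N = "matrix_inv (psd_sqrt P)" and ?M = "bures_root P Q"
  have Hi: "invertible ?H" by (rule pd_sqrt_invertible[OF P])
  have HN: "?H ** ?N = mat 1" "?N ** ?H = mat 1" by (simp_all add: matrix_inv_right matrix_inv_left Hi)
  have HN': "?H ** (?N ** X) = X" "?N ** (?H ** X) = X" for X
    by (simp_all add: HN matrix_mul_assoc)
  have HH: "?H ** ?H = P" by (rule psd_sqrt_mult[OF pd_psd[OF P]])
  have N: "transpose ?N = ?N" by (intro transpose_matrix_inv Hi psd_sqrt_sym pd_psd P)
  have arg: "?H ** Q ** ?H \<in> psd_matrices" by (intro bures_root_arg_psd pd_psd P Q)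
  have MM: "?M ** ?M = ?H ** Q ** ?H" and Mp: "?M \<in> psd_matrices"
    unfolding bures_root_def using psd_sqrt[OF arg] by auto
  show "T \<in> psd_matrices" using psd_congruence[OF Mp, of ?N] by (simp add: T_def monge_matrix_def N)
  have "T ** P ** T = T ** (?H ** ?H) ** T" by (simp only: HH)
  also have "\<dots> = ?N ** (?M ** ?M) ** ?N"
    unfolding T_def monge_matrix_def by (simp add: matrix_mul_assoc[symmetric] HN')
  also have "\<dots> = Q" unfolding MM by (simp add: matrix_mul_assoc[symmetric] HN' HN)
  finally show TPT: "T ** P ** T = Q" .
  have "trace (P ** T) = trace ((?H ** ?H) ** T)" by (simp only: HH)
  also have "\<dots> = trace (?H ** (?M ** ?N))"
    unfolding T_def monge_matrix_def by (simp add: matrix_mul_assoc[symmetric] HN')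
  also have "\<dots> = trace ((?M ** ?N) ** ?H)" by (rule trace_mul_sym)
  also have "\<dots> = trace ?M" by (simp add: matrix_mul_assoc[symmetric] HN)
  finally show "trace (P ** T) = trace ?M" .
  show "invertible T" using pd_invertible[OF Q] TPT by (metis invertible_factor(2))
qed

text \<open>Let \<open>T\<close> be the transport matrix and \<open>L\<close> its square root. Moving \<open>L\<close> to one side and its inverse to the
  other, \<open>A \<bullet> B = (L A) \<bullet> (L\<^sup>-\<^sup>1 B)\<close> is at most the mean of \<open>(L A) \<bullet> (L A) = trace (T P)\<close> and
  \<open>(L\<^sup>-\<^sup>1 B) \<bullet> (L\<^sup>-\<^sup>1 B) = trace (T\<^sup>-\<^sup>1 Q)\<close>. Because \<open>Q = T P T\<close>, both traces equal the bound.\<close>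

lemma bures_upper_bound:
  fixes A B :: "real ^ 'k ^ 'n"
  assumes P: "A ** transpose A = P" "P \<in> pd_matrices" and Q: "B ** transpose B = Q" "Q \<in> pd_matrices"
  shows "A \<bullet> B \<le> trace (bures_root P Q)"
proof -
  define T where "T = monge_matrix P Q"
  note T = monge_matrix[OF P(2) Q(2), folded T_def]
  define L where "L = psd_sqrt T"
  define L' where "L' = matrix_inv L"
  have LL: "L ** L = T" and Ls: "transpose L = L" using psd_sqrt[OF T(1)] by (auto simp: L_def)
  have Li: "invertible L" using T(4) LL by (metis invertible_factor(1))
  have L's: "transpose L' = L'" unfolding L'_def by (rule transpose_matrix_inv[OF Li Ls])
  have L'L: "L' ** L = mat 1" "L ** L' = mat 1" by (simp_all add: L'_def matrix_inv_left matrix_inv_right Li)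
  have "A \<bullet> B = A \<bullet> ((L ** L') ** B)" by (simp add: L'L)
  also have "\<dots> = (L ** A) \<bullet> (L' ** B)" by (simp add: inner_matrix_mult_left Ls matrix_mul_assoc)
  also have "\<dots> \<le> ((L ** A) \<bullet> (L ** A) + (L' ** B) \<bullet> (L' ** B)) / 2"
    using inner_ge_zero[of "L ** A - L' ** B"] by (simp add: algebra_simps inner_commute)
  also have "(L ** A) \<bullet> (L ** A) = (T ** A) \<bullet> A"
  proof -
    have "(L ** A) \<bullet> (L ** A) = A \<bullet> (T ** A)"
      by (simp add: inner_matrix_mult_left[of L A] Ls matrix_mul_assoc LL)
    then show ?thesis by (simp only: inner_commute[of A])
  qed
  also have "(T ** A) \<bullet> A = trace (P ** T)"
    using trace_mul_sym[of T P] by (simp add: inner_eq_trace P(1) matrix_mul_assoc[symmetric])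
  also have "(L' ** B) \<bullet> (L' ** B) = trace ((L' ** L') ** Q)"
  proof -
    have "(L' ** B) \<bullet> (L' ** B) = B \<bullet> ((L' ** L') ** B)"
      by (simp add: inner_matrix_mult_left[of L' B] L's matrix_mul_assoc)
    then have "(L' ** B) \<bullet> (L' ** B) = ((L' ** L') ** B) \<bullet> B" by (simp only: inner_commute[of B])
    then show ?thesis by (simp add: inner_eq_trace Q(1) matrix_mul_assoc[symmetric])
  qed
  also have "(L' ** L') ** Q = P ** T"
  proof -
    have "(L' ** L') ** T = mat 1"
      unfolding LL[symmetric] by (metis L'L(1) matrix_mul_assoc matrix_mul_rid)
    then show ?thesis unfolding T(2)[symmetric] by (simp add: matrix_mul_assoc)
  qed
  finally show ?thesis by (simp add: T(3))
qed

section \<open>Gaussian laws\<close>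

text \<open>Integrating \<open>1\<^sub>B (x - y) * 1\<^sub>A x\<close>, with \<open>B\<close> the unit ball, against \<open>\<mu>\<close> in \<open>x\<close> and Lebesgue measure in \<open>y\<close>,
  and shifting variables in the two orders of integration gives
  \<open>\<mu> B * lborel A = lborel B * \<mu> A\<close>; the symmetry of the ball enters when \<open>y\<close> is integrated first.\<close>

lemma lborel_translation_invariant_unique:
  fixes \<mu> :: "'a::euclidean_space measure"
  assumes sets_\<mu>[measurable_cong]: "sets \<mu> = sets borel" and fin: "sigma_finite_measure \<mu>"
    and trans: "\<And>a. distr \<mu> borel ((+) a) = \<mu>"
    and ball: "emeasure \<mu> (ball 0 1) = emeasure lborel (ball (0::'a) 1)"
  shows "\<mu> = lborel"
proof (rule measure_eqI)
  interpret \<mu>: sigma_finite_measure \<mu> by fact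
  interpret P: pair_sigma_finite \<mu> lborel ..
  interpret Q: pair_sigma_finite lborel \<mu> ..
  fix A assume "A \<in> sets \<mu>"
  then have A[measurable]: "A \<in> sets borel" by (simp add: sets_\<mu>)
  let ?B = "ball (0::'a) 1"
  define f where "f = (indicator ?B :: 'a \<Rightarrow> ennreal)"
  define g where "g = (indicator A :: 'a \<Rightarrow> ennreal)"
  have [measurable]: "f \<in> borel_measurable borel" "g \<in> borel_measurable borel" using A by (simp_all add: f_def g_def borel_measurable_indicator)
  have \<mu>_trans: "(\<integral>\<^sup>+x. h (x + y) \<partial>\<mu>) = (\<integral>\<^sup>+x. h x \<partial>\<mu>)" if "h \<in> borel_measurable borel" for h y
  proof -
    have "(\<integral>\<^sup>+x. h x \<partial>\<mu>) = (\<integral>\<^sup>+x. h x \<partial>distr \<mu> borel ((+) y))" by (simp only: trans)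
    also have "\<dots> = (\<integral>\<^sup>+x. h (y + x) \<partial>\<mu>)" using that by (intro nn_integral_distr) measurable
    finally show ?thesis by (simp add: add.commute)
  qed
  have l_trans: "(\<integral>\<^sup>+x. h (x + y) \<partial>lborel) = (\<integral>\<^sup>+x. h x \<partial>lborel)" if "h \<in> borel_measurable borel" for h and y :: 'a
  proof -
    have "(\<integral>\<^sup>+x. h x \<partial>lborel) = (\<integral>\<^sup>+x. h x \<partial>distr lborel borel ((+) y))" by (simp only: lborel_distr_plus)
    also have "\<dots> = (\<integral>\<^sup>+x. h (y + x) \<partial>lborel)" using that by (intro nn_integral_distr) measurable
    finally show ?thesis by (simp add: add.commute)
  qed
  have f_refl: "f (x - y) = f (y - x)" for x y
    by (simp add: f_def indicator_def norm_minus_commute)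
  have "(\<integral>\<^sup>+x. f x \<partial>\<mu>) * (\<integral>\<^sup>+y. g y \<partial>lborel) = (\<integral>\<^sup>+x. f x * (\<integral>\<^sup>+y. g y \<partial>lborel) \<partial>\<mu>)"
    by (simp add: nn_integral_multc)
  also have "\<dots> = (\<integral>\<^sup>+x. \<integral>\<^sup>+y. f x * g (y + x) \<partial>lborel \<partial>\<mu>)"
    by (simp add: nn_integral_cmult l_trans)
  also have "\<dots> = (\<integral>\<^sup>+y. \<integral>\<^sup>+x. f x * g (y + x) \<partial>\<mu> \<partial>lborel)"
    by (rule P.Fubini'[symmetric]) measurable
  also have "\<dots> = (\<integral>\<^sup>+y. \<integral>\<^sup>+x. f (x - y) * g x \<partial>\<mu> \<partial>lborel)"
  proof (rule nn_integral_cong)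
    fix y :: 'a
    show "(\<integral>\<^sup>+x. f x * g (y + x) \<partial>\<mu>) = (\<integral>\<^sup>+x. f (x - y) * g x \<partial>\<mu>)"
      using \<mu>_trans[of "\<lambda>x. f (x - y) * g x" y] by (simp add: add.commute)
  qed
  also have "\<dots> = (\<integral>\<^sup>+x. \<integral>\<^sup>+y. f (x - y) * g x \<partial>lborel \<partial>\<mu>)"
    by (rule P.Fubini') measurable
  also have "\<dots> = (\<integral>\<^sup>+x. (\<integral>\<^sup>+y. f y \<partial>lborel) * g x \<partial>\<mu>)"
  proof (rule nn_integral_cong)
    fix x :: 'a
    have "(\<integral>\<^sup>+y. f (x - y) \<partial>lborel) = (\<integral>\<^sup>+y. f y \<partial>lborel)"
      using l_trans[of f "- x"] by (simp add: f_refl[of x])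
    then show "(\<integral>\<^sup>+y. f (x - y) * g x \<partial>lborel) = (\<integral>\<^sup>+y. f y \<partial>lborel) * g x"
      by (simp add: nn_integral_multc)
  qed
  also have "\<dots> = (\<integral>\<^sup>+y. f y \<partial>lborel) * (\<integral>\<^sup>+x. g x \<partial>\<mu>)" by (simp add: nn_integral_cmult)
  finally have "emeasure \<mu> ?B * emeasure lborel A = emeasure lborel ?B * emeasure \<mu> A"
    by (simp add: f_def g_def sets_\<mu>)
  moreover have "emeasure lborel ?B \<noteq> 0"
  proof
    assume "emeasure lborel ?B = 0"
    then have "?B \<in> null_sets lborel" by (auto intro: null_setsI)
    then show False using open_not_negligible[of ?B] by (simp add: negligible_iff_null_sets null_sets_completionI)
  qed
  moreover have "emeasure lborel ?B < \<infinity>" by (rule emeasure_bounded_finite) simp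
  ultimately show "emeasure \<mu> A = emeasure lborel A"
    by (auto simp: ball ennreal_mult_cancel_left)
qed (simp add: sets_\<mu>)

text \<open>The image of Lebesgue measure under \<open>T\<close> is again translation invariant, and \<open>T\<close> maps the unit ball
  onto itself.\<close>

lemma lborel_orthogonal_invariant:
  fixes T :: "'a::euclidean_space \<Rightarrow> 'a"
  assumes T: "orthogonal_transformation T"
  shows "distr lborel borel T = lborel"
proof (rule lborel_translation_invariant_unique)
  have lin: "linear T" by (rule orthogonal_transformation_linear[OF T])
  have cont: "continuous_on UNIV T" using lin by (simp add: linear_continuous_on linear_conv_bounded_linear)
  have Tm[measurable]: "T \<in> borel_measurable borel" by (rule borel_measurable_continuous_onI[OF cont])
  obtain T' where T': "linear T'" "\<And>x. T (T' x) = x" "\<And>x. T' (T x) = x"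
    using linear_injective_isomorphism[OF lin orthogonal_transformation_inj[OF T]] by metis
  have norm_T: "norm (T x) = norm x" for x by (rule orthogonal_transformation_norm[OF T])
  show "sets (distr lborel borel T) = sets borel" by simp
  have pre: "T -` ball 0 r = ball 0 r" for r by (auto simp: norm_T)
  show "emeasure (distr lborel borel T) (ball 0 1) = emeasure lborel (ball (0::'a) 1)"
    by (simp add: emeasure_distr pre)
  show "sigma_finite_measure (distr lborel borel T)"
  proof
    show "\<exists>A. countable A \<and> A \<subseteq> sets (distr lborel borel T) \<and> \<Union> A = space (distr lborel borel T) \<and>
        (\<forall>a\<in>A. emeasure (distr lborel borel T) a \<noteq> \<infinity>)"
    proof (intro exI conjI)
      show "countable (range (\<lambda>n::nat. ball (0::'a) (real n)))" by simp
      show "\<Union> (range (\<lambda>n::nat. ball (0::'a) (real n))) = space (distr lborel borel T)"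
        by (auto intro: reals_Archimedean2)
      show "\<forall>a\<in>range (\<lambda>n::nat. ball (0::'a) (real n)). emeasure (distr lborel borel T) a \<noteq> \<infinity>"
      proof safe
        fix n :: nat
        assume "emeasure (distr lborel borel T) (ball 0 (real n)) = \<infinity>"
        then show False using emeasure_bounded_finite[OF bounded_ball, of "0::'a" "real n"]
          by (simp add: emeasure_distr pre)
      qed
    qed auto
  qed
  fix a
  have "distr (distr lborel borel T) borel ((+) a) = distr lborel borel (\<lambda>x. a + T x)"
    by (simp add: distr_distr comp_def)
  also have "(\<lambda>x. a + T x) = (\<lambda>x. T (T' a + x))" using T' lin by (simp add: linear_add)
  also have "distr lborel borel (\<lambda>x. T (T' a + x)) = distr (distr lborel borel ((+) (T' a))) borel T"
    by (simp add: distr_distr comp_def)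
  also have "distr lborel borel ((+) (T' a)) = lborel" by (rule lborel_distr_plus)
  finally show "distr (distr lborel borel T) borel ((+) a) = distr lborel borel T" .
qed

lemma prob_space_std_normal: "prob_space (density lborel (\<lambda>x. ennreal (std_normal_density x)))"
  by (rule prob_space_normal_density) simp

lemma measurable_vec_lambda_PiM:
  assumes "\<And>i. sets (M i) = sets (borel :: real measure)"
  shows "(\<lambda>f. \<chi> i. f i) \<in> (\<Pi>\<^sub>M i\<in>(UNIV::'n::finite set). M i) \<rightarrow>\<^sub>M borel"
proof (rule borel_measurable_euclidean_space[THEN iffD2], rule ballI)
  fix b :: "real ^ 'n" assume "b \<in> Basis"
  then obtain i where "b = axis i 1" by (auto simp: Basis_vec_def)
  moreover have "(\<lambda>f. f i) \<in> borel_measurable (\<Pi>\<^sub>M i\<in>(UNIV::'n set). M i)"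
    using measurable_component_singleton[of i UNIV M] assms[of i] by (simp cong: measurable_cong_sets)
  ultimately show "(\<lambda>f. (\<chi> i. f i) \<bullet> b) \<in> borel_measurable (\<Pi>\<^sub>M i\<in>(UNIV::'n set). M i)"
    by (simp add: inner_axis)
qed

lemma std_gaussian_sets [simp, measurable_cong]: "sets std_gaussian = sets borel"
  and std_gaussian_space [simp]: "space std_gaussian = UNIV"
  by (simp_all add: std_gaussian_def)

lemma prob_space_std_gaussian: "prob_space (std_gaussian :: (real ^ 'n) measure)"
  unfolding std_gaussian_def
  by (intro prob_space.prob_space_distr prob_space_PiM prob_space_std_normal measurable_vec_lambda_PiM) simp

lemma lborel_vec_eq: "distr (\<Pi>\<^sub>M i\<in>(UNIV::'n::finite set). lborel) borel (\<lambda>f. \<chi> i. f i) = (lborel :: (real ^ 'n) measure)"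
proof (rule lborel_eqI[symmetric])
  interpret product_sigma_finite "\<lambda>_::'n. lborel :: real measure" ..
  fix l u :: "real ^ 'n" assume le: "\<And>b. b \<in> Basis \<Longrightarrow> l \<bullet> b \<le> u \<bullet> b"
  then have le': "l $ i \<le> u $ i" for i by (metis cart_eq_inner_axis axis_in_Basis_iff Basis_real_def insertI1)
  have m: "(\<lambda>f. \<chi> i. f i) \<in> (\<Pi>\<^sub>M i\<in>(UNIV::'n set). lborel) \<rightarrow>\<^sub>M (borel :: (real ^ 'n) measure)"
    by (rule measurable_vec_lambda_PiM) simp
  have "(\<lambda>f. \<chi> i. f i) -` box l u \<inter> space (\<Pi>\<^sub>M i\<in>(UNIV::'n set). lborel) = (\<Pi>\<^sub>E i\<in>UNIV. {l $ i <..< u $ i})"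
    by (auto simp: mem_box_cart space_PiM PiE_def Pi_def)
  then have "emeasure (distr (\<Pi>\<^sub>M i\<in>(UNIV::'n set). lborel) borel (\<lambda>f. \<chi> i. f i)) (box l u) = (\<Prod>i\<in>UNIV. ennreal (u $ i - l $ i))"
    using le' by (simp add: emeasure_distr m emeasure_PiM)
  also have "\<dots> = ennreal (\<Prod>i\<in>UNIV. u $ i - l $ i)" using le' by (intro prod_ennreal) simp
  also have "(\<Prod>i\<in>UNIV. u $ i - l $ i) = (\<Prod>b\<in>Basis. (u - l) \<bullet> b)"
  proof -
    have "Basis = (\<lambda>i::'n. axis i (1::real)) ` UNIV" by (auto simp: Basis_vec_def)
    then have "(\<Prod>b\<in>Basis. (u - l) \<bullet> b) = (\<Prod>i\<in>(UNIV::'n set). (u - l) \<bullet> axis i 1)"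
      using prod.reindex[of "\<lambda>i::'n. axis i (1::real)" UNIV "\<lambda>b. (u - l) \<bullet> b"]
      by (simp add: inj_on_def axis_eq_axis comp_def)
    then show ?thesis by (simp add: inner_axis)
  qed
  finally show "emeasure (distr (\<Pi>\<^sub>M i\<in>(UNIV::'n set). lborel) borel (\<lambda>f. \<chi> i. f i)) (box l u) = ennreal (\<Prod>b\<in>Basis. (u - l) \<bullet> b)" .
qed simp

lemma std_normal_PiM_density:
  "(\<Pi>\<^sub>M i\<in>(UNIV::'n::finite set). density lborel (\<lambda>x. ennreal (std_normal_density x))) =
   density (\<Pi>\<^sub>M i\<in>(UNIV::'n set). lborel) (\<lambda>f. \<Prod>i\<in>UNIV. ennreal (std_normal_density (f i)))"
proof -
  interpret N: product_sigma_finite "\<lambda>_::'n. density lborel (\<lambda>x. ennreal (std_normal_density x))"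
    by (rule product_sigma_finite.intro) (rule prob_space_imp_sigma_finite[OF prob_space_std_normal])
  interpret L: product_sigma_finite "\<lambda>_::'n. lborel :: real measure" ..
  show ?thesis
  proof (rule N.PiM_eqI[symmetric])
    show "sets (density (\<Pi>\<^sub>M i\<in>(UNIV::'n set). lborel) (\<lambda>f. \<Prod>i\<in>UNIV. ennreal (std_normal_density (f i)))) =
      sets (\<Pi>\<^sub>M i\<in>(UNIV::'n set). density lborel (\<lambda>x. ennreal (std_normal_density x)))"
      unfolding sets_density by (rule sets_PiM_cong) simp_all
    fix A :: "'n \<Rightarrow> real set"
    assume "\<And>i. i \<in> UNIV \<Longrightarrow> A i \<in> sets (density lborel (\<lambda>x. ennreal (std_normal_density x)))"
    then have A[measurable]: "A i \<in> sets borel" for i by simp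
    have "emeasure (density (\<Pi>\<^sub>M i\<in>(UNIV::'n set). lborel) (\<lambda>f. \<Prod>i\<in>UNIV. ennreal (std_normal_density (f i)))) (Pi\<^sub>E UNIV A)
      = (\<integral>\<^sup>+f. (\<Prod>i\<in>UNIV. ennreal (std_normal_density (f i))) * indicator (Pi\<^sub>E UNIV A) f \<partial>(\<Pi>\<^sub>M i\<in>(UNIV::'n set). lborel))"
      by (intro emeasure_density sets_PiM_I_finite) auto
    also have "\<dots> = (\<integral>\<^sup>+f. (\<Prod>i\<in>UNIV. ennreal (std_normal_density (f i)) * indicator (A i) (f i)) \<partial>(\<Pi>\<^sub>M i\<in>(UNIV::'n set). lborel))"
    proof (rule nn_integral_cong)
      fix f :: "'n \<Rightarrow> real"
      have "indicator (Pi\<^sub>E UNIV A) f = (\<Prod>i\<in>UNIV. indicator (A i) (f i) :: ennreal)"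
        by (auto simp: indicator_def PiE_def Pi_def prod_zero_iff)
      then show "(\<Prod>i\<in>UNIV. ennreal (std_normal_density (f i))) * indicator (Pi\<^sub>E UNIV A) f =
        (\<Prod>i\<in>UNIV. ennreal (std_normal_density (f i)) * indicator (A i) (f i))"
        by (simp add: prod.distrib)
    qed
    also have "\<dots> = (\<Prod>i\<in>UNIV. \<integral>\<^sup>+x. ennreal (std_normal_density x) * indicator (A i) x \<partial>lborel)"
      by (rule L.product_nn_integral_prod) auto
    also have "\<dots> = (\<Prod>i\<in>UNIV. emeasure (density lborel (\<lambda>x. ennreal (std_normal_density x))) (A i))"
      by (intro prod.cong refl emeasure_density[symmetric]) auto
    finally show "emeasure (density (\<Pi>\<^sub>M i\<in>(UNIV::'n set). lborel) (\<lambda>f. \<Prod>i\<in>UNIV. ennreal (std_normal_density (f i)))) (Pi\<^sub>E UNIV A)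
      = (\<Prod>i\<in>UNIV. emeasure (density lborel (\<lambda>x. ennreal (std_normal_density x))) (A i))" .
  qed simp
qed

text \<open>The density depends on the norm only; this is the source of the rotational symmetry.\<close>

definition std_gaussian_density :: "real ^ 'n \<Rightarrow> real" where
  "std_gaussian_density x = (1 / sqrt (2 * pi)) ^ CARD('n) * exp (- (norm x)\<^sup>2 / 2)"

lemma std_gaussian_density: "std_gaussian = density lborel (\<lambda>x :: real ^ 'n. ennreal (std_gaussian_density x))"
proof -
  have m: "(\<lambda>f. \<chi> i. f i) \<in> (\<Pi>\<^sub>M i\<in>(UNIV::'n set). lborel) \<rightarrow>\<^sub>M (borel :: (real ^ 'n) measure)"
    by (rule measurable_vec_lambda_PiM) simp
  have "(\<Prod>i\<in>UNIV. ennreal (std_normal_density (f i))) = ennreal (std_gaussian_density (\<chi> i. f i))" for f :: "'n \<Rightarrow> real"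
  proof -
    have "(\<Prod>i\<in>UNIV. std_normal_density (f i)) = (1 / sqrt (2 * pi)) ^ CARD('n) * (\<Prod>i\<in>UNIV. exp (- (f i)\<^sup>2 / 2))"
      unfolding std_normal_density_def prod.distrib by simp
    also have "(\<Prod>i\<in>UNIV. exp (- (f i)\<^sup>2 / 2)) = exp (- (norm (\<chi> i. f i))\<^sup>2 / 2)"
      unfolding power2_norm_eq_inner
      by (simp add: exp_sum[symmetric] inner_vec_def sum_divide_distrib sum_negf power2_eq_square)
    finally show ?thesis by (simp add: prod_ennreal std_gaussian_density_def)
  qed
  then have "std_gaussian = distr (density (\<Pi>\<^sub>M i\<in>(UNIV::'n set). lborel) (\<lambda>f. ennreal (std_gaussian_density (\<chi> i. f i)))) borel (\<lambda>f. \<chi> i. f i)"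
    unfolding std_gaussian_def std_normal_PiM_density by simp
  also have "\<dots> = density (distr (\<Pi>\<^sub>M i\<in>(UNIV::'n set). lborel) borel (\<lambda>f. \<chi> i. f i)) (\<lambda>x. ennreal (std_gaussian_density x))"
    by (rule density_distr[symmetric, OF _ m]) (simp add: std_gaussian_density_def)
  finally show ?thesis by (simp only: lborel_vec_eq)
qed

lemma std_gaussian_orthogonal_invariant:
  fixes T :: "real ^ 'n \<Rightarrow> real ^ 'n"
  assumes T: "orthogonal_transformation T"
  shows "distr std_gaussian borel T = std_gaussian"
proof -
  have lin: "linear T" by (rule orthogonal_transformation_linear[OF T])
  have Tm[measurable]: "T \<in> borel_measurable borel"
    using lin by (intro borel_measurable_continuous_onI linear_continuous_on) (simp add: linear_conv_bounded_linear)
  have "std_gaussian_density x = std_gaussian_density (T x)" for x :: "real ^ 'n"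
    by (simp add: std_gaussian_density_def orthogonal_transformation_norm[OF T])
  then have "distr std_gaussian borel T = distr (density lborel (\<lambda>x. ennreal (std_gaussian_density (T x)))) borel T"
    unfolding std_gaussian_density by simp
  also have "\<dots> = density (distr lborel borel T) (\<lambda>x. ennreal (std_gaussian_density x))"
    by (rule density_distr[symmetric]) (simp_all add: std_gaussian_density_def)
  also have "\<dots> = std_gaussian" by (simp add: lborel_orthogonal_invariant[OF T] std_gaussian_density)
  finally show ?thesis .
qed

lemma std_gaussian_subvector:
  fixes \<iota> :: "'n::finite \<Rightarrow> 'k::finite"
  assumes "inj \<iota>"
  shows "distr (std_gaussian :: (real ^ 'k) measure) borel (\<lambda>x. \<chi> i. x $ \<iota> i) = (std_gaussian :: (real ^ 'n) measure)"
proof -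
  let ?N = "density lborel (\<lambda>x. ennreal (std_normal_density x))"
  have vk: "(\<lambda>f. \<chi> i. f i) \<in> (\<Pi>\<^sub>M i\<in>(UNIV::'k set). ?N) \<rightarrow>\<^sub>M borel"
    and vn: "(\<lambda>f. \<chi> i. f i) \<in> (\<Pi>\<^sub>M i\<in>(UNIV::'n set). ?N) \<rightarrow>\<^sub>M borel"
    by (rule measurable_vec_lambda_PiM, simp)+
  have sub: "(\<lambda>x. \<chi> i. x $ \<iota> i) \<in> (borel :: (real ^ 'k) measure) \<rightarrow>\<^sub>M (borel :: (real ^ 'n) measure)"
    by (intro borel_measurable_continuous_onI continuous_on_vec_lambda continuous_intros)
  have res: "(\<lambda>f. \<lambda>i\<in>UNIV. f (\<iota> i)) \<in> (\<Pi>\<^sub>M i\<in>(UNIV::'k set). ?N) \<rightarrow>\<^sub>M (\<Pi>\<^sub>M i\<in>(UNIV::'n set). ?N)"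
    by (intro measurable_restrict measurable_component_singleton UNIV_I)
  have "distr (std_gaussian :: (real ^ 'k) measure) borel (\<lambda>x. \<chi> i. x $ \<iota> i)
     = distr (\<Pi>\<^sub>M i\<in>(UNIV::'k set). ?N) borel (\<lambda>f. \<chi> i. f (\<iota> i))"
    unfolding std_gaussian_def distr_distr[OF sub vk] by (simp add: comp_def)
  also have "\<dots> = distr (distr (\<Pi>\<^sub>M i\<in>(UNIV::'k set). ?N) (\<Pi>\<^sub>M i\<in>(UNIV::'n set). ?N) (\<lambda>f. \<lambda>i\<in>UNIV. f (\<iota> i))) borel (\<lambda>f. \<chi> i. f i)"
    unfolding distr_distr[OF vn res] by (simp add: comp_def restrict_def)
  also have "distr (\<Pi>\<^sub>M i\<in>(UNIV::'k set). ?N) (\<Pi>\<^sub>M i\<in>(UNIV::'n set). ?N) (\<lambda>f. \<lambda>i\<in>UNIV. f (\<iota> i)) = (\<Pi>\<^sub>M i\<in>(UNIV::'n set). ?N)"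
    using assms by (intro distr_PiM_reindex prob_space_std_normal) auto
  finally show ?thesis by (simp add: std_gaussian_def)
qed

text \<open>The rows of \<open>U\<close> are completed to an orthonormal basis, whose members are then numbered by \<open>'k\<close>; the
  row \<open>i\<close> of \<open>U\<close> ends up in position \<open>\<iota> i\<close>.\<close>

lemma orthonormal_rows_extend:
  fixes U :: "real ^ 'k ^ 'n"
  assumes U: "U ** transpose U = mat 1"
  obtains V :: "real ^ 'k ^ 'k" and \<iota> :: "'n \<Rightarrow> 'k"
  where "inj \<iota>" "orthogonal_matrix V" "\<And>i. V $ \<iota> i = U $ i"
proof -
  have UU: "U $ i \<bullet> U $ j = (if i = j then 1 else 0)" for i j
  proof -
    have "(U ** transpose U) $ i $ j = U $ i \<bullet> U $ j"
      by (simp add: matrix_matrix_mult_def transpose_def inner_vec_def)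
    then show ?thesis by (simp add: U mat_def)
  qed
  let ?R = "range (($) U)"
  have injU: "inj (($) U)" by (rule injI) (metis UU one_neq_zero)
  have orthR: "pairwise orthogonal ?R" by (auto simp: pairwise_def orthogonal_def UU)
  obtain W where W: "W \<inter> insert 0 ?R = {}" "pairwise orthogonal (?R \<union> W)" "span (?R \<union> W) = UNIV"
    using orthogonal_extension_strong[OF orthR, of UNIV] by (metis Un_UNIV_right span_UNIV)
  define B where "B = ?R \<union> (\<lambda>w. w /\<^sub>R norm w) ` W"
  have orthB: "pairwise orthogonal B"
  proof (rule pairwiseI)
    fix x y assume xy: "x \<in> B" "y \<in> B" "x \<noteq> y"
    \<comment> \<open>Both vectors are multiples of members of the orthogonal family completing the rows; these members differ because equal ones would come with equal factors.\<close>
    obtain a x' where x: "x = a *\<^sub>R x'" "x' \<in> ?R \<union> W" "x' \<in> ?R \<Longrightarrow> a = 1" "x' \<in> W \<Longrightarrow> a = inverse (norm x')"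
    proof (cases "x \<in> ?R")
      case True then show thesis using W(1) by (intro that[of 1 x]) auto
    next
      case False
      then obtain w where "w \<in> W" "x = inverse (norm w) *\<^sub>R w" using xy(1) by (auto simp: B_def)
      then show thesis using W(1) by (intro that[of "inverse (norm w)" w]) auto
    qed
    obtain c y' where y: "y = c *\<^sub>R y'" "y' \<in> ?R \<union> W" "y' \<in> ?R \<Longrightarrow> c = 1" "y' \<in> W \<Longrightarrow> c = inverse (norm y')"
    proof (cases "y \<in> ?R")
      case True then show thesis using W(1) by (intro that[of 1 y]) auto
    next
      case False
      then obtain w where "w \<in> W" "y = inverse (norm w) *\<^sub>R w" using xy(2) by (auto simp: B_def)
      then show thesis using W(1) by (intro that[of "inverse (norm w)" w]) auto
    qed
    have "x' \<noteq> y'" using xy(3) x y by auto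
    then have "orthogonal x' y'" using W(2) x(2) y(2) by (auto simp: pairwise_def)
    then show "orthogonal x y" by (simp add: x(1) y(1) orthogonal_def)
  qed
  have normB: "norm b = 1" if "b \<in> B" for b
  proof -
    have "norm (U $ i) = 1" for i by (simp add: norm_eq_1 UU)
    moreover have "norm (w /\<^sub>R norm w) = 1" if "w \<in> W" for w
    proof -
      have "w \<noteq> 0" using that W(1) by auto
      then show ?thesis by simp
    qed
    ultimately show ?thesis using that by (auto simp: B_def)
  qed
  have "independent B" using normB by (intro pairwise_orthogonal_independent orthB) force
  have "?R \<union> W \<subseteq> span B"
  proof safe
    fix w assume w: "w \<in> W"
    then have "w \<noteq> 0" using W(1) by auto
    then have "w = norm w *\<^sub>R (w /\<^sub>R norm w)" by simp
    moreover have "w /\<^sub>R norm w \<in> span B" using w by (intro span_base) (auto simp: B_def)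
    ultimately show "w \<in> span B" by (metis span_scale)
  qed (auto simp: B_def intro: span_base)
  then have spanB: "span B = UNIV" using W(3) by (metis span_minimal subspace_span top.extremum_uniqueI)
  have finB: "finite B" using \<open>independent B\<close> by (rule independent_imp_finite)
  have "card B = CARD('k)"
    using dim_eq_card[of B "UNIV :: (real ^ 'k) set"] spanB \<open>independent B\<close> by simp
  then obtain \<beta> :: "'k \<Rightarrow> real ^ 'k" where \<beta>: "bij_betw \<beta> UNIV B"
    using finite_same_card_bij[of "UNIV :: 'k set" B] finB by auto
  define \<iota> where "\<iota> i = inv_into UNIV \<beta> (U $ i)" for i
  have \<beta>\<iota>: "\<beta> (\<iota> i) = U $ i" for i
    unfolding \<iota>_def using \<beta> by (intro f_inv_into_f) (auto simp: bij_betw_def B_def)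
  show thesis
  proof
    show "inj \<iota>" by (rule injI) (metis \<beta>\<iota> injU injD)
    show "(\<chi> k. \<beta> k) $ \<iota> i = U $ i" for i by (simp add: \<beta>\<iota>)
    have "\<beta> k \<in> B" for k using \<beta> by (auto simp: bij_betw_def)
    moreover have "\<beta> k \<noteq> \<beta> l" if "k \<noteq> l" for k l using \<beta> that by (auto simp: bij_betw_def inj_on_def)
    ultimately show "orthogonal_matrix (\<chi> k. \<beta> k)"
      using orthB normB by (auto simp: orthogonal_matrix_orthonormal_rows row_def pairwise_def)
  qed
qed


text \<open>Up to the choice of coordinates, \<open>U\<close> is an orthogonal map followed by forgetting some coordinates,
  and both steps preserve standard Gaussians. This identifies the marginals of Gaussian laws
  without characteristic functions in several variables.\<close>

lemma std_gaussian_coisometry: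
  fixes U :: "real ^ 'k ^ 'n"
  assumes U: "U ** transpose U = mat 1"
  shows "distr std_gaussian borel ((*v) U) = std_gaussian"
proof -
  obtain V :: "real ^ 'k ^ 'k" and \<iota> where V: "inj \<iota>" "orthogonal_matrix V" "\<And>i. V $ \<iota> i = U $ i"
    using orthonormal_rows_extend[OF U] by metis
  have T: "orthogonal_transformation ((*v) V)"
    using V(2) by (simp add: orthogonal_transformation_matrix matrix_of_matrix_vector_mul)
  have sub: "(\<lambda>x. \<chi> i. x $ \<iota> i) \<in> (borel :: (real ^ 'k) measure) \<rightarrow>\<^sub>M (borel :: (real ^ 'n) measure)"
    by (intro borel_measurable_continuous_onI continuous_on_vec_lambda continuous_intros)
  have Vm: "(*v) V \<in> std_gaussian \<rightarrow>\<^sub>M borel"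
    by (simp cong: measurable_cong_sets)
      (intro borel_measurable_continuous_onI continuous_on_matrix_vector_mult continuous_intros)
  have "(*v) U = (\<lambda>x. \<chi> i. (V *v x) $ \<iota> i)"
    by (simp add: fun_eq_iff vec_eq_iff matrix_vector_mult_def V(3))
  then have "distr std_gaussian borel ((*v) U) = distr (distr std_gaussian borel ((*v) V)) borel (\<lambda>x. \<chi> i. x $ \<iota> i)"
    unfolding distr_distr[OF sub Vm] by (simp add: comp_def)
  then show ?thesis by (simp add: std_gaussian_orthogonal_invariant[OF T] std_gaussian_subvector[OF V(1)])
qed

text \<open>An affine image of a standard Gaussian depends on the linear part only through \<open>A ** transpose A\<close>,
  because \<open>A\<close> is the square root of \<open>Q\<close> times a matrix with orthonormal rows.\<close>

lemma std_gaussian_affine_image: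
  fixes A :: "real ^ 'k ^ 'n"
  assumes A: "A ** transpose A = Q" and Q: "Q \<in> pd_matrices"
  shows "distr std_gaussian borel (\<lambda>x. m + A *v x) = gaussian (m, Q)"
proof -
  let ?H = "psd_sqrt Q" and ?N = "matrix_inv (psd_sqrt Q)"
  have Hi: "invertible ?H" by (rule pd_sqrt_invertible[OF Q])
  have N: "transpose ?N = ?N" by (intro transpose_matrix_inv Hi psd_sqrt_sym pd_psd Q)
  have HH: "?H ** ?H = Q" by (rule psd_sqrt_mult[OF pd_psd[OF Q]])
  define U where "U = ?N ** A"
  have "U ** transpose U = ?N ** (A ** transpose A) ** ?N"
    by (simp add: U_def matrix_transpose_mul N matrix_mul_assoc)
  also have "\<dots> = ?N ** (?H ** ?H) ** ?N" by (simp only: A HH)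
  also have "\<dots> = (?N ** ?H) ** (?H ** ?N)" by (simp add: matrix_mul_assoc)
  also have "\<dots> = mat 1" by (simp add: matrix_inv_left matrix_inv_right Hi)
  finally have U: "U ** transpose U = mat 1" .
  have "A = ?H ** U" by (simp add: U_def matrix_mul_assoc matrix_inv_right Hi)
  then have "m + A *v x = m + ?H *v (U *v x)" for x by (simp add: matrix_vector_mul_assoc)
  moreover have am: "(\<lambda>y. m + ?H *v y) \<in> borel \<rightarrow>\<^sub>M borel"
    by (intro borel_measurable_continuous_onI continuous_on_matrix_vector_mult continuous_intros)
  moreover have Um: "(*v) U \<in> std_gaussian \<rightarrow>\<^sub>M borel"
    by (simp cong: measurable_cong_sets)
      (intro borel_measurable_continuous_onI continuous_on_matrix_vector_mult continuous_intros)
  ultimately have "distr std_gaussian borel (\<lambda>x. m + A *v x) = distr (distr std_gaussian borel ((*v) U)) borel (\<lambda>y. m + ?H *v y)"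
    by (simp add: distr_distr comp_def)
  then show ?thesis by (simp add: std_gaussian_coisometry[OF U] gaussian_def)
qed

subsection \<open>Second moments\<close>

lemma std_gaussian_coordinate: "distr (std_gaussian :: (real ^ 'n) measure) borel (\<lambda>x. x $ i) = density lborel (\<lambda>x. ennreal (std_normal_density x))"
proof -
  let ?N = "density lborel (\<lambda>x. ennreal (std_normal_density x))"
  have v: "(\<lambda>f. \<chi> i. f i) \<in> (\<Pi>\<^sub>M i\<in>(UNIV::'n set). ?N) \<rightarrow>\<^sub>M borel"
    by (rule measurable_vec_lambda_PiM) simp
  have c: "(\<lambda>x. x $ i) \<in> (borel :: (real ^ 'n) measure) \<rightarrow>\<^sub>M borel"
    by (intro borel_measurable_continuous_onI continuous_intros)
  have "distr (std_gaussian :: (real ^ 'n) measure) borel (\<lambda>x. x $ i) = distr (\<Pi>\<^sub>M i\<in>(UNIV::'n set). ?N) borel (\<lambda>f. f i)"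
    unfolding std_gaussian_def distr_distr[OF c v] by (simp add: comp_def)
  also have "\<dots> = distr (\<Pi>\<^sub>M i\<in>(UNIV::'n set). ?N) ?N (\<lambda>f. f i)"
    by (rule distr_cong) simp_all
  also have "\<dots> = ?N" by (rule distr_PiM_component) (simp_all add: prob_space_std_normal)
  finally show ?thesis .
qed

text \<open>Changing the signs of coordinates is orthogonal; it annihilates all moments that are odd in some
  coordinate.\<close>

lemma std_gaussian_reflection:
  fixes c :: "'n::finite \<Rightarrow> real" and f :: "real ^ 'n \<Rightarrow> real"
  assumes c: "\<And>i. \<bar>c i\<bar> = 1" and f: "f \<in> borel_measurable borel"
  shows "(\<integral>x. f (\<chi> i. c i * x $ i) \<partial>std_gaussian) = (\<integral>x. f x \<partial>std_gaussian)"
proof -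
  let ?T = "\<lambda>x :: real ^ 'n. \<chi> i. c i * x $ i"
  have "orthogonal_transformation ?T"
    unfolding orthogonal_transformation
  proof (intro conjI allI)
    show "linear ?T" by (intro linearI) (simp_all add: vec_eq_iff algebra_simps)
    have "(c i * x $ i)\<^sup>2 = (x $ i)\<^sup>2" for x :: "real ^ 'n" and i
      by (metis c abs_mult lambda_one power2_abs)
    then show "norm (?T x) = norm x" for x by (simp add: norm_vec_def L2_set_def)
  qed
  note inv = std_gaussian_orthogonal_invariant[OF this]
  have "?T \<in> (borel :: (real ^ 'n) measure) \<rightarrow>\<^sub>M borel"
    by (intro borel_measurable_continuous_onI continuous_on_vec_lambda continuous_intros)
  then have "(\<integral>x. f x \<partial>distr std_gaussian borel ?T) = (\<integral>x. f (?T x) \<partial>std_gaussian)"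
    using f by (intro integral_distr) (simp_all cong: measurable_cong_sets)
  then show ?thesis by (simp add: inv)
qed

lemma std_gaussian_covariance:
  shows std_gaussian_integrable_coordinate_prod: "integrable (std_gaussian :: (real ^ 'n) measure) (\<lambda>x. x $ i * x $ j)"
    and std_gaussian_integrable_coordinate: "integrable (std_gaussian :: (real ^ 'n) measure) (\<lambda>x. x $ i)"
    and std_gaussian_mean: "(\<integral>x. x $ i \<partial>(std_gaussian :: (real ^ 'n) measure)) = 0"
    and std_gaussian_cov: "(\<integral>x. x $ i * x $ j \<partial>(std_gaussian :: (real ^ 'n) measure)) = (if i = j then 1 else 0)"
proof -
  interpret prob_space "std_gaussian :: (real ^ 'n) measure" by (rule prob_space_std_gaussian)
  have c[measurable]: "(\<lambda>x. x $ i) \<in> (borel :: (real ^ 'n) measure) \<rightarrow>\<^sub>M borel" for i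
    by (intro borel_measurable_continuous_onI continuous_intros)
  have sq: "integrable (std_gaussian :: (real ^ 'n) measure) (\<lambda>x. (x $ i)\<^sup>2) \<and> (\<integral>x. (x $ i)\<^sup>2 \<partial>(std_gaussian :: (real ^ 'n) measure)) = 1" for i
  proof -
    have m: "(\<lambda>x. x $ i) \<in> (std_gaussian :: (real ^ 'n) measure) \<rightarrow>\<^sub>M borel" by measurable
    have s: "(\<lambda>y::real. y\<^sup>2) \<in> borel_measurable borel" by measurable
    have has: "has_bochner_integral lborel (\<lambda>x. std_normal_density x * x\<^sup>2) 1"
      using std_normal_moment_even[of 1] by simp
    then have "has_bochner_integral (density lborel (\<lambda>x. ennreal (std_normal_density x))) (\<lambda>x. x\<^sup>2) 1"
      by (intro has_bochner_integral_density) auto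
    then have "has_bochner_integral (distr (std_gaussian :: (real ^ 'n) measure) borel (\<lambda>x. x $ i)) (\<lambda>x. x\<^sup>2) 1"
      by (simp add: std_gaussian_coordinate)
    then show ?thesis
      using integrable_distr_eq[OF m s] integral_distr[OF m s] by (simp add: has_bochner_integral_iff)
  qed
  show prod: "integrable (std_gaussian :: (real ^ 'n) measure) (\<lambda>x. x $ i * x $ j)" for i j
  proof (rule Bochner_Integration.integrable_bound[of _ "\<lambda>x. (x $ i)\<^sup>2 + (x $ j)\<^sup>2"])
    show "AE x in (std_gaussian :: (real ^ 'n) measure). norm (x $ i * x $ j) \<le> norm ((x $ i)\<^sup>2 + (x $ j)\<^sup>2)"
    proof (rule AE_I2)
      fix x :: "real ^ 'n"
      have "2 * \<bar>x $ i * x $ j\<bar> \<le> (x $ i)\<^sup>2 + (x $ j)\<^sup>2"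
        using sum_squares_bound[of "\<bar>x $ i\<bar>" "\<bar>x $ j\<bar>"] by (simp add: abs_mult)
      then show "norm (x $ i * x $ j) \<le> norm ((x $ i)\<^sup>2 + (x $ j)\<^sup>2)"
        unfolding real_norm_def by linarith
    qed
  qed (use sq in auto)
  show "integrable (std_gaussian :: (real ^ 'n) measure) (\<lambda>x. x $ i)"
  proof (rule Bochner_Integration.integrable_bound[of _ "\<lambda>x. 1 + (x $ i)\<^sup>2"])
    show "AE x in (std_gaussian :: (real ^ 'n) measure). norm (x $ i) \<le> norm (1 + (x $ i)\<^sup>2)"
    proof (rule AE_I2)
      fix x :: "real ^ 'n"
      have "2 * \<bar>x $ i\<bar> \<le> 1 + (x $ i)\<^sup>2" using sum_squares_bound[of 1 "\<bar>x $ i\<bar>"] by simp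
      then show "norm (x $ i) \<le> norm (1 + (x $ i)\<^sup>2)" unfolding real_norm_def by linarith
    qed
  qed (use sq in auto)
  show "(\<integral>x. x $ i \<partial>(std_gaussian :: (real ^ 'n) measure)) = 0"
    using std_gaussian_reflection[of "\<lambda>_. -1" "\<lambda>x. x $ i"] by simp
  show "(\<integral>x. x $ i * x $ j \<partial>(std_gaussian :: (real ^ 'n) measure)) = (if i = j then 1 else 0)"
  proof (cases "i = j")
    case True then show ?thesis using sq[of i] by (simp add: power2_eq_square)
  next
    case False
    have "(\<integral>x. - (x $ i * x $ j) \<partial>(std_gaussian :: (real ^ 'n) measure)) = (\<integral>x. x $ i * x $ j \<partial>(std_gaussian :: (real ^ 'n) measure))"
      using std_gaussian_reflection[of "\<lambda>k. if k = i then -1 else 1" "\<lambda>x. x $ i * x $ j"] False by simp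
    then show ?thesis using False by simp
  qed
qed

lemma std_gaussian_affine_second_moment:
  fixes A :: "real ^ 'k ^ 'n"
  shows "(\<integral>\<^sup>+x. ennreal ((norm (b + A *v x))\<^sup>2) \<partial>std_gaussian) = ennreal ((norm b)\<^sup>2 + (norm A)\<^sup>2)"
proof -
  let ?g = "std_gaussian :: (real ^ 'k) measure"
  interpret prob_space ?g by (rule prob_space_std_gaussian)
  have expand: "(norm (b + A *v x))\<^sup>2 = (\<Sum>i\<in>UNIV. (b $ i)\<^sup>2 + (\<Sum>j\<in>UNIV. 2 * b $ i * A $ i $ j * x $ j)
      + (\<Sum>j\<in>UNIV. \<Sum>k\<in>UNIV. A $ i $ j * A $ i $ k * (x $ j * x $ k)))" for x :: "real ^ 'k"
  proof -
    have "(norm (b + A *v x))\<^sup>2 = (\<Sum>i\<in>UNIV. (b $ i + (\<Sum>j\<in>UNIV. A $ i $ j * x $ j))\<^sup>2)"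
      unfolding power2_norm_eq_inner by (simp add: inner_vec_def matrix_vector_mult_def power2_eq_square)
    also have "\<dots> = (\<Sum>i\<in>UNIV. (b $ i)\<^sup>2 + (\<Sum>j\<in>UNIV. 2 * b $ i * A $ i $ j * x $ j)
      + (\<Sum>j\<in>UNIV. \<Sum>k\<in>UNIV. A $ i $ j * A $ i $ k * (x $ j * x $ k)))"
    proof (rule sum.cong[OF refl])
      fix i
      have "(\<Sum>j\<in>UNIV. A $ i $ j * x $ j)\<^sup>2 = (\<Sum>j\<in>UNIV. \<Sum>k\<in>UNIV. A $ i $ j * A $ i $ k * (x $ j * x $ k))"
        by (simp add: power2_eq_square sum_product mult_ac)
      moreover have "2 * b $ i * (\<Sum>j\<in>UNIV. A $ i $ j * x $ j) = (\<Sum>j\<in>UNIV. 2 * b $ i * A $ i $ j * x $ j)"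
        by (simp add: sum_distrib_left mult_ac)
      ultimately show "(b $ i + (\<Sum>j\<in>UNIV. A $ i $ j * x $ j))\<^sup>2 = (b $ i)\<^sup>2 + (\<Sum>j\<in>UNIV. 2 * b $ i * A $ i $ j * x $ j)
          + (\<Sum>j\<in>UNIV. \<Sum>k\<in>UNIV. A $ i $ j * A $ i $ k * (x $ j * x $ k))"
        by (simp only: power2_sum add_ac)
    qed
    finally show ?thesis .
  qed
  have int: "integrable ?g (\<lambda>x. (norm (b + A *v x))\<^sup>2)"
    unfolding expand
    by (intro Bochner_Integration.integrable_sum Bochner_Integration.integrable_add integrable_mult_right
        std_gaussian_integrable_coordinate_prod std_gaussian_integrable_coordinate) simp
  have "(\<integral>x. (norm (b + A *v x))\<^sup>2 \<partial>?g) = (\<Sum>i\<in>UNIV. (b $ i)\<^sup>2 + (\<Sum>j\<in>UNIV. A $ i $ j * A $ i $ j))"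
    unfolding expand
    by (simp add: Bochner_Integration.integral_sum Bochner_Integration.integral_add std_gaussian_cov std_gaussian_mean
        std_gaussian_integrable_coordinate_prod std_gaussian_integrable_coordinate
        prob_space[simplified] if_distrib cong: if_cong)
  also have "\<dots> = (norm b)\<^sup>2 + (norm A)\<^sup>2"
    unfolding power2_norm_eq_inner by (simp add: inner_vec_def sum.distrib power2_eq_square)
  finally show ?thesis using nn_integral_eq_integral[OF int] by simp
qed

section \<open>A space-filling curve with a measurable section\<close>

text \<open>A continuous function of period 2 that is 0 on \<open>[0, 1/3]\<close> and 1 on \<open>[2/3, 1]\<close>. At \<open>3 ^ m * t\<close> it
  therefore tells whether the ternary digit of \<open>t\<close> in position \<open>m\<close> is 0 or 2, for \<open>t\<close> in the Cantor set.\<close>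

definition schoenberg_wave :: "real \<Rightarrow> real" where
  "schoenberg_wave t = max 0 (min 1 (1 / 2 - cos (pi * t)))"

text \<open>The point of the Cantor set with the ternary digits \<open>2 * d m, 2 * d (m + 1), \<dots>\<close>.\<close>

definition ternary_tail :: "(nat \<Rightarrow> bool) \<Rightarrow> nat \<Rightarrow> real" where
  "ternary_tail d m = (\<Sum>i. 2 * of_bool (d (i + m)) / 3 ^ Suc i)"

lemma geometric_third: "(\<lambda>i. 2 * (1::real) / 3 ^ Suc i) sums 1"
proof -
  have "(\<lambda>i. 2 / 3 * (1 / 3 :: real) ^ i) sums (2 / 3 * (1 / (1 - 1 / 3)))"
    by (intro sums_mult geometric_sums) simp
  then show ?thesis by (simp add: power_divide)
qed

lemma ternary_tail_summable: "summable (\<lambda>i. 2 * of_bool (d (i + m)) / 3 ^ Suc i :: real)"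
  by (rule summable_comparison_test'[OF sums_summable[OF geometric_third], of 0])
    (simp add: divide_right_mono)

lemma ternary_tail_bounds: "0 \<le> ternary_tail d m" "ternary_tail d m \<le> 1"
proof -
  show "0 \<le> ternary_tail d m" unfolding ternary_tail_def
    by (intro suminf_nonneg ternary_tail_summable) simp
  have "ternary_tail d m \<le> (\<Sum>i. 2 * (1::real) / 3 ^ Suc i)" unfolding ternary_tail_def
    by (intro suminf_le ternary_tail_summable sums_summable[OF geometric_third])
      (simp add: divide_right_mono)
  then show "ternary_tail d m \<le> 1" using sums_unique[OF geometric_third] by simp
qed

lemma ternary_tail_Suc: "ternary_tail d m = 2 * of_bool (d m) / 3 + ternary_tail d (Suc m) / 3"
proof -
  have "ternary_tail d m = (\<Sum>i. 2 * of_bool (d (Suc i + m)) / 3 ^ Suc (Suc i)) + 2 * of_bool (d m) / 3"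
    unfolding ternary_tail_def by (subst suminf_split_head[OF ternary_tail_summable]) simp
  also have "(\<Sum>i. 2 * of_bool (d (Suc i + m)) / 3 ^ Suc (Suc i)) = (\<Sum>i. (2 * of_bool (d (i + Suc m)) / 3 ^ Suc i) / 3 :: real)"
    by (intro suminf_cong) simp
  also have "\<dots> = ternary_tail d (Suc m) / 3"
    unfolding ternary_tail_def by (rule suminf_divide[OF ternary_tail_summable])
  finally show ?thesis by simp
qed

text \<open>The integral part that appears when the ternary point is shifted is even, so that it is invisible
  to a function of period 2.\<close>

lemma ternary_shift: "\<exists>k::nat. 3 ^ m * ternary_tail d 0 = 2 * real k + ternary_tail d m"
proof (induction m)
  case 0
  show ?case by (rule exI[of _ 0]) simp
next
  case (Suc m)
  then obtain k where "3 ^ m * ternary_tail d 0 = 2 * real k + ternary_tail d m" by blast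
  then show ?case using ternary_tail_Suc[of d m]
    by (intro exI[of _ "3 * k + of_bool (d m)"]) (simp add: algebra_simps)
qed

lemma schoenberg_wave_reads_digit: "schoenberg_wave (3 ^ m * ternary_tail d 0) = of_bool (d m)"
proof -
  obtain k where k: "3 ^ m * ternary_tail d 0 = 2 * real k + ternary_tail d m"
    using ternary_shift by blast
  define s where "s = ternary_tail d m"
  have "cos (pi * (2 * real k + s)) = cos (pi * s)"
  proof -
    have "pi * (2 * real k + s) = pi * s + 2 * real k * pi" by (simp add: algebra_simps)
    then show ?thesis by (simp only: cos_add cos_2npi sin_2npi)
  qed
  moreover have "cos (pi * s) \<le> - (1 / 2)" if "d m"
  proof -
    have "2 / 3 \<le> s" "s \<le> 1" using ternary_tail_Suc[of d m] ternary_tail_bounds[of d m] ternary_tail_bounds[of d "Suc m"] that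
      by (auto simp: s_def)
    then have "cos (pi * s) \<le> cos (pi * (2 / 3))"
      by (intro cos_monotone_0_pi_le) (simp_all add: mult_left_mono)
    then show ?thesis using cos_120 by (simp add: mult.commute)
  qed
  moreover have "1 / 2 \<le> cos (pi * s)" if "\<not> d m"
  proof -
    have "s \<le> 1 / 3" "0 \<le> s" using ternary_tail_Suc[of d m] ternary_tail_bounds[of d m] ternary_tail_bounds[of d "Suc m"] that
      by (auto simp: s_def)
    then have "cos (pi * (1 / 3)) \<le> cos (pi * s)"
      by (intro cos_monotone_0_pi_le) (simp_all add: mult_left_mono)
    then show ?thesis by (simp add: cos_60)
  qed
  ultimately show ?thesis by (auto simp: schoenberg_wave_def k s_def)
qed

definition binary_digit :: "real \<Rightarrow> nat \<Rightarrow> bool" where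
  "binary_digit x k \<longleftrightarrow> odd \<lfloor>2 ^ Suc k * x\<rfloor>"

lemma binary_expansion:
  assumes "0 \<le> x" "x < 1"
  shows "(\<lambda>k. of_bool (binary_digit x k) / 2 ^ Suc k) sums x"
proof -
  have partial: "(\<Sum>k<n. of_bool (binary_digit x k) / 2 ^ Suc k) = real_of_int \<lfloor>2 ^ n * x\<rfloor> / 2 ^ n" for n
  proof (induction n)
    case 0
    have "\<lfloor>x\<rfloor> = 0" using assms by (simp add: floor_eq_iff)
    then show ?case by simp
  next
    case (Suc n)
    \<comment> \<open>Doubling \<open>y\<close> doubles its integer part and appends the next binary digit.\<close>
    have "\<lfloor>2 * y\<rfloor> = 2 * \<lfloor>y\<rfloor> + of_bool (odd \<lfloor>2 * y\<rfloor>)" for y :: real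
    proof -
      have "\<lfloor>2 * y\<rfloor> = 2 * \<lfloor>y\<rfloor> \<or> \<lfloor>2 * y\<rfloor> = 2 * \<lfloor>y\<rfloor> + 1" by linarith
      then show ?thesis by auto
    qed
    from arg_cong[OF this[of "2 ^ n * x"], of real_of_int]
    have "real_of_int \<lfloor>2 ^ Suc n * x\<rfloor> = 2 * real_of_int \<lfloor>2 ^ n * x\<rfloor> + of_bool (binary_digit x n)"
      by (simp only: binary_digit_def power_Suc mult.assoc of_int_add of_int_mult of_int_numeral of_int_of_bool)
    then show ?case using Suc.IH by (simp add: field_simps)
  qed
  have "(\<lambda>n. of_int \<lfloor>2 ^ n * x\<rfloor> / 2 ^ n) \<longlonglongrightarrow> x"
  proof (rule tendsto_sandwich[of "\<lambda>n. x - (1 / 2) ^ n" _ _ "\<lambda>_. x"])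
    show "\<forall>\<^sub>F n in sequentially. x - (1 / 2) ^ n \<le> of_int \<lfloor>2 ^ n * x\<rfloor> / 2 ^ n"
    proof (rule always_eventually, rule allI)
      fix n
      have "2 ^ n * x - 1 \<le> of_int \<lfloor>2 ^ n * x\<rfloor>" by linarith
      then have "(2 ^ n * x - 1) / 2 ^ n \<le> of_int \<lfloor>2 ^ n * x\<rfloor> / 2 ^ n" by (intro divide_right_mono) simp_all
      then show "x - (1 / 2) ^ n \<le> of_int \<lfloor>2 ^ n * x\<rfloor> / 2 ^ n" by (simp add: power_divide diff_divide_distrib)
    qed
    show "\<forall>\<^sub>F n in sequentially. of_int \<lfloor>2 ^ n * x\<rfloor> / 2 ^ n \<le> x"
      by (rule always_eventually) (simp add: field_simps)
    have "(\<lambda>n. x - (1 / 2) ^ n) \<longlonglongrightarrow> x - 0"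
      by (intro tendsto_intros LIMSEQ_power_zero) simp
    then show "(\<lambda>n. x - (1 / 2) ^ n) \<longlonglongrightarrow> x" by simp
  qed simp
  then show ?thesis by (simp only: sums_def partial)
qed

text \<open>Schoenberg's curve. The map \<open>\<psi>\<close> interleaves the binary digits of all coordinates of \<open>x\<close> into the digits
  of one point of the Cantor set, and \<open>\<Phi>\<close> recovers the coordinates from these digits. As a uniform
  limit \<open>\<Phi>\<close> is continuous, whereas \<open>\<psi>\<close> is merely measurable.\<close>

lemma space_filling_curve_unit_box:
  obtains \<Phi> :: "real \<Rightarrow> 'a::euclidean_space" and \<psi> :: "'a \<Rightarrow> real"
  where "continuous_on UNIV \<Phi>" "\<psi> \<in> borel_measurable borel" "\<And>x. 0 \<le> \<psi> x" "\<And>x. \<psi> x \<le> 1"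
    "\<And>x. (\<And>b. b \<in> Basis \<Longrightarrow> 0 \<le> x \<bullet> b \<and> x \<bullet> b < 1) \<Longrightarrow> \<Phi> (\<psi> x) = x"
proof -
  define I where "I = (Basis :: 'a set) \<times> (UNIV :: nat set)"
  have I: "countable I" unfolding I_def by (intro countable_SIGMA) (simp_all add: countable_finite)
  define d where "d x i = (case from_nat_into I i of (b, k) \<Rightarrow> binary_digit (x \<bullet> b) k)" for x :: 'a and i
  define \<psi> where "\<psi> x = ternary_tail (d x) 0" for x
  define w where "w b k t = schoenberg_wave (3 ^ to_nat_on I (b, k) * t) / 2 ^ Suc k" for b :: 'a and k :: nat and t :: real
  define \<Phi> where "\<Phi> t = (\<Sum>b\<in>Basis. (\<Sum>k. w b k t) *\<^sub>R b)" for t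
  show thesis
  proof
    have w_cont: "continuous_on UNIV (w b k)" for b k
      unfolding w_def schoenberg_wave_def by (intro continuous_intros) auto
    have "continuous_on UNIV (\<lambda>t. \<Sum>k. w b k t)" for b
    proof (rule uniform_limit_theorem)
      show "uniform_limit UNIV (\<lambda>n t. \<Sum>k<n. w b k t) (\<lambda>t. \<Sum>k. w b k t) sequentially"
      proof (rule Weierstrass_m_test)
        show "summable (\<lambda>k. (1 / 2 :: real) ^ Suc k)" by (simp add: summable_geometric)
        show "norm (w b k t) \<le> (1 / 2) ^ Suc k" for k t
          by (simp add: w_def schoenberg_wave_def power_divide divide_right_mono)
      qed
      show "\<forall>\<^sub>F n in sequentially. continuous_on UNIV (\<lambda>t. \<Sum>k<n. w b k t)"
        by (intro always_eventually allI continuous_on_sum w_cont)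
    qed simp
    then show "continuous_on UNIV \<Phi>" unfolding \<Phi>_def by (intro continuous_intros)
    have "(\<lambda>x. of_bool (d x i) :: real) \<in> borel_measurable borel" for i
    proof -
      obtain b k where bk: "from_nat_into I i = (b, k)" by (cases "from_nat_into I i")
      have "(\<lambda>x. of_bool (odd \<lfloor>2 ^ Suc k * (x \<bullet> b)\<rfloor>) :: real) \<in> borel_measurable borel"
        by measurable
      then show ?thesis by (simp add: d_def bk binary_digit_def)
    qed
    then show "\<psi> \<in> borel_measurable borel" unfolding \<psi>_def ternary_tail_def
      by (intro borel_measurable_suminf borel_measurable_divide borel_measurable_times) simp_all
    show "0 \<le> \<psi> x" "\<psi> x \<le> 1" for x by (simp_all add: \<psi>_def ternary_tail_bounds)
    fix x :: 'a assume x: "\<And>b. b \<in> Basis \<Longrightarrow> 0 \<le> x \<bullet> b \<and> x \<bullet> b < 1"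
    have "(\<Sum>k. w b k (\<psi> x)) = x \<bullet> b" if b: "b \<in> Basis" for b
    proof -
      have "from_nat_into I (to_nat_on I (b, k)) = (b, k)" for k
        using b by (intro from_nat_into_to_nat_on I) (auto simp: I_def)
      then have "w b k (\<psi> x) = of_bool (binary_digit (x \<bullet> b) k) / 2 ^ Suc k" for k
        by (simp add: w_def \<psi>_def schoenberg_wave_reads_digit d_def)
      then show ?thesis using binary_expansion[of "x \<bullet> b"] x[OF b] by (simp add: sums_iff)
    qed
    then show "\<Phi> (\<psi> x) = x" by (simp add: \<Phi>_def euclidean_representation)
  qed
qed

lemma space_filling_curve:
  fixes K :: "'a::euclidean_space set"
  assumes "bounded K"
  obtains \<Phi> :: "real \<Rightarrow> 'a" and \<psi> :: "'a \<Rightarrow> real"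
  where "continuous_on UNIV \<Phi>" "\<psi> \<in> borel_measurable borel" "\<And>x. 0 \<le> \<psi> x" "\<And>x. \<psi> x \<le> 1"
    "\<And>x. x \<in> K \<Longrightarrow> \<Phi> (\<psi> x) = x"
proof -
  obtain r where r: "0 < r" "\<And>x. x \<in> K \<Longrightarrow> norm x \<le> r" using assms by (metis bounded_pos)
  obtain \<Phi> :: "real \<Rightarrow> 'a" and \<psi> :: "'a \<Rightarrow> real" where
    c: "continuous_on UNIV \<Phi>" "\<psi> \<in> borel_measurable borel" "\<And>x. 0 \<le> \<psi> x" "\<And>x. \<psi> x \<le> 1"
    "\<And>x. (\<And>b. b \<in> Basis \<Longrightarrow> 0 \<le> x \<bullet> b \<and> x \<bullet> b < 1) \<Longrightarrow> \<Phi> (\<psi> x) = x"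
    by (rule space_filling_curve_unit_box) blast
  \<comment> \<open>This affine map sends \<open>K\<close> into the half-open unit box.\<close>
  define u where "u x = (1 / (2 * r + 1)) *\<^sub>R (x + r *\<^sub>R One)" for x :: 'a
  show thesis
  proof
    show "continuous_on UNIV (\<lambda>t. (2 * r + 1) *\<^sub>R \<Phi> t - r *\<^sub>R One)" by (intro continuous_intros c)
    have "u \<in> borel_measurable borel" unfolding u_def by measurable
    from measurable_compose[OF this c(2)] show "(\<lambda>x. \<psi> (u x)) \<in> borel_measurable borel" .
    fix x assume x: "x \<in> K"
    have "\<Phi> (\<psi> (u x)) = u x"
    proof (rule c(5))
      fix b :: 'a assume b: "b \<in> Basis"
      have "\<bar>x \<bullet> b\<bar> \<le> r" using Basis_le_norm[OF b, of x] r(2)[OF x] by simp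
      moreover have "u x \<bullet> b = (x \<bullet> b + r) / (2 * r + 1)" using b by (simp add: u_def inner_add_left)
      ultimately show "0 \<le> u x \<bullet> b \<and> u x \<bullet> b < 1" using r(1)
        by (simp only: abs_le_iff) (auto intro: divide_nonneg_pos simp: divide_less_eq)
    qed
    then show "(2 * r + 1) *\<^sub>R \<Phi> (\<psi> (u x)) - r *\<^sub>R One = x" using r(1) by (simp add: u_def)
  qed (use c in auto)
qed

section \<open>Weak sequential compactness\<close>

lemma borel_probs_distr:
  assumes "M \<in> borel_probs A" "f \<in> restrict_space borel A \<rightarrow>\<^sub>M restrict_space borel B"
  shows "distr M (restrict_space borel B) f \<in> borel_probs B"
proof -
  interpret prob_space M using assms by (simp add: borel_probs_def)
  have "f \<in> M \<rightarrow>\<^sub>M restrict_space borel B"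
    using assms by (simp add: borel_probs_def cong: measurable_cong_sets)
  then show ?thesis by (simp add: borel_probs_def prob_space_distr)
qed

lemma borel_probs_space: "M \<in> borel_probs A \<Longrightarrow> space M = A"
  by (auto simp: borel_probs_def space_restrict_space dest: sets_eq_imp_space_eq)

text \<open>The measures are moved to the line along the measurable section \<open>\<psi>\<close>, where Helly's selection
  theorem provides a weak limit, and the limit is moved back along the curve \<open>\<Phi>\<close>. For continuous \<open>g\<close>
  the function \<open>g \<circ> \<Phi>\<close> is continuous and agrees with \<open>g\<close> after \<open>\<psi>\<close>, so integrals of \<open>g\<close> converge.
  Testing with the truncated distance to \<open>K\<close> shows that the limit is carried by \<open>K\<close>, and Tietze's
  theorem extends functions that are continuous on \<open>K\<close> only.\<close>

lemma borel_probs_compact_subseq: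
  fixes K :: "'a::euclidean_space set"
  assumes K: "compact K" and M: "\<And>n. M n \<in> borel_probs K"
  obtains r N where "strict_mono (r :: nat \<Rightarrow> nat)" "N \<in> borel_probs K"
    "\<And>f :: 'a \<Rightarrow> real. continuous_on K f \<Longrightarrow> (\<lambda>n. \<integral>x. f x \<partial>M (r n)) \<longlonglongrightarrow> (\<integral>x. f x \<partial>N)"
proof -
  have closed: "closed K" and bdd: "bounded K" using K by (auto intro: compact_imp_closed compact_imp_bounded)
  then have Kb: "K \<in> sets borel" by auto
  obtain \<Phi> :: "real \<Rightarrow> 'a" and \<psi> :: "'a \<Rightarrow> real" where
    \<Phi>: "continuous_on UNIV \<Phi>" and \<psi>: "\<psi> \<in> borel_measurable borel" "\<And>x. 0 \<le> \<psi> x" "\<And>x. \<psi> x \<le> 1"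
    and retract: "\<And>x. x \<in> K \<Longrightarrow> \<Phi> (\<psi> x) = x"
    using space_filling_curve[OF bdd] by metis
  have sets_M: "sets (M n) = sets (restrict_space borel K)" and sp_M: "space (M n) = K"
    and prob_M: "prob_space (M n)" for n
    using M borel_probs_space[OF M] by (auto simp: borel_probs_def)
  have \<psi>M[measurable]: "\<psi> \<in> borel_measurable (M n)" for n
    using measurable_restrict_space1[OF \<psi>(1)] sets_M by (simp cong: measurable_cong_sets)
  define \<rho> where "\<rho> n = distr (M n) borel \<psi>" for n
  have \<rho>: "real_distribution (\<rho> n)" for n
    unfolding \<rho>_def using prob_M by (intro prob_space.real_distribution_distr) auto
  have "tight \<rho>"
    unfolding tight_def
  proof (intro conjI allI impI \<rho>)
    fix \<epsilon> :: real assume "0 < \<epsilon>"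
    have "measure (\<rho> n) {-1<..1} = 1" for n
    proof -
      have "\<psi> -` {-1<..1} \<inter> space (M n) = space (M n)" by (auto simp: \<psi>(3) less_le_trans[OF _ \<psi>(2)])
      then show ?thesis using prob_space.prob_space[OF prob_M] by (simp add: \<rho>_def measure_distr)
    qed
    then show "\<exists>a b. a < b \<and> (\<forall>n. 1 - \<epsilon> < measure (\<rho> n) {a<..b})" using \<open>0 < \<epsilon>\<close>
      by (intro exI[of _ "-1"] exI[of _ 1]) auto
  qed
  from tight_imp_convergent_subsubsequence[OF this strict_mono_id]
  obtain r P where r: "strict_mono (r :: nat \<Rightarrow> nat)" and P: "real_distribution P"
    and conv: "weak_conv_m (\<rho> \<circ> id \<circ> r) P" by blast
  interpret P: real_distribution P by fact
  have \<Phi>m[measurable]: "\<Phi> \<in> borel_measurable borel" by (rule borel_measurable_continuous_onI[OF \<Phi>])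
  define N' where "N' = distr P borel \<Phi>"
  interpret N': prob_space N' unfolding N'_def by (rule P.prob_space_distr) simp
  have sets_N'[simp, measurable_cong]: "sets N' = sets borel" and [simp]: "space N' = UNIV" by (auto simp: N'_def)
  have lim: "(\<lambda>n. \<integral>x. g x \<partial>M (r n)) \<longlonglongrightarrow> (\<integral>x. g x \<partial>N')"
    if g: "continuous_on UNIV g" and B: "\<And>x. norm (g x) \<le> B" for g :: "'a \<Rightarrow> real" and B
  proof -
    have gm[measurable]: "g \<in> borel_measurable borel" by (rule borel_measurable_continuous_onI[OF g])
    have "continuous_on UNIV (\<lambda>t. g (\<Phi> t))"
      by (rule continuous_on_compose2[OF g \<Phi>]) auto
    then have "isCont (\<lambda>t. g (\<Phi> t)) t" for t by (simp add: continuous_on_eq_continuous_at)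
    then have "(\<lambda>n. integral\<^sup>L ((\<rho> \<circ> id \<circ> r) n) (\<lambda>t. g (\<Phi> t))) \<longlonglongrightarrow> integral\<^sup>L P (\<lambda>t. g (\<Phi> t))"
      by (intro weak_conv_imp_integral_bdd_continuous_conv[OF _ P conv, where B = B])
        (use B \<rho> in auto)
    moreover have "integral\<^sup>L ((\<rho> \<circ> id \<circ> r) n) (\<lambda>t. g (\<Phi> t)) = (\<integral>x. g x \<partial>M (r n))" for n
    proof -
      have "integral\<^sup>L ((\<rho> \<circ> id \<circ> r) n) (\<lambda>t. g (\<Phi> t)) = (\<integral>x. g (\<Phi> (\<psi> x)) \<partial>M (r n))"
        by (simp add: \<rho>_def integral_distr)
      also have "\<dots> = (\<integral>x. g x \<partial>M (r n))"
        by (rule Bochner_Integration.integral_cong) (auto simp: sp_M retract)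
      finally show ?thesis .
    qed
    ultimately show ?thesis by (simp add: N'_def integral_distr)
  qed
  have AE_K: "AE x in N'. x \<in> K"
  proof -
    define g where "g x = min 1 (infdist x K)" for x
    have g: "continuous_on UNIV g" unfolding g_def by (intro continuous_intros)
    have gB: "norm (g x) \<le> 1" for x by (simp add: g_def infdist_nonneg)
    have gm[measurable]: "g \<in> borel_measurable borel" by (rule borel_measurable_continuous_onI[OF g])
    have "(\<integral>x. g x \<partial>M (r n)) = 0" for n
    proof -
      have "(\<integral>x. g x \<partial>M (r n)) = (\<integral>x. 0 \<partial>M (r n))"
        by (rule Bochner_Integration.integral_cong) (auto simp: sp_M g_def)
      then show ?thesis by simp
    qed
    then have "(\<integral>x. g x \<partial>N') = 0" using lim[OF g gB] by (simp add: LIMSEQ_const_iff)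
    moreover have "integrable N' g" by (rule N'.integrable_const_bound[of _ 1]) (use gB in auto)
    ultimately have g0: "AE x in N'. g x = 0"
      by (subst (asm) integral_nonneg_eq_0_iff_AE) (auto simp: g_def infdist_nonneg)
    have ne: "K \<noteq> {}" using prob_space.not_empty[OF prob_M] sp_M by simp
    from g0 show ?thesis
    proof eventually_elim
      case (elim x)
      then have "infdist x K = 0" by (simp add: g_def min_def split: if_splits)
      then show "x \<in> K" using in_closed_iff_infdist_zero[OF closed ne] by simp
    qed
  qed
  define N where "N = restrict_space N' K"
  have Kev: "K \<inter> space N' \<in> sets N'" using Kb by simp
  have N: "N \<in> borel_probs K"
  proof -
    have "emeasure N' K = 1" using AE_K Kb by (simp add: N'.emeasure_eq_1_AE)
    then have "prob_space N" unfolding N_def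
      by (intro prob_spaceI) (simp add: emeasure_restrict_space Kb space_restrict_space)
    moreover have "sets N = sets (restrict_space borel K)"
      by (simp add: N_def sets_restrict_space)
    ultimately show ?thesis by (simp add: borel_probs_def)
  qed
  have "(\<lambda>n. \<integral>x. f x \<partial>M (r n)) \<longlonglongrightarrow> (\<integral>x. f x \<partial>N)" if f: "continuous_on K f" for f :: "'a \<Rightarrow> real"
  proof -
    have "bounded (f ` K)" by (intro compact_imp_bounded compact_continuous_image f K)
    then obtain B where "0 < B" "\<And>x. x \<in> K \<Longrightarrow> norm (f x) \<le> B" by (auto simp: bounded_pos)
    then obtain g where g: "continuous_on UNIV g" "\<And>x. x \<in> K \<Longrightarrow> g x = f x" "\<And>x. norm (g x) \<le> B"
      using Tietze[OF f, of UNIV B] closed by (auto simp: less_imp_le)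
    have gm[measurable]: "g \<in> borel_measurable borel" by (rule borel_measurable_continuous_onI[OF g(1)])
    have "(\<integral>x. f x \<partial>M (r n)) = (\<integral>x. g x \<partial>M (r n))" for n
      by (rule Bochner_Integration.integral_cong) (auto simp: sp_M g)
    moreover have "(\<integral>x. f x \<partial>N) = (\<integral>x. g x \<partial>N')"
    proof -
      have "(\<integral>x. f x \<partial>N) = (\<integral>x. g x \<partial>N)"
        by (rule Bochner_Integration.integral_cong) (auto simp: borel_probs_space[OF N] g)
      also have "\<dots> = (\<integral>x. indicator K x *\<^sub>R g x \<partial>N')"
        unfolding N_def by (rule integral_restrict_space[OF Kev])
      also have "\<dots> = (\<integral>x. g x \<partial>N')"
        by (rule integral_cong_AE) (use AE_K Kb in \<open>auto elim!: eventually_mono\<close>)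
      finally show ?thesis .
    qed
    ultimately show ?thesis using lim[OF g(1,3)] by simp
  qed
  then show thesis using that r N by blast
qed

section \<open>Gaussian kernels\<close>

lemma nn_integral_distr':
  "T \<in> M \<rightarrow>\<^sub>M M' \<Longrightarrow> f \<in> borel_measurable M' \<Longrightarrow> (\<integral>\<^sup>+x. f x \<partial>distr M M' T) = (\<integral>\<^sup>+x. f (T x) \<partial>M)"
  by (rule nn_integral_distr) simp_all

lemma gaussian_sets [simp, measurable_cong]: "sets (gaussian s) = sets borel"
  by (simp add: gaussian_def)

lemma gaussian_map_measurable: "(\<lambda>x. m + A *v x) \<in> std_gaussian \<rightarrow>\<^sub>M borel"
  by (simp cong: measurable_cong_sets)
    (intro borel_measurable_continuous_onI continuous_on_matrix_vector_mult continuous_intros)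

lemma prob_space_gaussian: "prob_space (gaussian s)"
  unfolding gaussian_def by (rule prob_space.prob_space_distr[OF prob_space_std_gaussian gaussian_map_measurable])

lemma gaussian_kernel:
  fixes X :: "((real ^ 'n) \<times> (real ^ 'n ^ 'n)) set"
  assumes X: "X \<subseteq> UNIV \<times> psd_matrices"
  shows "gaussian \<in> restrict_space borel X \<rightarrow>\<^sub>M subprob_algebra borel"
  unfolding gaussian_def
proof (rule measurable_distr2)
  let ?L = "restrict_space borel X"
  have m: "fst \<in> borel_measurable ?L"
    by (intro borel_measurable_continuous_on_restrict continuous_intros)
  have "continuous_on X (\<lambda>s. psd_sqrt (snd s))"
    by (rule continuous_on_compose2[OF continuous_on_psd_sqrt]) (use X in \<open>auto intro!: continuous_intros\<close>)
  then have s: "(\<lambda>s. psd_sqrt (snd s)) \<in> borel_measurable ?L"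
    by (rule borel_measurable_continuous_on_restrict)
  have m2: "(\<lambda>p. fst (fst p)) \<in> borel_measurable (?L \<Otimes>\<^sub>M (borel :: (real ^ 'n) measure))"
    by (rule measurable_compose[OF measurable_fst m])
  have s2: "(\<lambda>p. psd_sqrt (snd (fst p))) \<in> borel_measurable (?L \<Otimes>\<^sub>M (borel :: (real ^ 'n) measure))"
    by (rule measurable_compose[OF measurable_fst s])
  have "(\<lambda>p. psd_sqrt (snd (fst p)) *v snd p) \<in> borel_measurable (?L \<Otimes>\<^sub>M (borel :: (real ^ 'n) measure))"
    by (rule borel_measurable_continuous_Pair[OF s2 measurable_snd])
      (intro continuous_on_matrix_vector_mult continuous_intros)
  then show "(\<lambda>(s, x). fst s + psd_sqrt (snd s) *v x) \<in> ?L \<Otimes>\<^sub>M (borel :: (real ^ 'n) measure) \<rightarrow>\<^sub>M borel"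
    unfolding case_prod_beta by (intro borel_measurable_add m2)
  have "std_gaussian \<in> space (subprob_algebra (borel :: (real ^ 'n) measure))"
    by (simp add: space_subprob_algebra prob_space_imp_subprob_space prob_space_std_gaussian)
  then show "(\<lambda>_. std_gaussian) \<in> ?L \<rightarrow>\<^sub>M subprob_algebra (borel :: (real ^ 'n) measure)" by simp
qed

lemma continuous_on_split_vec: "continuous_on X split_vec"
  unfolding split_vec_def by (intro continuous_on_Pair continuous_on_vec_lambda continuous_intros)

lemma continuous_on_join_vec: "continuous_on X (join_vec :: (real ^ 'n) \<times> (real ^ 'n) \<Rightarrow> _)"
  unfolding join_vec_def
proof (intro continuous_on_vec_lambda)
  fix k :: "'n + 'n"
  show "continuous_on X (\<lambda>m. case k of Inl i \<Rightarrow> fst m $ i | Inr i \<Rightarrow> snd m $ i)"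
    by (cases k) (auto intro!: continuous_intros)
qed

lemma continuous_on_block:
  assumes "continuous_on X F" shows "continuous_on X (\<lambda>x. block f g (F x))"
  unfolding block_def by (intro continuous_on_vec_lambda continuous_intros assms)

lemma gaussian2_sets [simp, measurable_cong]: "sets (gaussian2 z) = sets borel"
  by (simp add: gaussian2_def)

lemma split_vec_measurable: "split_vec \<in> (borel :: (real ^ ('n::finite + 'n)) measure) \<rightarrow>\<^sub>M borel"
  by (intro borel_measurable_continuous_onI continuous_on_split_vec)

lemma prob_space_gaussian2: "prob_space (gaussian2 z)"
  unfolding gaussian2_def
  by (rule prob_space.prob_space_distr[OF prob_space_gaussian])
    (simp add: split_vec_measurable cong: measurable_cong_sets)

lemma gaussian2_kernel:
  fixes X :: "(((real ^ 'n) \<times> (real ^ 'n)) \<times> (real ^ ('n + 'n) ^ ('n + 'n))) set"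
  assumes X: "X \<subseteq> UNIV \<times> psd_matrices"
  shows "gaussian2 \<in> restrict_space borel X \<rightarrow>\<^sub>M subprob_algebra borel"
proof -
  let ?J = "\<lambda>z :: ((real ^ 'n) \<times> (real ^ 'n)) \<times> (real ^ ('n + 'n) ^ ('n + 'n)). (join_vec (fst z), snd z)"
  let ?Y = "UNIV \<times> psd_matrices :: ((real ^ ('n + 'n)) \<times> (real ^ ('n + 'n) ^ ('n + 'n))) set"
  have "continuous_on X ?J"
    by (intro continuous_on_Pair continuous_on_compose2[OF continuous_on_join_vec] continuous_intros) auto
  then have "?J \<in> restrict_space borel X \<rightarrow>\<^sub>M restrict_space borel ?Y"
    using X by (intro measurable_restrict_space2 borel_measurable_continuous_on_restrict)
      (auto simp: space_restrict_space)
  from measurable_compose[OF measurable_compose[OF this gaussian_kernel] measurable_distr[OF split_vec_measurable]]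
  show ?thesis by (simp add: gaussian2_def[abs_def])
qed

subsection \<open>Marginals and transport cost of a joint Gaussian\<close>

definition row_block :: "('n \<Rightarrow> 'k) \<Rightarrow> real ^ 'm ^ 'k \<Rightarrow> real ^ 'm ^ 'n" where
  "row_block f R = (\<chi> i. R $ f i)"

lemma block_congruence:
  fixes f g :: "'n::finite \<Rightarrow> 'k::finite"
  shows "block f g (R ** Q ** transpose R) = row_block f R ** Q ** transpose (row_block g R)"
  by (simp add: block_def row_block_def matrix_matrix_mult_def transpose_def vec_eq_iff)

lemma block_gram:
  fixes f g :: "'n::finite \<Rightarrow> 'k::finite"
  shows "block f g (R ** transpose R) = row_block f R ** transpose (row_block g R)"
  using block_congruence[of f g R "mat 1"] by simp

lemma gaussian2_eq:
  "gaussian2 ((m\<^sub>1, m\<^sub>2), Q) = distr std_gaussian borel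
     (\<lambda>x. (m\<^sub>1 + row_block Inl (psd_sqrt Q) *v x, m\<^sub>2 + row_block Inr (psd_sqrt Q) *v x))"
proof -
  have "split_vec (join_vec (m\<^sub>1, m\<^sub>2) + psd_sqrt Q *v x) =
    (m\<^sub>1 + row_block Inl (psd_sqrt Q) *v x, m\<^sub>2 + row_block Inr (psd_sqrt Q) *v x)" for x
    by (simp add: split_vec_def join_vec_def row_block_def vec_eq_iff matrix_vector_mult_def)
  then show ?thesis
    unfolding gaussian2_def gaussian_def distr_distr[OF split_vec_measurable gaussian_map_measurable]
    by (simp add: comp_def)
qed

lemma affine_pair_measurable:
  fixes A B :: "real ^ 'k ^ 'n"
  shows "(\<lambda>x. (m\<^sub>1 + A *v x, m\<^sub>2 + B *v x)) \<in> std_gaussian \<rightarrow>\<^sub>M borel"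
  by (simp cong: measurable_cong_sets)
    (intro borel_measurable_continuous_onI continuous_on_Pair continuous_on_matrix_vector_mult continuous_intros)

lemma gaussian2_marginals:
  assumes Q: "Q \<in> psd_matrices"
  shows gaussian2_fst: "block Inl Inl Q \<in> pd_matrices \<Longrightarrow>
      distr (gaussian2 ((m\<^sub>1, m\<^sub>2), Q)) borel fst = gaussian (m\<^sub>1, block Inl Inl Q)"
    and gaussian2_snd: "block Inr Inr Q \<in> pd_matrices \<Longrightarrow>
      distr (gaussian2 ((m\<^sub>1, m\<^sub>2), Q)) borel snd = gaussian (m\<^sub>2, block Inr Inr Q)"
proof -
  have m: "fst \<in> (borel :: ((real ^ 'a) \<times> (real ^ 'a)) measure) \<rightarrow>\<^sub>M borel"
    "snd \<in> (borel :: ((real ^ 'a) \<times> (real ^ 'a)) measure) \<rightarrow>\<^sub>M borel"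
    by (intro borel_measurable_continuous_onI continuous_intros)+
  have blk: "row_block f (psd_sqrt Q) ** transpose (row_block f (psd_sqrt Q)) = block f f Q" for f :: "'a \<Rightarrow> 'a + 'a"
    using block_gram[of f f "psd_sqrt Q"] by (simp add: psd_sqrt_sym psd_sqrt_mult Q)
  show "distr (gaussian2 ((m\<^sub>1, m\<^sub>2), Q)) borel fst = gaussian (m\<^sub>1, block Inl Inl Q)"
    if "block Inl Inl Q \<in> pd_matrices"
    unfolding gaussian2_eq distr_distr[OF m(1) affine_pair_measurable]
    using std_gaussian_affine_image[OF blk that] by (simp add: comp_def)
  show "distr (gaussian2 ((m\<^sub>1, m\<^sub>2), Q)) borel snd = gaussian (m\<^sub>2, block Inr Inr Q)"
    if "block Inr Inr Q \<in> pd_matrices"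
    unfolding gaussian2_eq distr_distr[OF m(2) affine_pair_measurable]
    using std_gaussian_affine_image[OF blk that] by (simp add: comp_def)
qed

lemma sq_dist_measurable:
  "(\<lambda>(y\<^sub>1, y\<^sub>2). ennreal ((norm (y\<^sub>1 - y\<^sub>2))\<^sup>2)) \<in> borel_measurable (borel :: ((real ^ 'n) \<times> (real ^ 'n)) measure)"
  unfolding case_prod_beta
  by (intro measurable_compose[OF _ measurable_ennreal] borel_measurable_continuous_onI continuous_intros)

text \<open>If \<open>A\<close> and \<open>B\<close> are the upper and lower halves of the square root of \<open>Q\<close>, then \<open>y\<^sub>1 - y\<^sub>2\<close> is an affine image
  of a standard Gaussian with linear part \<open>A - B\<close>, and the Gram matrices of \<open>A\<close> and \<open>B\<close> are the blocks
  of \<open>Q\<close>.\<close>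

lemma transport_cost_gaussian2:
  assumes Q: "Q \<in> psd_matrices"
  shows "transport_cost (gaussian2 ((m\<^sub>1, m\<^sub>2), Q)) =
    ennreal ((norm (m\<^sub>1 - m\<^sub>2))\<^sup>2 + (trace (block Inl Inl Q) + trace (block Inr Inr Q) - 2 * trace (block Inl Inr Q)))"
proof -
  define A where "A = row_block Inl (psd_sqrt Q)"
  define B where "B = row_block Inr (psd_sqrt Q)"
  have blk: "row_block f (psd_sqrt Q) ** transpose (row_block g (psd_sqrt Q)) = block f g Q" for f g :: "'a \<Rightarrow> 'a + 'a"
    using block_gram[of f g "psd_sqrt Q"] by (simp add: psd_sqrt_sym psd_sqrt_mult Q)
  have diff: "m\<^sub>1 + A *v x - (m\<^sub>2 + B *v x) = (m\<^sub>1 - m\<^sub>2) + (A - B) *v x" for x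
    by (simp add: matrix_vector_mult_diff_rdistrib)
  have "transport_cost (gaussian2 ((m\<^sub>1, m\<^sub>2), Q)) = (\<integral>\<^sup>+x. ennreal ((norm ((m\<^sub>1 - m\<^sub>2) + (A - B) *v x))\<^sup>2) \<partial>std_gaussian)"
    unfolding transport_cost_def gaussian2_eq nn_integral_distr'[OF affine_pair_measurable sq_dist_measurable]
    by (simp only: A_def[symmetric] B_def[symmetric] prod.case diff)
  also have "\<dots> = ennreal ((norm (m\<^sub>1 - m\<^sub>2))\<^sup>2 + (norm (A - B))\<^sup>2)" by (rule std_gaussian_affine_second_moment)
  also have "(norm (A - B))\<^sup>2 = A \<bullet> A + B \<bullet> B - 2 * (A \<bullet> B)"
    unfolding power2_norm_eq_inner by (simp add: inner_diff inner_commute)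
  also have "\<dots> = trace (block Inl Inl Q) + trace (block Inr Inr Q) - 2 * trace (block Inl Inr Q)"
    by (simp add: inner_eq_trace A_def B_def blk)
  finally show ?thesis .
qed

lemma bw_sq_eq:
  "bw_sq (m\<^sub>1, P) (m\<^sub>2, Q) = (norm (m\<^sub>1 - m\<^sub>2))\<^sup>2 + (trace P + trace Q - 2 * trace (bures_root P Q))"
  by (simp add: bw_sq_def bures_root_def trace_def sum_subtractf sum.distrib sum_distrib_left)

text \<open>Only the off-diagonal block of \<open>Q\<close> is free once the marginals are fixed, and \<open>bures_upper_bound\<close>
  limits its trace.\<close>

lemma bw_sq_le_transport_cost:
  assumes Q: "Q \<in> psd_matrices" and pd: "block Inl Inl Q \<in> pd_matrices" "block Inr Inr Q \<in> pd_matrices"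
  shows "ennreal (bw_sq (m\<^sub>1, block Inl Inl Q) (m\<^sub>2, block Inr Inr Q)) \<le> transport_cost (gaussian2 ((m\<^sub>1, m\<^sub>2), Q))"
proof -
  let ?A = "row_block Inl (psd_sqrt Q)" and ?B = "row_block Inr (psd_sqrt Q)"
  have blk: "row_block f (psd_sqrt Q) ** transpose (row_block g (psd_sqrt Q)) = block f g Q" for f g :: "'a \<Rightarrow> 'a + 'a"
    using block_gram[of f g "psd_sqrt Q"] by (simp add: psd_sqrt_sym psd_sqrt_mult Q)
  have "trace (block Inl Inr Q) = ?A \<bullet> ?B" by (simp add: inner_eq_trace blk)
  also have "\<dots> \<le> trace (bures_root (block Inl Inl Q) (block Inr Inr Q))"
    by (rule bures_upper_bound[OF blk pd(1) blk pd(2)])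
  finally show ?thesis
    unfolding transport_cost_gaussian2[OF Q] bw_sq_eq by (intro ennreal_leI) simp
qed

subsection \<open>The optimal joint covariance\<close>

text \<open>The covariance of \<open>(X, T X)\<close> for \<open>X\<close> of covariance \<open>P\<close> and \<open>T\<close> the optimal transport matrix.\<close>

definition optimal_joint_cov :: "real ^ 'n ^ 'n \<Rightarrow> real ^ 'n ^ 'n \<Rightarrow> real ^ ('n + 'n) ^ ('n + 'n)" where
  "optimal_joint_cov P Q =
     (let G = (\<chi> k. case k of Inl i \<Rightarrow> mat 1 $ i | Inr i \<Rightarrow> monge_matrix P Q $ i) in G ** P ** transpose G)"

lemma optimal_joint_cov:
  assumes P: "P \<in> pd_matrices" and Q: "Q \<in> pd_matrices"
  shows optimal_joint_cov_psd: "optimal_joint_cov P Q \<in> psd_matrices"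
    and optimal_joint_cov_Inl: "block Inl Inl (optimal_joint_cov P Q) = P"
    and optimal_joint_cov_Inr: "block Inr Inr (optimal_joint_cov P Q) = Q"
    and optimal_joint_cov_trace: "trace (block Inl Inr (optimal_joint_cov P Q)) = trace (bures_root P Q)"
proof -
  let ?T = "monge_matrix P Q"
  note T = monge_matrix[OF P Q]
  have Ts: "transpose ?T = ?T" using T(1) by (simp add: psd_matrices_def)
  define G :: "real ^ 'a ^ ('a + 'a)" where "G = (\<chi> k. case k of Inl i \<Rightarrow> mat 1 $ i | Inr i \<Rightarrow> ?T $ i)"
  have J: "optimal_joint_cov P Q = G ** P ** transpose G" by (simp add: optimal_joint_cov_def G_def Let_def)
  have G: "row_block Inl G = mat 1" "row_block Inr G = ?T" by (simp_all add: row_block_def G_def vec_eq_iff)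
  show "optimal_joint_cov P Q \<in> psd_matrices" unfolding J by (intro psd_congruence pd_psd P)
  show "block Inl Inl (optimal_joint_cov P Q) = P" "block Inr Inr (optimal_joint_cov P Q) = Q"
    "trace (block Inl Inr (optimal_joint_cov P Q)) = trace (bures_root P Q)"
    by (simp_all add: J block_congruence G Ts T)
qed

lemma transport_cost_optimal_joint:
  assumes "P \<in> pd_matrices" "Q \<in> pd_matrices"
  shows "transport_cost (gaussian2 ((m\<^sub>1, m\<^sub>2), optimal_joint_cov P Q)) = ennreal (bw_sq (m\<^sub>1, P) (m\<^sub>2, Q))"
  by (simp add: transport_cost_gaussian2 optimal_joint_cov[OF assms] bw_sq_eq)

lemma continuous_on_bures_root:
  fixes F G :: "'a::topological_space \<Rightarrow> real ^ 'n ^ 'n"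
  assumes F: "continuous_on X F" "\<And>x. x \<in> X \<Longrightarrow> F x \<in> psd_matrices"
    and G: "continuous_on X G" "\<And>x. x \<in> X \<Longrightarrow> G x \<in> psd_matrices"
  shows "continuous_on X (\<lambda>x. bures_root (F x) (G x))"
  unfolding bures_root_def
  by (rule continuous_on_compose2[OF continuous_on_psd_sqrt])
    (auto intro!: continuous_on_matrix_mult continuous_on_compose2[OF continuous_on_psd_sqrt F(1)] G(1) bures_root_arg_psd simp: F(2) G(2))

text \<open>Continuity makes the optimal joint covariance a measurable function of the two marginal
  parameters, so that it can be selected simultaneously for all components of a mixture.\<close>

lemma continuous_on_optimal_joint_cov:
  fixes F G :: "'a::topological_space \<Rightarrow> real ^ 'n ^ 'n"
  assumes F: "continuous_on X F" "\<And>x. x \<in> X \<Longrightarrow> F x \<in> pd_matrices"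
    and G: "continuous_on X G" "\<And>x. x \<in> X \<Longrightarrow> G x \<in> pd_matrices"
  shows "continuous_on X (\<lambda>x. optimal_joint_cov (F x) (G x))"
proof -
  have inv: "continuous_on X (\<lambda>x. matrix_inv (psd_sqrt (F x)))"
    by (intro continuous_on_matrix_inv continuous_on_compose2[OF continuous_on_psd_sqrt F(1)])
      (auto simp: F(2) pd_psd pd_sqrt_invertible)
  have T: "continuous_on X (\<lambda>x. monge_matrix (F x) (G x))"
    unfolding monge_matrix_def
    by (intro continuous_on_matrix_mult inv continuous_on_bures_root F(1) G(1)) (auto simp: F(2) G(2) pd_psd)
  have "continuous_on X (\<lambda>x. (\<chi> k. case k of Inl i \<Rightarrow> mat 1 $ i | Inr i \<Rightarrow> monge_matrix (F x) (G x) $ i) :: real ^ 'n ^ ('n + 'n))"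
  proof (intro continuous_on_vec_lambda)
    fix k :: "'n + 'n"
    show "continuous_on X (\<lambda>x. case k of Inl i \<Rightarrow> mat 1 $ i | Inr i \<Rightarrow> monge_matrix (F x) (G x) $ i)"
      by (cases k) (auto intro!: continuous_intros T)
  qed
  then show ?thesis
    unfolding optimal_joint_cov_def Let_def
    by (intro continuous_on_matrix_mult continuous_on_transpose F(1))
qed

lemma continuous_on_bw_sq:
  fixes S :: "((real ^ 'n) \<times> (real ^ 'n ^ 'n)) set"
  assumes S: "S \<subseteq> UNIV \<times> psd_matrices"
  shows "continuous_on (S \<times> S) (\<lambda>p. bw_sq (fst p) (snd p))"
proof -
  have "continuous_on (S \<times> S) (\<lambda>p. (norm (fst (fst p) - fst (snd p)))\<^sup>2 +
     (trace (snd (fst p)) + trace (snd (snd p)) - 2 * trace (bures_root (snd (fst p)) (snd (snd p)))))"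
    using S by (intro continuous_intros continuous_on_trace continuous_on_bures_root) auto
  then show ?thesis by (simp add: bw_sq_eq[symmetric])
qed

section \<open>Mixtures and couplings\<close>

text \<open>Mixtures are binds in the Giry monad; this form gives access to its laws for image measures and
  integrals.\<close>

lemma mixture_eq_bind:
  assumes K: "K \<in> M \<rightarrow>\<^sub>M subprob_algebra N" and ne: "space M \<noteq> {}" and sets: "sets \<nu> = sets N"
  shows "\<nu> = M \<bind> K \<longleftrightarrow> (\<forall>A\<in>sets N. emeasure \<nu> A = (\<integral>\<^sup>+z. emeasure (K z) A \<partial>M))"
proof
  assume "\<forall>A\<in>sets N. emeasure \<nu> A = (\<integral>\<^sup>+z. emeasure (K z) A \<partial>M)"
  then show "\<nu> = M \<bind> K"
    by (intro measure_eqI) (simp_all add: sets sets_bind_measurable[OF K ne] emeasure_bind[OF ne K])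
qed (simp add: emeasure_bind[OF ne K])

lemma borel_probs_measurable_cong:
  "M \<in> borel_probs A \<Longrightarrow> M \<rightarrow>\<^sub>M N = restrict_space borel A \<rightarrow>\<^sub>M N"
  by (rule measurable_cong_sets) (simp_all add: borel_probs_def)

lemma borel_probs_UNIV: "\<mu> \<in> borel_probs UNIV \<longleftrightarrow> prob_space \<mu> \<and> sets \<mu> = sets borel"
  by (simp add: borel_probs_def sets_restrict_space)

lemma borel_probs_ne: "M \<in> borel_probs A \<Longrightarrow> space M \<noteq> {}"
  by (simp add: borel_probs_def prob_space.not_empty)

context
  fixes S :: "((real ^ 'n) \<times> (real ^ 'n ^ 'n)) set"
  assumes pd: "S \<subseteq> UNIV \<times> pd_matrices"
begin

lemma pd_parameters_psd: "S \<subseteq> UNIV \<times> psd_matrices" using pd pd_psd by blast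

lemma Z_S_psd: "Z_S S \<subseteq> UNIV \<times> psd_matrices" by (auto simp: Z_S_def)

lemma gaussian_kernel_fst: "(\<lambda>p. gaussian (fst p)) \<in> restrict_space borel (S \<times> S) \<rightarrow>\<^sub>M subprob_algebra borel"
  and gaussian_kernel_snd: "(\<lambda>p. gaussian (snd p)) \<in> restrict_space borel (S \<times> S) \<rightarrow>\<^sub>M subprob_algebra borel"
  and fst_measurable: "fst \<in> restrict_space borel (S \<times> S) \<rightarrow>\<^sub>M restrict_space borel S"
  and snd_measurable: "snd \<in> restrict_space borel (S \<times> S) \<rightarrow>\<^sub>M restrict_space borel S"
proof -
  show f: "fst \<in> restrict_space borel (S \<times> S) \<rightarrow>\<^sub>M restrict_space borel S"
    by (intro measurable_restrict_space2 borel_measurable_continuous_on_restrict continuous_intros)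
      (auto simp: space_restrict_space)
  show s: "snd \<in> restrict_space borel (S \<times> S) \<rightarrow>\<^sub>M restrict_space borel S"
    by (intro measurable_restrict_space2 borel_measurable_continuous_on_restrict continuous_intros)
      (auto simp: space_restrict_space)
  show "(\<lambda>p. gaussian (fst p)) \<in> restrict_space borel (S \<times> S) \<rightarrow>\<^sub>M subprob_algebra borel"
    "(\<lambda>p. gaussian (snd p)) \<in> restrict_space borel (S \<times> S) \<rightarrow>\<^sub>M subprob_algebra borel"
    by (rule measurable_compose[OF f gaussian_kernel[OF pd_parameters_psd]], rule measurable_compose[OF s gaussian_kernel[OF pd_parameters_psd]])
qed

lemma Gamma_S_iff:
  assumes \<mu>: "\<mu>\<^sub>1 \<in> borel_probs UNIV" "\<mu>\<^sub>2 \<in> borel_probs UNIV"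
  shows "\<pi> \<in> Gamma_S S \<mu>\<^sub>1 \<mu>\<^sub>2 \<longleftrightarrow> \<pi> \<in> borel_probs (S \<times> S) \<and>
    \<mu>\<^sub>1 = \<pi> \<bind> (\<lambda>p. gaussian (fst p)) \<and> \<mu>\<^sub>2 = \<pi> \<bind> (\<lambda>p. gaussian (snd p))"
proof (cases "\<pi> \<in> borel_probs (S \<times> S)")
  case True
  note cong = borel_probs_measurable_cong[OF True]
  have em: "(\<lambda>s. emeasure (gaussian s) A) \<in> borel_measurable (restrict_space borel S)" if "A \<in> sets borel" for A
    by (rule measurable_compose[OF gaussian_kernel[OF pd_parameters_psd] measurable_emeasure_subprob_algebra[OF that]])
  have "(\<integral>\<^sup>+s. emeasure (gaussian s) A \<partial>distr \<pi> (restrict_space borel S) fst) = (\<integral>\<^sup>+p. emeasure (gaussian (fst p)) A \<partial>\<pi>)"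
    "(\<integral>\<^sup>+s. emeasure (gaussian s) A \<partial>distr \<pi> (restrict_space borel S) snd) = (\<integral>\<^sup>+p. emeasure (gaussian (snd p)) A \<partial>\<pi>)"
    if "A \<in> sets borel" for A
    by (rule nn_integral_distr'[OF _ em[OF that]], simp add: cong fst_measurable snd_measurable)+
  moreover have "\<mu>\<^sub>1 = \<pi> \<bind> (\<lambda>p. gaussian (fst p)) \<longleftrightarrow> (\<forall>A\<in>sets borel. emeasure \<mu>\<^sub>1 A = (\<integral>\<^sup>+p. emeasure (gaussian (fst p)) A \<partial>\<pi>))"
    using \<mu>(1) borel_probs_ne[OF True] by (intro mixture_eq_bind) (auto simp: cong gaussian_kernel_fst borel_probs_UNIV)
  moreover have "\<mu>\<^sub>2 = \<pi> \<bind> (\<lambda>p. gaussian (snd p)) \<longleftrightarrow> (\<forall>A\<in>sets borel. emeasure \<mu>\<^sub>2 A = (\<integral>\<^sup>+p. emeasure (gaussian (snd p)) A \<partial>\<pi>))"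
    using \<mu>(2) borel_probs_ne[OF True] by (intro mixture_eq_bind) (auto simp: cong gaussian_kernel_snd borel_probs_UNIV)
  ultimately show ?thesis using True by (auto simp: Gamma_S_def)
qed (auto simp: Gamma_S_def)

lemma GM_2n_iff:
  "\<nu> \<in> GM_2n S \<longleftrightarrow> \<nu> \<in> borel_probs UNIV \<and> (\<exists>\<Lambda>\<in>borel_probs (Z_S S). \<nu> = \<Lambda> \<bind> gaussian2)"
proof -
  have "\<nu> = \<Lambda> \<bind> gaussian2 \<longleftrightarrow> (\<forall>A\<in>sets borel. emeasure \<nu> A = (\<integral>\<^sup>+z. emeasure (gaussian2 z) A \<partial>\<Lambda>))"
    if "\<Lambda> \<in> borel_probs (Z_S S)" "\<nu> \<in> borel_probs UNIV" for \<Lambda>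
    using that borel_probs_ne[OF that(1)]
    by (intro mixture_eq_bind) (auto simp: borel_probs_measurable_cong[OF that(1)] gaussian2_kernel Z_S_psd borel_probs_UNIV)
  then show ?thesis unfolding GM_2n_def by blast
qed

lemma bw_sq_measurable:
  "(\<lambda>(s\<^sub>1, s\<^sub>2). ennreal (bw_sq s\<^sub>1 s\<^sub>2)) \<in> borel_measurable (restrict_space borel (S \<times> S))"
  unfolding case_prod_beta
  by (rule measurable_compose[OF borel_measurable_continuous_on_restrict[OF continuous_on_bw_sq[OF pd_parameters_psd]] measurable_ennreal])

lemma transport_cost_bind:
  assumes "\<Lambda> \<in> borel_probs (Z_S S)"
  shows "transport_cost (\<Lambda> \<bind> gaussian2) = (\<integral>\<^sup>+z. transport_cost (gaussian2 z) \<partial>\<Lambda>)"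
  unfolding transport_cost_def
  by (rule nn_integral_bind[OF sq_dist_measurable])
    (simp add: borel_probs_measurable_cong[OF assms] gaussian2_kernel[OF Z_S_psd])

lemma bind_gaussian2_marginals:
  assumes \<Lambda>: "\<Lambda> \<in> borel_probs (Z_S S)"
  shows "distr (\<Lambda> \<bind> gaussian2) borel fst = \<Lambda> \<bind> (\<lambda>z. gaussian (fst (fst z), block Inl Inl (snd z)))"
    and "distr (\<Lambda> \<bind> gaussian2) borel snd = \<Lambda> \<bind> (\<lambda>z. gaussian (snd (fst z), block Inr Inr (snd z)))"
proof -
  have k: "gaussian2 \<in> \<Lambda> \<rightarrow>\<^sub>M subprob_algebra borel"
    by (simp add: borel_probs_measurable_cong[OF \<Lambda>] gaussian2_kernel[OF Z_S_psd])
  have m: "fst \<in> (borel :: ((real ^ 'n) \<times> (real ^ 'n)) measure) \<rightarrow>\<^sub>M borel"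
    "snd \<in> (borel :: ((real ^ 'n) \<times> (real ^ 'n)) measure) \<rightarrow>\<^sub>M borel"
    by (intro borel_measurable_continuous_onI continuous_intros)+
  have z: "snd z \<in> psd_matrices" "block Inl Inl (snd z) \<in> pd_matrices" "block Inr Inr (snd z) \<in> pd_matrices"
    if "z \<in> space \<Lambda>" for z
    using that pd unfolding borel_probs_space[OF \<Lambda>] by (auto simp: Z_S_def)
  show "distr (\<Lambda> \<bind> gaussian2) borel fst = \<Lambda> \<bind> (\<lambda>z. gaussian (fst (fst z), block Inl Inl (snd z)))"
    unfolding distr_bind[OF k borel_probs_ne[OF \<Lambda>] m(1)]
  proof (rule bind_cong[OF refl])
    fix z assume "z \<in> space \<Lambda>"
    from z[OF this] show "distr (gaussian2 z) borel fst = gaussian (fst (fst z), block Inl Inl (snd z))"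
      using gaussian2_fst[of "snd z" "fst (fst z)" "snd (fst z)"] by simp
  qed
  show "distr (\<Lambda> \<bind> gaussian2) borel snd = \<Lambda> \<bind> (\<lambda>z. gaussian (snd (fst z), block Inr Inr (snd z)))"
    unfolding distr_bind[OF k borel_probs_ne[OF \<Lambda>] m(2)]
  proof (rule bind_cong[OF refl])
    fix z assume "z \<in> space \<Lambda>"
    from z[OF this] show "distr (gaussian2 z) borel snd = gaussian (snd (fst z), block Inr Inr (snd z))"
      using gaussian2_snd[of "snd z" "fst (fst z)" "snd (fst z)"] by simp
  qed
qed

text \<open>Each joint Gaussian is replaced by the parameters of its two marginals. Since the marginals of
  \<open>gaussian2 z\<close> are the Gaussians with these parameters, the constraints carry over, and the cost of
  each component does not increase.\<close>

lemma mixture_coupling_to_parameter_coupling: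
  assumes \<mu>: "\<mu>\<^sub>1 \<in> borel_probs UNIV" "\<mu>\<^sub>2 \<in> borel_probs UNIV"
    and \<nu>: "\<nu> \<in> couplings \<mu>\<^sub>1 \<mu>\<^sub>2 \<inter> GM_2n S"
  obtains \<pi> where "\<pi> \<in> Gamma_S S \<mu>\<^sub>1 \<mu>\<^sub>2"
    "(\<integral>\<^sup>+ (s\<^sub>1, s\<^sub>2). ennreal (bw_sq s\<^sub>1 s\<^sub>2) \<partial>\<pi>) \<le> transport_cost \<nu>"
proof -
  obtain \<Lambda> where \<Lambda>: "\<Lambda> \<in> borel_probs (Z_S S)" and \<nu>_eq: "\<nu> = \<Lambda> \<bind> gaussian2"
    using \<nu> by (auto simp: GM_2n_iff)
  note cong = borel_probs_measurable_cong[OF \<Lambda>]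
  define f where "f z = ((fst (fst z), block Inl Inl (snd z)), (snd (fst z), block Inr Inr (snd z)))"
    for z :: "((real ^ 'n) \<times> (real ^ 'n)) \<times> (real ^ ('n + 'n) ^ ('n + 'n))"
  have f: "f \<in> restrict_space borel (Z_S S) \<rightarrow>\<^sub>M restrict_space borel (S \<times> S)"
    unfolding f_def
    by (intro measurable_restrict_space2 borel_measurable_continuous_on_restrict continuous_on_Pair continuous_on_block continuous_intros)
      (auto simp: space_restrict_space Z_S_def)
  then have f': "f \<in> \<Lambda> \<rightarrow>\<^sub>M restrict_space borel (S \<times> S)" by (simp add: cong)
  define \<pi> where "\<pi> = distr \<Lambda> (restrict_space borel (S \<times> S)) f"
  have \<pi>: "\<pi> \<in> borel_probs (S \<times> S)" unfolding \<pi>_def by (rule borel_probs_distr[OF \<Lambda> f])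
  have "\<pi> \<bind> (\<lambda>p. gaussian (fst p)) = \<Lambda> \<bind> (\<lambda>z. gaussian (fst (f z)))"
    "\<pi> \<bind> (\<lambda>p. gaussian (snd p)) = \<Lambda> \<bind> (\<lambda>z. gaussian (snd (f z)))"
    unfolding \<pi>_def by (rule bind_distr[OF f' _ borel_probs_ne[OF \<Lambda>]], rule gaussian_kernel_fst gaussian_kernel_snd)+
  then have "\<pi> \<in> Gamma_S S \<mu>\<^sub>1 \<mu>\<^sub>2"
    using \<nu> bind_gaussian2_marginals[OF \<Lambda>] \<pi> by (auto simp: Gamma_S_iff[OF \<mu>] couplings_def \<nu>_eq f_def)
  moreover have "(\<integral>\<^sup>+ (s\<^sub>1, s\<^sub>2). ennreal (bw_sq s\<^sub>1 s\<^sub>2) \<partial>\<pi>) \<le> transport_cost \<nu>"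
  proof -
    have "(\<integral>\<^sup>+ (s\<^sub>1, s\<^sub>2). ennreal (bw_sq s\<^sub>1 s\<^sub>2) \<partial>\<pi>) = (\<integral>\<^sup>+ z. ennreal (bw_sq (fst (f z)) (snd (f z))) \<partial>\<Lambda>)"
      unfolding \<pi>_def nn_integral_distr'[OF f' bw_sq_measurable] by (simp add: case_prod_beta)
    also have "\<dots> \<le> (\<integral>\<^sup>+ z. transport_cost (gaussian2 z) \<partial>\<Lambda>)"
    proof (rule nn_integral_mono)
      fix z assume "z \<in> space \<Lambda>"
      then obtain m1 m2 Q where "z = ((m1, m2), Q)" "Q \<in> psd_matrices" "block Inl Inl Q \<in> pd_matrices" "block Inr Inr Q \<in> pd_matrices"
        using pd unfolding borel_probs_space[OF \<Lambda>] by (auto simp: Z_S_def)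
      then show "ennreal (bw_sq (fst (f z)) (snd (f z))) \<le> transport_cost (gaussian2 z)"
        using bw_sq_le_transport_cost by (simp add: f_def)
    qed
    also have "\<dots> = transport_cost \<nu>" unfolding \<nu>_eq by (rule transport_cost_bind[OF \<Lambda>, symmetric])
    finally show ?thesis .
  qed
  ultimately show thesis by (rule that)
qed

text \<open>Each pair of parameters is replaced by the joint Gaussian that couples them at the least cost.\<close>

lemma parameter_coupling_to_mixture_coupling:
  assumes \<mu>: "\<mu>\<^sub>1 \<in> borel_probs UNIV" "\<mu>\<^sub>2 \<in> borel_probs UNIV"
    and \<pi>: "\<pi> \<in> Gamma_S S \<mu>\<^sub>1 \<mu>\<^sub>2"
  obtains \<nu> where "\<nu> \<in> couplings \<mu>\<^sub>1 \<mu>\<^sub>2 \<inter> GM_2n S"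
    "transport_cost \<nu> = (\<integral>\<^sup>+ (s\<^sub>1, s\<^sub>2). ennreal (bw_sq s\<^sub>1 s\<^sub>2) \<partial>\<pi>)"
proof -
  have \<pi>p: "\<pi> \<in> borel_probs (S \<times> S)" and \<mu>_eq: "\<mu>\<^sub>1 = \<pi> \<bind> (\<lambda>p. gaussian (fst p))" "\<mu>\<^sub>2 = \<pi> \<bind> (\<lambda>p. gaussian (snd p))"
    using \<pi> by (auto simp: Gamma_S_iff[OF \<mu>])
  note cong = borel_probs_measurable_cong[OF \<pi>p]
  define h where "h p = ((fst (fst p), fst (snd p)), optimal_joint_cov (snd (fst p)) (snd (snd p)))"
    for p :: "((real ^ 'n) \<times> (real ^ 'n ^ 'n)) \<times> ((real ^ 'n) \<times> (real ^ 'n ^ 'n))"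
  have pdS: "snd s \<in> pd_matrices" if "s \<in> S" for s using that pd by auto
  have h: "h \<in> restrict_space borel (S \<times> S) \<rightarrow>\<^sub>M restrict_space borel (Z_S S)"
  proof (rule measurable_restrict_space2)
    show "h \<in> space (restrict_space borel (S \<times> S)) \<rightarrow> Z_S S"
      using pdS by (force simp: space_restrict_space Z_S_def h_def optimal_joint_cov)
    show "h \<in> borel_measurable (restrict_space borel (S \<times> S))"
      unfolding h_def
      by (intro borel_measurable_continuous_on_restrict continuous_on_Pair continuous_on_optimal_joint_cov continuous_intros)
        (auto intro: pdS)
  qed
  then have h': "h \<in> \<pi> \<rightarrow>\<^sub>M restrict_space borel (Z_S S)" by (simp add: cong)
  define \<Lambda> where "\<Lambda> = distr \<pi> (restrict_space borel (Z_S S)) h"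
  have \<Lambda>: "\<Lambda> \<in> borel_probs (Z_S S)" unfolding \<Lambda>_def by (rule borel_probs_distr[OF \<pi>p h])
  define \<nu> where "\<nu> = \<Lambda> \<bind> gaussian2"
  have k: "gaussian2 \<in> \<Lambda> \<rightarrow>\<^sub>M subprob_algebra borel"
    by (simp add: borel_probs_measurable_cong[OF \<Lambda>] gaussian2_kernel[OF Z_S_psd])
  have \<nu>p: "\<nu> \<in> borel_probs UNIV"
  proof -
    have "prob_space \<Lambda>" using \<Lambda> by (simp add: borel_probs_def)
    then have "prob_space \<nu>" unfolding \<nu>_def
      by (intro prob_space.prob_space_bind[OF _ _ k] AE_I2 prob_space_gaussian2)
    then show ?thesis
      by (simp add: borel_probs_UNIV \<nu>_def sets_bind_measurable[OF k borel_probs_ne[OF \<Lambda>]])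
  qed
  have zm: "(\<lambda>z. gaussian (fst (fst z), block Inl Inl (snd z))) \<in> restrict_space borel (Z_S S) \<rightarrow>\<^sub>M subprob_algebra borel"
    "(\<lambda>z. gaussian (snd (fst z), block Inr Inr (snd z))) \<in> restrict_space borel (Z_S S) \<rightarrow>\<^sub>M subprob_algebra borel"
    by (rule measurable_compose[OF _ gaussian_kernel[OF pd_parameters_psd]],
        intro measurable_restrict_space2 borel_measurable_continuous_on_restrict continuous_on_Pair continuous_on_block continuous_intros,
        auto simp: space_restrict_space Z_S_def)+
  have "distr \<nu> borel fst = \<mu>\<^sub>1" "distr \<nu> borel snd = \<mu>\<^sub>2"
    unfolding \<nu>_def bind_gaussian2_marginals[OF \<Lambda>] unfolding \<Lambda>_def \<mu>_eq
      bind_distr[OF h' zm(1) borel_probs_ne[OF \<pi>p]] bind_distr[OF h' zm(2) borel_probs_ne[OF \<pi>p]]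
    by (rule bind_cong[OF refl], use pdS in \<open>force simp: borel_probs_space[OF \<pi>p] h_def optimal_joint_cov\<close>)+
  then have "\<nu> \<in> couplings \<mu>\<^sub>1 \<mu>\<^sub>2 \<inter> GM_2n S"
    using \<nu>p \<Lambda> by (auto simp: couplings_def GM_2n_iff \<nu>_def)
  moreover have "transport_cost \<nu> = (\<integral>\<^sup>+ (s\<^sub>1, s\<^sub>2). ennreal (bw_sq s\<^sub>1 s\<^sub>2) \<partial>\<pi>)"
  proof -
    have tcm: "(\<lambda>z. transport_cost (gaussian2 z)) \<in> borel_measurable (restrict_space borel (Z_S S))"
      unfolding transport_cost_def
      by (rule measurable_compose[OF gaussian2_kernel[OF Z_S_psd] nn_integral_measurable_subprob_algebra[OF sq_dist_measurable]])
    have "transport_cost \<nu> = (\<integral>\<^sup>+ z. transport_cost (gaussian2 z) \<partial>\<Lambda>)"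
      unfolding \<nu>_def by (rule transport_cost_bind[OF \<Lambda>])
    also have "\<dots> = (\<integral>\<^sup>+ p. transport_cost (gaussian2 (h p)) \<partial>\<pi>)"
      unfolding \<Lambda>_def by (rule nn_integral_distr'[OF h' tcm])
    also have "\<dots> = (\<integral>\<^sup>+ (s\<^sub>1, s\<^sub>2). ennreal (bw_sq s\<^sub>1 s\<^sub>2) \<partial>\<pi>)"
      by (rule nn_integral_cong)
        (use pdS in \<open>force simp: borel_probs_space[OF \<pi>p] h_def transport_cost_optimal_joint\<close>)
    finally show ?thesis .
  qed
  ultimately show thesis by (rule that)
qed

lemma W_mix_eq_W_prm:
  assumes \<mu>: "\<mu>\<^sub>1 \<in> borel_probs UNIV" "\<mu>\<^sub>2 \<in> borel_probs UNIV"
  shows "W_mix S \<mu>\<^sub>1 \<mu>\<^sub>2 = W_prm S \<mu>\<^sub>1 \<mu>\<^sub>2"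
proof (rule antisym)
  show "W_mix S \<mu>\<^sub>1 \<mu>\<^sub>2 \<le> W_prm S \<mu>\<^sub>1 \<mu>\<^sub>2"
    unfolding W_prm_def
  proof (rule INF_greatest)
    fix \<pi> assume "\<pi> \<in> Gamma_S S \<mu>\<^sub>1 \<mu>\<^sub>2"
    from parameter_coupling_to_mixture_coupling[OF \<mu> this] obtain \<nu> where
      "\<nu> \<in> couplings \<mu>\<^sub>1 \<mu>\<^sub>2 \<inter> GM_2n S" "transport_cost \<nu> = (\<integral>\<^sup>+ (s\<^sub>1, s\<^sub>2). ennreal (bw_sq s\<^sub>1 s\<^sub>2) \<partial>\<pi>)" .
    then show "W_mix S \<mu>\<^sub>1 \<mu>\<^sub>2 \<le> (\<integral>\<^sup>+ (s\<^sub>1, s\<^sub>2). ennreal (bw_sq s\<^sub>1 s\<^sub>2) \<partial>\<pi>)"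
      unfolding W_mix_def by (metis INF_lower)
  qed
  show "W_prm S \<mu>\<^sub>1 \<mu>\<^sub>2 \<le> W_mix S \<mu>\<^sub>1 \<mu>\<^sub>2"
    unfolding W_mix_def
  proof (rule INF_greatest)
    fix \<nu> assume "\<nu> \<in> couplings \<mu>\<^sub>1 \<mu>\<^sub>2 \<inter> GM_2n S"
    from mixture_coupling_to_parameter_coupling[OF \<mu> this] obtain \<pi> where
      "\<pi> \<in> Gamma_S S \<mu>\<^sub>1 \<mu>\<^sub>2" "(\<integral>\<^sup>+ (s\<^sub>1, s\<^sub>2). ennreal (bw_sq s\<^sub>1 s\<^sub>2) \<partial>\<pi>) \<le> transport_cost \<nu>" .
    then show "W_prm S \<mu>\<^sub>1 \<mu>\<^sub>2 \<le> transport_cost \<nu>"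
      unfolding W_prm_def by (rule INF_lower2)
  qed
qed

end

section \<open>Existence of an optimal parameter coupling\<close>

text \<open>The functions \<open>max 0 (1 - k * infdist x F)\<close> converge to the indicator function of a closed set \<open>F\<close>, and
  closed sets generate the Borel sets.\<close>

lemma prob_measure_eqI_continuous:
  fixes M N :: "'a::metric_space measure"
  assumes M: "prob_space M" "sets M = sets borel" and N: "prob_space N" "sets N = sets borel"
    and eq: "\<And>g :: 'a \<Rightarrow> real. continuous_on UNIV g \<Longrightarrow> (\<And>x. 0 \<le> g x) \<Longrightarrow> (\<And>x. g x \<le> 1) \<Longrightarrow>
      (\<integral>\<^sup>+x. ennreal (g x) \<partial>M) = (\<integral>\<^sup>+x. ennreal (g x) \<partial>N)"
  shows "M = N"
proof (rule measure_eqI_generator_eq[where E = "Collect closed" and \<Omega> = UNIV and A = "\<lambda>_. UNIV"])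
  show "Int_stable (Collect closed :: 'a set set)" by (auto simp: Int_stable_def)
  show "sets M = sigma_sets UNIV (Collect closed)" "sets N = sigma_sets UNIV (Collect closed)"
    using M(2) N(2) by (simp_all add: borel_eq_closed)
  show "emeasure M UNIV \<noteq> \<infinity>"
    using prob_space.emeasure_space_1[OF M(1)] sets_eq_imp_space_eq[OF M(2)] by simp
  fix F :: "'a set" assume "F \<in> Collect closed"
  then have F: "closed F" by simp
  show "emeasure M F = emeasure N F"
  proof (cases "F = {}")
    case False
    define g where "g k x = max 0 (1 - real k * infdist x F)" for k x
    have g_cont: "continuous_on UNIV (g k)" for k unfolding g_def by (intro continuous_intros)
    have g01: "0 \<le> g k x" "g k x \<le> 1" for k x by (simp_all add: g_def infdist_nonneg)
    have lim: "(\<lambda>k. \<integral>\<^sup>+x. ennreal (g k x) \<partial>P) \<longlonglongrightarrow> emeasure P F"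
      if P: "prob_space P" "sets P = sets borel" for P :: "'a measure"
    proof -
      have "(\<lambda>k. g k x) \<longlonglongrightarrow> indicator F x" for x
      proof (cases "x \<in> F")
        case True
        then show ?thesis by (simp add: g_def)
      next
        case out: False
        then have pos: "0 < infdist x F"
          using in_closed_iff_infdist_zero[OF F False] infdist_nonneg[of x F] by force
        obtain K where K: "1 / infdist x F < real K" using reals_Archimedean2 by blast
        have "\<forall>\<^sub>F k in sequentially. g k x = 0"
          using eventually_ge_at_top[of K]
        proof eventually_elim
          case (elim k)
          then have "1 / infdist x F < real k" using K by linarith
          then show "g k x = 0" using pos by (simp add: g_def field_simps)
        qed
        then show ?thesis using out by (simp add: tendsto_eventually)
      qed
      then have "(\<lambda>k. ennreal (g k x)) \<longlonglongrightarrow> ennreal (indicator F x)" for x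
        by (intro tendsto_ennrealI)
      moreover have "(\<lambda>x. ennreal (g k x)) \<in> borel_measurable P" for k
        using measurable_compose[OF borel_measurable_continuous_onI[OF g_cont] measurable_ennreal]
        by (simp add: P(2) cong: measurable_cong_sets)
      moreover have "(\<lambda>x. ennreal (indicator F x)) \<in> borel_measurable P"
        using F by (simp add: P(2) ennreal_indicator cong: measurable_cong_sets)
      moreover have "ennreal (g k x) \<le> 1" for k x
        using ennreal_leI[OF g01(2)[of k x]] by simp
      ultimately have "(\<lambda>k. \<integral>\<^sup>+x. ennreal (g k x) \<partial>P) \<longlonglongrightarrow> (\<integral>\<^sup>+x. ennreal (indicator F x) \<partial>P)"
        by (intro nn_integral_dominated_convergence[where w = "\<lambda>_. 1"])
          (auto simp: prob_space.emeasure_space_1[OF P(1)])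
      then show ?thesis using F P(2) by (simp add: ennreal_indicator)
    qed
    have "(\<lambda>k. \<integral>\<^sup>+x. ennreal (g k x) \<partial>M) = (\<lambda>k. \<integral>\<^sup>+x. ennreal (g k x) \<partial>N)"
      by (intro ext eq g_cont g01)
    then show ?thesis using LIMSEQ_unique[OF lim[OF M]] lim[OF N] by simp
  qed simp
qed auto

lemma continuous_on_gaussian_expectation:
  fixes X :: "((real ^ 'n) \<times> (real ^ 'n ^ 'n)) set" and g :: "real ^ 'n \<Rightarrow> real"
  assumes X: "X \<subseteq> UNIV \<times> psd_matrices" and g: "continuous_on UNIV g" and g01: "\<And>x. 0 \<le> g x" "\<And>x. g x \<le> 1"
  shows "continuous_on X (\<lambda>s. \<integral>x. g x \<partial>gaussian s)"
proof -
  have gm: "g \<in> borel_measurable borel" by (rule borel_measurable_continuous_onI[OF g])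
  interpret prob_space "std_gaussian :: (real ^ 'n) measure" by (rule prob_space_std_gaussian)
  have sq: "continuous_on X (\<lambda>s. psd_sqrt (snd s))"
    by (rule continuous_on_compose2[OF continuous_on_psd_sqrt]) (use X in \<open>auto intro!: continuous_intros\<close>)
  have gc: "continuous_on X (\<lambda>s. g (fst s + psd_sqrt (snd s) *v x))" for x
    by (rule continuous_on_compose2[OF g])
      (auto intro!: continuous_intros continuous_on_matrix_vector_mult sq)
  have "continuous_on X (\<lambda>s. \<integral>x. g (fst s + psd_sqrt (snd s) *v x) \<partial>std_gaussian)"
  proof (rule continuous_on_sequentiallyI)
    fix u :: "nat \<Rightarrow> (real ^ 'n) \<times> (real ^ 'n ^ 'n)" and a
    assume u: "\<forall>n. u n \<in> X" "a \<in> X" "u \<longlonglongrightarrow> a"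
    have m: "(\<lambda>x. g (fst s + psd_sqrt (snd s) *v x)) \<in> borel_measurable std_gaussian" for s
      by (rule measurable_compose[OF gaussian_map_measurable gm])
    show "(\<lambda>n. \<integral>x. g (fst (u n) + psd_sqrt (snd (u n)) *v x) \<partial>std_gaussian) \<longlonglongrightarrow>
        (\<integral>x. g (fst a + psd_sqrt (snd a) *v x) \<partial>std_gaussian)"
    proof (rule integral_dominated_convergence[where w = "\<lambda>_. 1"])
      show "AE x in std_gaussian. (\<lambda>n. g (fst (u n) + psd_sqrt (snd (u n)) *v x)) \<longlonglongrightarrow> g (fst a + psd_sqrt (snd a) *v x)"
        using gc u by (intro AE_I2) (auto simp: continuous_on_sequentially comp_def)
      show "AE x in std_gaussian. norm (g (fst (u n) + psd_sqrt (snd (u n)) *v x)) \<le> 1" for n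
        by (intro AE_I2) (simp add: g01)
    qed (simp_all add: m)
  qed
  then show ?thesis
    unfolding gaussian_def by (simp add: integral_distr[OF gaussian_map_measurable gm])
qed

lemma nn_integral_eq_integral_of_bounded:
  assumes "prob_space M" "f \<in> borel_measurable M" "\<And>x. 0 \<le> f x" "\<And>x. x \<in> space M \<Longrightarrow> f x \<le> B"
  shows "(\<integral>\<^sup>+x. ennreal (f x) \<partial>M) = ennreal (\<integral>x. f x \<partial>M)"
proof -
  interpret prob_space M by fact
  have "integrable M f"
    using assms by (intro integrable_const_bound[of _ B] AE_I2) auto
  then show ?thesis using assms(3) by (intro nn_integral_eq_integral) auto
qed

text \<open>Being a mixing law of \<open>\<mu>\<close> is preserved by weak limits: integrated against a continuous function \<open>g\<close>, the
  condition prescribes the integral over \<open>p\<close> of \<open>\<integral>x. g x \<partial>K p\<close>, which is a continuous function of \<open>p\<close>.\<close>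

lemma mixture_weak_limit:
  fixes K :: "'a::topological_space \<Rightarrow> (real ^ 'n) measure"
  assumes K: "\<And>p. prob_space (K p)"
    and Km: "K \<in> restrict_space borel A \<rightarrow>\<^sub>M subprob_algebra borel"
    and cont: "\<And>g :: real ^ 'n \<Rightarrow> real. continuous_on UNIV g \<Longrightarrow> (\<And>x. 0 \<le> g x) \<Longrightarrow> (\<And>x. g x \<le> 1) \<Longrightarrow>
      continuous_on A (\<lambda>p. \<integral>x. g x \<partial>K p)"
    and P: "\<And>n. P n \<in> borel_probs A" and N: "N \<in> borel_probs A"
    and lim: "\<And>f :: 'a \<Rightarrow> real. continuous_on A f \<Longrightarrow> (\<lambda>n. \<integral>x. f x \<partial>P n) \<longlonglongrightarrow> (\<integral>x. f x \<partial>N)"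
    and \<mu>: "\<And>n. \<mu> = P n \<bind> K"
  shows "\<mu> = N \<bind> K"
proof -
  have Kn: "K \<in> M \<rightarrow>\<^sub>M subprob_algebra borel" if "M \<in> borel_probs A" for M
    using Km by (simp add: borel_probs_measurable_cong[OF that])
  have bind_prob: "prob_space (M \<bind> K)" "sets (M \<bind> K) = sets borel" if "M \<in> borel_probs A" for M
  proof -
    have "prob_space M" using that by (simp add: borel_probs_def)
    then show "prob_space (M \<bind> K)" by (intro prob_space.prob_space_bind[OF _ _ Kn[OF that]] AE_I2 K)
    show "sets (M \<bind> K) = sets borel" by (rule sets_bind_measurable[OF Kn[OF that] borel_probs_ne[OF that]])
  qed
  have "P 0 \<bind> K = N \<bind> K"
  proof (rule prob_measure_eqI_continuous[OF bind_prob[OF P] bind_prob[OF N]])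
    fix g :: "real ^ 'n \<Rightarrow> real"
    assume g: "continuous_on UNIV g" "\<And>x. 0 \<le> g x" "\<And>x. g x \<le> 1"
    define f where "f p = (\<integral>x. g x \<partial>K p)" for p
    have f: "continuous_on A f" unfolding f_def by (rule cont[OF g])
    have gm: "g \<in> borel_measurable borel" by (rule borel_measurable_continuous_onI[OF g(1)])
    have sets_K: "sets (K p) = sets borel" if "p \<in> A" for p
      using sets_kernel[OF Km, of p] that by (simp add: space_restrict_space)
    have f0: "0 \<le> f p" for p unfolding f_def by (rule Bochner_Integration.integral_nonneg) (rule g)
    have f1: "f p \<le> 1" if "p \<in> A" for p
    proof -
      interpret prob_space "K p" by (rule K)
      have "integrable (K p) g"
        using g gm sets_K[OF that] by (intro integrable_const_bound[of _ 1] AE_I2) (auto cong: measurable_cong_sets)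
      then have "f p \<le> (\<integral>x. 1 \<partial>K p)" unfolding f_def by (intro integral_mono) (auto simp: g)
      then show ?thesis by (simp add: prob_space)
    qed
    have bind_int: "(\<integral>\<^sup>+x. ennreal (g x) \<partial>(M \<bind> K)) = ennreal (\<integral>p. f p \<partial>M)" if M: "M \<in> borel_probs A" for M
    proof -
      have "(\<integral>\<^sup>+x. ennreal (g x) \<partial>(M \<bind> K)) = (\<integral>\<^sup>+p. \<integral>\<^sup>+x. ennreal (g x) \<partial>K p \<partial>M)"
        using gm by (intro nn_integral_bind[OF _ Kn[OF M]]) measurable
      also have "\<dots> = (\<integral>\<^sup>+p. ennreal (f p) \<partial>M)"
      proof (rule nn_integral_cong)
        fix p assume "p \<in> space M"
        then have p: "p \<in> A" using borel_probs_space[OF M] by simp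
        show "(\<integral>\<^sup>+x. ennreal (g x) \<partial>K p) = ennreal (f p)"
          unfolding f_def using gm sets_K[OF p] g
          by (intro nn_integral_eq_integral_of_bounded[OF K]) (auto cong: measurable_cong_sets)
      qed
      also have "\<dots> = ennreal (\<integral>p. f p \<partial>M)"
        using M f0 f1 borel_measurable_continuous_on_restrict[OF f]
        by (intro nn_integral_eq_integral_of_bounded[where B = 1])
          (auto simp: borel_probs_measurable_cong[OF M] borel_probs_space[OF M] borel_probs_def)
      finally show ?thesis .
    qed
    have "ennreal (\<integral>p. f p \<partial>P n) = ennreal (\<integral>p. f p \<partial>P 0)" for n
      using bind_int[OF P] \<mu>[of n] \<mu>[of 0] by metis
    then have "(\<lambda>n. ennreal (\<integral>p. f p \<partial>P n)) = (\<lambda>n. ennreal (\<integral>p. f p \<partial>P 0))" by (rule ext)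
    then have "(\<lambda>n. ennreal (\<integral>p. f p \<partial>P 0)) \<longlonglongrightarrow> ennreal (\<integral>p. f p \<partial>N)"
      using tendsto_ennrealI[OF lim[OF f]] by (simp only:)
    then show "(\<integral>\<^sup>+x. ennreal (g x) \<partial>(P 0 \<bind> K)) = (\<integral>\<^sup>+x. ennreal (g x) \<partial>(N \<bind> K))"
      by (simp add: bind_int P N LIMSEQ_const_iff)
  qed
  then show ?thesis using \<mu>[of 0] by simp
qed

text \<open>The direct method: a minimising sequence of parameter couplings has a weakly convergent
  subsequence, the limit still satisfies the constraints, and the cost is weakly continuous because
  \<open>bw_sq\<close> is continuous on the compact set \<open>S \<times> S\<close>.\<close>

lemma W_prm_attained:
  fixes S :: "((real ^ 'n) \<times> (real ^ 'n ^ 'n)) set"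
  assumes pd: "S \<subseteq> UNIV \<times> pd_matrices" and compact_S: "compact S"
    and \<mu>: "\<mu>\<^sub>1 \<in> borel_probs UNIV" "\<mu>\<^sub>2 \<in> borel_probs UNIV" and ne: "Gamma_S S \<mu>\<^sub>1 \<mu>\<^sub>2 \<noteq> {}"
  obtains \<pi> where "\<pi> \<in> Gamma_S S \<mu>\<^sub>1 \<mu>\<^sub>2"
    "(\<integral>\<^sup>+ (s\<^sub>1, s\<^sub>2). ennreal (bw_sq s\<^sub>1 s\<^sub>2) \<partial>\<pi>) = W_prm S \<mu>\<^sub>1 \<mu>\<^sub>2"
proof -
  have compact_SS: "compact (S \<times> S)" by (intro compact_Times compact_S)
  \<comment> \<open>The truncation at 0 does not change the value in \<^typ>\<open>ennreal\<close> and makes nonnegativity evident.\<close>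
  define c where "c p = max 0 (bw_sq (fst p) (snd p))" for p :: "((real ^ 'n) \<times> (real ^ 'n ^ 'n)) \<times> ((real ^ 'n) \<times> (real ^ 'n ^ 'n))"
  define cost where "cost \<pi> = (\<integral>\<^sup>+ (s\<^sub>1, s\<^sub>2). ennreal (bw_sq s\<^sub>1 s\<^sub>2) \<partial>\<pi>)"
    for \<pi> :: "(((real ^ 'n) \<times> (real ^ 'n ^ 'n)) \<times> ((real ^ 'n) \<times> (real ^ 'n ^ 'n))) measure"
  have c_nonneg: "0 \<le> c p" for p by (simp add: c_def)
  have c: "continuous_on (S \<times> S) c"
    unfolding c_def by (rule continuous_on_max[OF continuous_on_const continuous_on_bw_sq[OF pd_parameters_psd[OF pd]]])
  obtain B where B: "\<And>p. p \<in> S \<times> S \<Longrightarrow> c p \<le> B"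
  proof -
    have "bounded (c ` (S \<times> S))" by (intro compact_imp_bounded compact_continuous_image c compact_SS)
    then obtain B where B: "\<forall>y\<in>c ` (S \<times> S). norm y \<le> B" unfolding bounded_iff by blast
    show thesis
    proof (rule that)
      fix p assume "p \<in> S \<times> S"
      then have "norm (c p) \<le> B" using B by blast
      then show "c p \<le> B" by simp
    qed
  qed
  have cost_eq: "cost \<pi> = ennreal (\<integral>p. c p \<partial>\<pi>)" if \<pi>: "\<pi> \<in> borel_probs (S \<times> S)" for \<pi>
  proof -
    have "cost \<pi> = (\<integral>\<^sup>+p. ennreal (c p) \<partial>\<pi>)"
      unfolding cost_def by (intro nn_integral_cong) (simp add: c_def case_prod_beta ennreal_max_0)
    also have "\<dots> = ennreal (\<integral>p. c p \<partial>\<pi>)"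
      using \<pi> B borel_measurable_continuous_on_restrict[OF c]
      by (intro nn_integral_eq_integral_of_bounded[where B = B])
        (simp_all add: borel_probs_measurable_cong[OF \<pi>] borel_probs_space[OF \<pi>] c_nonneg borel_probs_def)
    finally show ?thesis .
  qed
  have "cost ` Gamma_S S \<mu>\<^sub>1 \<mu>\<^sub>2 \<noteq> {}" using ne by simp
  from ennreal_Inf_countable_INF[OF this] obtain v where v: "decseq v" "range v \<subseteq> cost ` Gamma_S S \<mu>\<^sub>1 \<mu>\<^sub>2"
    and v_Inf: "Inf (cost ` Gamma_S S \<mu>\<^sub>1 \<mu>\<^sub>2) = (INF i. v i)" by blast
  have v_mem: "v n \<in> cost ` Gamma_S S \<mu>\<^sub>1 \<mu>\<^sub>2" for n by (rule subsetD[OF v(2) rangeI])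
  define P where "P n = inv_into (Gamma_S S \<mu>\<^sub>1 \<mu>\<^sub>2) cost (v n)" for n
  have P: "P n \<in> Gamma_S S \<mu>\<^sub>1 \<mu>\<^sub>2" and cost_P: "cost (P n) = v n" for n
    unfolding P_def by (rule inv_into_into[OF v_mem], rule f_inv_into_f[OF v_mem])
  have W: "W_prm S \<mu>\<^sub>1 \<mu>\<^sub>2 = Inf (cost ` Gamma_S S \<mu>\<^sub>1 \<mu>\<^sub>2)" by (simp only: W_prm_def cost_def[abs_def])
  have v_lim: "v \<longlonglongrightarrow> W_prm S \<mu>\<^sub>1 \<mu>\<^sub>2" unfolding W v_Inf by (rule LIMSEQ_INF[OF v(1)])
  note Pn = P[unfolded Gamma_S_iff[OF pd \<mu>]]
  have P': "P n \<in> borel_probs (S \<times> S)" "\<mu>\<^sub>1 = P n \<bind> (\<lambda>p. gaussian (fst p))" "\<mu>\<^sub>2 = P n \<bind> (\<lambda>p. gaussian (snd p))" for n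
    by (rule Pn[THEN conjunct1], rule Pn[THEN conjunct2, THEN conjunct1], rule Pn[THEN conjunct2, THEN conjunct2])
  obtain r N where r: "strict_mono (r :: nat \<Rightarrow> nat)" and N: "N \<in> borel_probs (S \<times> S)"
    and lim: "\<And>f :: _ \<Rightarrow> real. continuous_on (S \<times> S) f \<Longrightarrow> (\<lambda>n. \<integral>x. f x \<partial>P (r n)) \<longlonglongrightarrow> (\<integral>x. f x \<partial>N)"
  proof (rule borel_probs_compact_subseq[of "S \<times> S" P, OF compact_SS P'(1)])
    fix r :: "nat \<Rightarrow> nat" and N
    assume 1: "strict_mono r" "N \<in> borel_probs (S \<times> S)"
      and 2: "\<And>f :: _ \<Rightarrow> real. continuous_on (S \<times> S) f \<Longrightarrow> (\<lambda>n. \<integral>x. f x \<partial>P (r n)) \<longlonglongrightarrow> (\<integral>x. f x \<partial>N)"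
    show thesis by (rule that[OF 1 2])
  qed
  have cont: "continuous_on (S \<times> S) (\<lambda>p. \<integral>x. g x \<partial>gaussian (fst p))" "continuous_on (S \<times> S) (\<lambda>p. \<integral>x. g x \<partial>gaussian (snd p))"
    if "continuous_on UNIV g" "\<And>x. 0 \<le> g x" "\<And>x. g x \<le> 1" for g :: "real ^ 'n \<Rightarrow> real"
    by (rule continuous_on_compose2[OF continuous_on_gaussian_expectation[OF pd_parameters_psd[OF pd] that]];
        auto intro!: continuous_intros)+
  have "\<mu>\<^sub>1 = N \<bind> (\<lambda>p. gaussian (fst p))"
    by (rule mixture_weak_limit[where P = "\<lambda>n. P (r n)", OF prob_space_gaussian gaussian_kernel_fst[OF pd] cont(1) P'(1) N lim P'(2)])
  moreover have "\<mu>\<^sub>2 = N \<bind> (\<lambda>p. gaussian (snd p))"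
    by (rule mixture_weak_limit[where P = "\<lambda>n. P (r n)", OF prob_space_gaussian gaussian_kernel_snd[OF pd] cont(2) P'(1) N lim P'(3)])
  ultimately have NG: "N \<in> Gamma_S S \<mu>\<^sub>1 \<mu>\<^sub>2"
    unfolding Gamma_S_iff[OF pd \<mu>] by (intro conjI N)
  have "(\<lambda>n. cost (P (r n))) \<longlonglongrightarrow> cost N"
    unfolding cost_eq[OF P'(1)] cost_eq[OF N] by (intro tendsto_ennrealI lim c)
  moreover have "(\<lambda>n. cost (P (r n))) \<longlonglongrightarrow> W_prm S \<mu>\<^sub>1 \<mu>\<^sub>2"
    unfolding cost_P using LIMSEQ_subseq_LIMSEQ[OF v_lim r] by (simp add: comp_def)
  ultimately have "cost N = W_prm S \<mu>\<^sub>1 \<mu>\<^sub>2" by (rule LIMSEQ_unique)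
  then show thesis using that[OF NG] by (simp add: cost_def)
qed

text \<open>The product of the two mixing laws is a parameter coupling.\<close>

lemma Gamma_S_nonempty:
  assumes pd: "S \<subseteq> UNIV \<times> pd_matrices"
    and \<mu>: "\<mu>\<^sub>1 \<in> borel_probs UNIV" "\<mu>\<^sub>2 \<in> borel_probs UNIV"
    and \<eta>: "mixing_law S \<mu>\<^sub>1 \<eta>\<^sub>1" "mixing_law S \<mu>\<^sub>2 \<eta>\<^sub>2"
  shows "Gamma_S S \<mu>\<^sub>1 \<mu>\<^sub>2 \<noteq> {}"
proof -
  have \<eta>p: "\<eta>\<^sub>1 \<in> borel_probs S" "\<eta>\<^sub>2 \<in> borel_probs S" using \<eta> by (auto simp: mixing_law_def)
  interpret E1: prob_space \<eta>\<^sub>1 using \<eta>p by (simp add: borel_probs_def)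
  interpret E2: prob_space \<eta>\<^sub>2 using \<eta>p by (simp add: borel_probs_def)
  interpret E: pair_prob_space \<eta>\<^sub>1 \<eta>\<^sub>2 ..
  have sp: "space (\<eta>\<^sub>1 \<Otimes>\<^sub>M \<eta>\<^sub>2) = S \<times> S" by (simp add: space_pair_measure borel_probs_space[OF \<eta>p(1)] borel_probs_space[OF \<eta>p(2)])
  have emb: "(\<lambda>s. s) \<in> \<eta> \<rightarrow>\<^sub>M borel" if "\<eta> \<in> borel_probs S" for \<eta>
    unfolding borel_probs_measurable_cong[OF that] by (intro measurable_restrict_space1) simp
  have "(\<lambda>p. (fst p, snd p)) \<in> \<eta>\<^sub>1 \<Otimes>\<^sub>M \<eta>\<^sub>2 \<rightarrow>\<^sub>M (borel \<Otimes>\<^sub>M borel)"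
    by (intro measurable_Pair measurable_compose[OF measurable_fst emb[OF \<eta>p(1)]] measurable_compose[OF measurable_snd emb[OF \<eta>p(2)]])
  then have id: "(\<lambda>p. p) \<in> \<eta>\<^sub>1 \<Otimes>\<^sub>M \<eta>\<^sub>2 \<rightarrow>\<^sub>M restrict_space borel (S \<times> S)"
    by (intro measurable_restrict_space2) (auto simp: sp borel_prod)
  define \<pi> where "\<pi> = distr (\<eta>\<^sub>1 \<Otimes>\<^sub>M \<eta>\<^sub>2) (restrict_space borel (S \<times> S)) (\<lambda>p. p)"
  have \<pi>: "\<pi> \<in> borel_probs (S \<times> S)" by (simp add: borel_probs_def \<pi>_def E.prob_space_distr[OF id])
  have g: "gaussian \<in> \<eta> \<rightarrow>\<^sub>M subprob_algebra borel" if "\<eta> \<in> borel_probs S" for \<eta>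
    by (simp add: borel_probs_measurable_cong[OF that] gaussian_kernel[OF pd_parameters_psd[OF pd]])
  have \<mu>_eq: "\<mu>\<^sub>1 = \<eta>\<^sub>1 \<bind> gaussian" "\<mu>\<^sub>2 = \<eta>\<^sub>2 \<bind> gaussian"
    using \<eta> \<mu> mixture_eq_bind[OF g[OF \<eta>p(1)] borel_probs_ne[OF \<eta>p(1)], of \<mu>\<^sub>1]
      mixture_eq_bind[OF g[OF \<eta>p(2)] borel_probs_ne[OF \<eta>p(2)], of \<mu>\<^sub>2]
    by (auto simp: mixing_law_def borel_probs_UNIV)
  have "\<pi> \<bind> (\<lambda>p. gaussian (fst p)) = (\<eta>\<^sub>1 \<Otimes>\<^sub>M \<eta>\<^sub>2) \<bind> (\<lambda>p. gaussian (fst p))"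
    unfolding \<pi>_def by (rule bind_distr[OF id gaussian_kernel_fst[OF pd] E.not_empty])
  also have "\<dots> = distr (\<eta>\<^sub>1 \<Otimes>\<^sub>M \<eta>\<^sub>2) \<eta>\<^sub>1 fst \<bind> gaussian"
    by (rule bind_distr[OF measurable_fst g[OF \<eta>p(1)] E.not_empty, symmetric])
  also have "distr (\<eta>\<^sub>1 \<Otimes>\<^sub>M \<eta>\<^sub>2) \<eta>\<^sub>1 fst = \<eta>\<^sub>1" by (rule E2.distr_pair_fst)
  finally have 1: "\<pi> \<bind> (\<lambda>p. gaussian (fst p)) = \<mu>\<^sub>1" by (simp add: \<mu>_eq)
  have "\<pi> \<bind> (\<lambda>p. gaussian (snd p)) = (\<eta>\<^sub>1 \<Otimes>\<^sub>M \<eta>\<^sub>2) \<bind> (\<lambda>p. gaussian (snd p))"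
    unfolding \<pi>_def by (rule bind_distr[OF id gaussian_kernel_snd[OF pd] E.not_empty])
  also have "\<dots> = distr (\<eta>\<^sub>1 \<Otimes>\<^sub>M \<eta>\<^sub>2) \<eta>\<^sub>2 snd \<bind> gaussian"
    by (rule bind_distr[OF measurable_snd g[OF \<eta>p(2)] E.not_empty, symmetric])
  also have "distr (\<eta>\<^sub>1 \<Otimes>\<^sub>M \<eta>\<^sub>2) \<eta>\<^sub>2 snd = \<eta>\<^sub>2"
  proof -
    have "distr (\<eta>\<^sub>1 \<Otimes>\<^sub>M \<eta>\<^sub>2) \<eta>\<^sub>2 snd = distr (distr (\<eta>\<^sub>2 \<Otimes>\<^sub>M \<eta>\<^sub>1) (\<eta>\<^sub>1 \<Otimes>\<^sub>M \<eta>\<^sub>2) (\<lambda>(x, y). (y, x))) \<eta>\<^sub>2 snd"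
      by (simp only: E.distr_pair_swap[symmetric])
    also have "\<dots> = distr (\<eta>\<^sub>2 \<Otimes>\<^sub>M \<eta>\<^sub>1) \<eta>\<^sub>2 fst"
      by (subst distr_distr) (simp_all add: comp_def case_prod_beta)
    also have "\<dots> = \<eta>\<^sub>2" by (rule E1.distr_pair_fst)
    finally show ?thesis .
  qed
  finally have 2: "\<pi> \<bind> (\<lambda>p. gaussian (snd p)) = \<mu>\<^sub>2" by (simp add: \<mu>_eq)
  have "\<pi> \<in> Gamma_S S \<mu>\<^sub>1 \<mu>\<^sub>2" using \<pi> 1 2 by (simp add: Gamma_S_iff[OF pd \<mu>])
  then show ?thesis by blast
qed

lemma Gamma_S_finite_second_moment:
  assumes compact_S: "compact S" and "\<pi> \<in> Gamma_S S \<mu>\<^sub>1 \<mu>\<^sub>2"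
  shows "finite_second_moment \<pi>"
proof -
  have \<pi>: "\<pi> \<in> borel_probs (S \<times> S)" using assms by (simp add: Gamma_S_def)
  interpret prob_space \<pi> using \<pi> by (simp add: borel_probs_def)
  obtain B where B: "\<And>s. s \<in> S \<Longrightarrow> norm s \<le> B" using compact_imp_bounded[OF compact_S] by (auto simp: bounded_iff)
  have *: "(norm m)\<^sup>2 + (norm Q)\<^sup>2 \<le> B\<^sup>2" if "(m, Q) \<in> S" for m Q
  proof -
    have "(norm m)\<^sup>2 + (norm Q)\<^sup>2 = (norm (m, Q))\<^sup>2" by (simp add: norm_Pair)
    also have "\<dots> \<le> B\<^sup>2" using B[OF that] by (intro power_mono) auto
    finally show ?thesis .
  qed
  have "(norm m1)\<^sup>2 + (norm Q1)\<^sup>2 + (norm m2)\<^sup>2 + (norm Q2)\<^sup>2 \<le> 2 * B\<^sup>2" if "((m1, Q1), (m2, Q2)) \<in> S \<times> S" for m1 Q1 m2 Q2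
    using that add_mono[OF *[of m1 Q1] *[of m2 Q2]] by auto
  then have "(\<integral>\<^sup>+ ((m1, Q1), (m2, Q2)). ennreal ((norm m1)\<^sup>2 + (norm Q1)\<^sup>2 + (norm m2)\<^sup>2 + (norm Q2)\<^sup>2) \<partial>\<pi>) \<le> (\<integral>\<^sup>+ p. ennreal (2 * B\<^sup>2) \<partial>\<pi>)"
    by (intro nn_integral_mono) (auto simp: borel_probs_space[OF \<pi>] simp del: ennreal_plus intro!: ennreal_leI)
  also have "\<dots> < \<infinity>" by (simp add: emeasure_space_1 ennreal_less_top)
  finally show ?thesis by (simp add: finite_second_moment_def)
qed


theorem theorem3:
  fixes \<Theta> :: "(real ^ 'n) set" and \<Xi> :: "(real ^ 'n ^ 'n) set"
    and S :: "((real ^ 'n) \<times> (real ^ 'n ^ 'n)) set"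
    and \<mu>\<^sub>1 \<mu>\<^sub>2 :: "(real ^ 'n) measure"
  assumes "S = \<Theta> \<times> \<Xi>"
    and "S \<subseteq> nonneg_orthant \<times> pd_matrices"
    and "S \<noteq> {}"
    and "compact S"
    and "\<mu>\<^sub>1 \<in> borel_probs UNIV"
    and "\<mu>\<^sub>2 \<in> borel_probs UNIV"
    and "\<exists>\<eta>\<^sub>1. mixing_law S \<mu>\<^sub>1 \<eta>\<^sub>1"
    and "\<exists>\<eta>\<^sub>2. mixing_law S \<mu>\<^sub>2 \<eta>\<^sub>2"
  shows "couplings \<mu>\<^sub>1 \<mu>\<^sub>2 \<inter> GM_2n S \<noteq> {} \<and>
    (\<exists>\<nu>\<in>couplings \<mu>\<^sub>1 \<mu>\<^sub>2 \<inter> GM_2n S. transport_cost \<nu> = W_mix S \<mu>\<^sub>1 \<mu>\<^sub>2) \<and>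
    (\<forall>\<pi>\<in>Gamma_S S \<mu>\<^sub>1 \<mu>\<^sub>2. finite_second_moment \<pi>) \<and>
    W_mix S \<mu>\<^sub>1 \<mu>\<^sub>2 = W_prm S \<mu>\<^sub>1 \<mu>\<^sub>2"
proof -
  have pd: "S \<subseteq> UNIV \<times> pd_matrices" using assms(2) by auto
  note \<mu> = assms(5,6)
  obtain \<eta>\<^sub>1 \<eta>\<^sub>2 where \<eta>: "mixing_law S \<mu>\<^sub>1 \<eta>\<^sub>1" "mixing_law S \<mu>\<^sub>2 \<eta>\<^sub>2" using assms(7,8) by blast
  have ne: "Gamma_S S \<mu>\<^sub>1 \<mu>\<^sub>2 \<noteq> {}" by (rule Gamma_S_nonempty[OF pd \<mu> \<eta>])
  obtain \<pi> where \<pi>: "\<pi> \<in> Gamma_S S \<mu>\<^sub>1 \<mu>\<^sub>2"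
    "(\<integral>\<^sup>+ (s\<^sub>1, s\<^sub>2). ennreal (bw_sq s\<^sub>1 s\<^sub>2) \<partial>\<pi>) = W_prm S \<mu>\<^sub>1 \<mu>\<^sub>2"
    by (rule W_prm_attained[OF pd assms(4) \<mu> ne])
  obtain \<nu> where "\<nu> \<in> couplings \<mu>\<^sub>1 \<mu>\<^sub>2 \<inter> GM_2n S" "transport_cost \<nu> = W_prm S \<mu>\<^sub>1 \<mu>\<^sub>2"
    using parameter_coupling_to_mixture_coupling[OF pd \<mu> \<pi>(1)] \<pi>(2) by metis
  then show ?thesis
    using W_mix_eq_W_prm[OF pd \<mu>] Gamma_S_finite_second_moment[OF assms(4)] by auto
qed

end
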